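(* Let $\bullet\in\{*,\mathrm{sh}\}$. For every nonnegative integer $n$, the following identity holds in $\mathcal{Z}[[t]]/t^3$ (with the convention $\zeta(1)=0$): \[ \zeta_{\mathcal{S}_3}^{\bullet}(\{1,3\}^n,1) =\frac{(-4)^{n+1}}{(4n+4)!}\pi^{4n+2}\,t+(-1)^n\sum_{n_0,n_1\ge0,\; n_0+n_1=2n+1}\frac{(-1)^{n_1}2^{n_0-n_1+2}}{(2n_0+2)!}\pi^{2n_0}\zeta(2n_1+1)\,t^2 . \]
   Context: An index is a finite (possibly empty) sequence of positive integers; it is admissible if it is empty or its last component is greater than $1$. $\{a,b\}^n$ denotes the $n$-fold repetition of $a,b$ (e.g. $(\{1,3\}^2,1)=(1,3,1,3,1)$). For an admissible index, $\zeta(k_1,\dots,k_r)=\sum_{1\le n_1<\dots<n_r}\frac{1}{n_1^{k_1}\cdots n_r^{k_r}}$, with $\zeta(\emptyset)=1$. $\mathcal{Z}\subset\mathbb{R}$ is the $\mathbb{Q}$-span of all these values (a $\mathbb{Q}$-algebra). Harmonic regularization $\zeta^*$: on the $\mathbb{Q}$-vector space $\mathcal{I}$ freely generated by all indices, define the bilinear product $*$ by $\boldsymbol{k}*\emptyset=\emptyset*\boldsymbol{k}=\boldsymbol{k}$ and $(\boldsymbol{k},k)*(\boldsymbol{l},l)=(\boldsymbol{k}*(\boldsymbol{l},l),k)+(\boldsymbol{k}*\boldsymbol{l},k+l)+((\boldsymbol{k},k)*\boldsymbol{l},l)$. Then $\zeta^*:\mathcal{I}\to\mathbb{R}$ is the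 unique $\mathbb{Q}$-linear map that is multiplicative for $*$, equals $\zeta$ on admissible indices, and satisfies $\zeta^*(1)=0$. Shuffle regularization $\zeta^{\mathrm{sh}}$: identify the index $(k_1,\dots,k_r)$ with the word $yx^{k_1-1}\cdots yx^{k_r-1}$ in $\mathbb{Q}+y\mathbb{Q}\langle x,y\rangle$, equipped with the shuffle product. Then $\zeta^{\mathrm{sh}}$ is the unique $\mathbb{Q}$-linear map that is multiplicative for the shuffle product, equals $\zeta$ on admissible indices, and satisfies $\zeta^{\mathrm{sh}}(1)=0$. Both maps take values in $\mathcal{Z}$. For $\bullet\in\{*,\mathrm{sh}\}$, an index $(k_1,\dots,k_r)$ and $m\ge0$ put \[\zeta_m^{\bullet}(k_1,\dots,k_r)=\sum_{l_1,\dots,l_r\ge0,\; l_1+\dots+l_r=m}\zeta^{\bullet}(k_1+l_1,\dots,k_r+l_r)\prod_{i=1}^r\binom{k_i+l_i-1}{l_i}\] (so $\zeta_0^\bullet(\emptyset)=1$ and $\zeta_m^\bullet(\emptyset)=0$ for $m\ge1$), and \[\zeta_{\widehat{\mathcal{S}}}^{\bullet}(k_1,\dots,k_r)=\sum_{i=0}^r(-1)^{k_{i+1}+\dots+k_r}\zeta^{\bullet}(k_1,\dots,k_i)\sum_{m\ge0}\zeta_m^{\bullet}(k_r,\dots,k_{i+1})t^m\in\mathcal{Z}[[t]].\] For $m\ge1$, $\zeta_{\mathcal{S}_m}^{\bullet}(\boldsymbol{k})$ is the image of $\zeta_{\widehat{\mathcal{S}}}^{\bullet}(\boldsymbol{k})$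 in $\mathcal{Z}[[t]]/t^m$. On the right-hand side of the claim, $\zeta(k)$ for $k\ge2$ is the Riemann zeta value, and $\zeta(1)$ is interpreted as $0$. *)

theory Defs
  imports
    "HOL-Analysis.Analysis"
    "HOL-Computational_Algebra.Formal_Power_Series"
    "HOL-Library.Poly_Mapping"
begin

section \<open>Indices and multiple zeta values\<close>

definition is_index :: "nat list \<Rightarrow> bool" where
  "is_index ks \<longleftrightarrow> (\<forall>k\<in>set ks. 0 < k)"

definition admissible :: "nat list \<Rightarrow> bool" where
  "admissible ks \<longleftrightarrow> is_index ks \<and> (ks = [] \<or> 1 < last ks)"

text \<open>The summation runs over the chains \<open>1 \<le> n\<^sub>1 < \<dots> < n\<^sub>r\<close>, encoded as lists.
  For the empty index the only chain is the empty list, so the value is 1.\<close>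

definition mzv :: "nat list \<Rightarrow> real" where
  "mzv ks = infsum (\<lambda>ns. \<Prod>i<length ks. 1 / real (ns ! i) ^ (ks ! i))
     {ns. length ns = length ks \<and> sorted_wrt (<) ns \<and> (\<forall>n\<in>set ns. 1 \<le> n)}"

definition mzv_space :: "real set" where
  "mzv_space = module.span (\<lambda>(q::rat) (x::real). of_rat q * x) (mzv ` {ks. admissible ks})"

section \<open>Formal rational linear combinations\<close>

text \<open>The rational vector space freely generated by a type \<open>'a\<close> is \<open>'a \<Rightarrow>\<^sub>0 rat\<close>; the
  basis vector of \<open>a\<close> is \<open>Poly_Mapping.single a 1\<close>.\<close>

definition qscale :: "rat \<Rightarrow> ('a \<Rightarrow>\<^sub>0 rat) \<Rightarrow> ('a \<Rightarrow>\<^sub>0 rat)" where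
  "qscale c u = Poly_Mapping.map ((*) c) u"

definition linear_ext :: "('a \<Rightarrow> ('b \<Rightarrow>\<^sub>0 rat)) \<Rightarrow> ('a \<Rightarrow>\<^sub>0 rat) \<Rightarrow> ('b \<Rightarrow>\<^sub>0 rat)" where
  "linear_ext g u = (\<Sum>a\<in>Poly_Mapping.keys u. qscale (Poly_Mapping.lookup u a) (g a))"

definition bilinear_ext ::
  "('a \<Rightarrow> 'a \<Rightarrow> ('b \<Rightarrow>\<^sub>0 rat)) \<Rightarrow> ('a \<Rightarrow>\<^sub>0 rat) \<Rightarrow> ('a \<Rightarrow>\<^sub>0 rat) \<Rightarrow> ('b \<Rightarrow>\<^sub>0 rat)" where
  "bilinear_ext g u v = linear_ext (\<lambda>a. linear_ext (\<lambda>b. g a b) v) u"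

definition qlinear_on :: "('a \<Rightarrow>\<^sub>0 rat) set \<Rightarrow> (('a \<Rightarrow>\<^sub>0 rat) \<Rightarrow> real) \<Rightarrow> bool" where
  "qlinear_on V f \<longleftrightarrow>
     (\<forall>u\<in>V. \<forall>v\<in>V. f (u + v) = f u + f v) \<and>
     (\<forall>c. \<forall>u\<in>V. f (qscale c u) = of_rat c * f u)"

section \<open>Harmonic regularization\<close>

definition index_space :: "(nat list \<Rightarrow>\<^sub>0 rat) set" where
  "index_space = {u. \<forall>ks\<in>Poly_Mapping.keys u. is_index ks}"

definition snoc_lin :: "nat \<Rightarrow> (nat list \<Rightarrow>\<^sub>0 rat) \<Rightarrow> (nat list \<Rightarrow>\<^sub>0 rat)" where
  "snoc_lin k = linear_ext (\<lambda>ks. Poly_Mapping.single (ks @ [k]) 1)"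

text \<open>The harmonic product of basis vectors recurses on the last components, so the auxiliary
  function takes its two indices in reversed order; the intended recursion is
  the lemma \<open>harmonic_basis_snoc\<close>.\<close>

fun harmonic_aux :: "nat list \<Rightarrow> nat list \<Rightarrow> (nat list \<Rightarrow>\<^sub>0 rat)" where
  "harmonic_aux [] ls = Poly_Mapping.single (rev ls) 1"
| "harmonic_aux ks [] = Poly_Mapping.single (rev ks) 1"
| "harmonic_aux (k # ks) (l # ls) =
     snoc_lin k (harmonic_aux ks (l # ls)) + snoc_lin (k + l) (harmonic_aux ks ls)
     + snoc_lin l (harmonic_aux (k # ks) ls)"

definition harmonic_basis :: "nat list \<Rightarrow> nat list \<Rightarrow> (nat list \<Rightarrow>\<^sub>0 rat)" where
  "harmonic_basis ks ls = harmonic_aux (rev ks) (rev ls)"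

lemma harmonic_basis_Nil:
  "harmonic_basis [] ls = Poly_Mapping.single ls 1"
  "harmonic_basis ks [] = Poly_Mapping.single ks 1"
  by (simp_all add: harmonic_basis_def) (cases "rev ks"; simp)

lemma harmonic_basis_snoc:
  "harmonic_basis (ks @ [k]) (ls @ [l]) =
     snoc_lin k (harmonic_basis ks (ls @ [l])) + snoc_lin (k + l) (harmonic_basis ks ls)
     + snoc_lin l (harmonic_basis (ks @ [k]) ls)"
  by (simp add: harmonic_basis_def)

definition harmonic_prod ::
  "(nat list \<Rightarrow>\<^sub>0 rat) \<Rightarrow> (nat list \<Rightarrow>\<^sub>0 rat) \<Rightarrow> (nat list \<Rightarrow>\<^sub>0 rat)" where
  "harmonic_prod = bilinear_ext harmonic_basis"

text \<open>Extensionality only fixes the junk values outside the domain, so that the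
  unique map on \<open>index_space\<close> is also unique as a function on the whole type.\<close>

definition is_harmonic_reg :: "((nat list \<Rightarrow>\<^sub>0 rat) \<Rightarrow> real) \<Rightarrow> bool" where
  "is_harmonic_reg f \<longleftrightarrow>
     f \<in> extensional index_space \<and>
     qlinear_on index_space f \<and>
     (\<forall>u\<in>index_space. \<forall>v\<in>index_space. f (harmonic_prod u v) = f u * f v) \<and>
     (\<forall>ks. admissible ks \<longrightarrow> f (Poly_Mapping.single ks 1) = mzv ks) \<and>
     f (Poly_Mapping.single [1] 1) = 0"

definition zeta_harmonic :: "nat list \<Rightarrow> real" where
  "zeta_harmonic ks = (THE f. is_harmonic_reg f) (Poly_Mapping.single ks 1)"

section \<open>Shuffle regularization\<close>

datatype letter = X | Y

definition word_of_index :: "nat list \<Rightarrow> letter list" where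
  "word_of_index ks = concat (map (\<lambda>k. Y # replicate (k - 1) X) ks)"

text \<open>The subspace \<open>\<rat> + y\<rat>\<langle>x,y\<rangle>\<close> of the free associative algebra \<open>\<rat>\<langle>x,y\<rangle>\<close>.\<close>

definition word_space :: "(letter list \<Rightarrow>\<^sub>0 rat) set" where
  "word_space = {u. \<forall>w\<in>Poly_Mapping.keys u. w = [] \<or> hd w = Y}"

definition cons_lin :: "letter \<Rightarrow> (letter list \<Rightarrow>\<^sub>0 rat) \<Rightarrow> (letter list \<Rightarrow>\<^sub>0 rat)" where
  "cons_lin a = linear_ext (\<lambda>w. Poly_Mapping.single (a # w) 1)"

text \<open>The library's \<open>shuffles\<close> is a set and forgets multiplicities, hence this definition.\<close>

fun shuffle_basis :: "letter list \<Rightarrow> letter list \<Rightarrow> (letter list \<Rightarrow>\<^sub>0 rat)" where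
  "shuffle_basis [] w = Poly_Mapping.single w 1"
| "shuffle_basis v [] = Poly_Mapping.single v 1"
| "shuffle_basis (a # v) (b # w) =
     cons_lin a (shuffle_basis v (b # w)) + cons_lin b (shuffle_basis (a # v) w)"

definition shuffle_prod ::
  "(letter list \<Rightarrow>\<^sub>0 rat) \<Rightarrow> (letter list \<Rightarrow>\<^sub>0 rat) \<Rightarrow> (letter list \<Rightarrow>\<^sub>0 rat)" where
  "shuffle_prod = bilinear_ext shuffle_basis"

definition is_shuffle_reg :: "((letter list \<Rightarrow>\<^sub>0 rat) \<Rightarrow> real) \<Rightarrow> bool" where
  "is_shuffle_reg f \<longleftrightarrow>
     f \<in> extensional word_space \<and>
     qlinear_on word_space f \<and>
     (\<forall>u\<in>word_space. \<forall>v\<in>word_space. f (shuffle_prod u v) = f u * f v) \<and>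
     (\<forall>ks. admissible ks \<longrightarrow> f (Poly_Mapping.single (word_of_index ks) 1) = mzv ks) \<and>
     f (Poly_Mapping.single (word_of_index [1]) 1) = 0"

definition zeta_shuffle :: "nat list \<Rightarrow> real" where
  "zeta_shuffle ks = (THE f. is_shuffle_reg f) (Poly_Mapping.single (word_of_index ks) 1)"

section \<open>Symmetric multiple zeta values\<close>

datatype regularization = Harmonic | Shuffle

fun zeta_reg :: "regularization \<Rightarrow> nat list \<Rightarrow> real" where
  "zeta_reg Harmonic = zeta_harmonic"
| "zeta_reg Shuffle = zeta_shuffle"

definition zeta_shift :: "regularization \<Rightarrow> nat \<Rightarrow> nat list \<Rightarrow> real" where
  "zeta_shift b m ks =
     (\<Sum>ls | length ls = length ks \<and> sum_list ls = m.
        zeta_reg b (map2 (+) ks ls) *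
        (\<Prod>i<length ks. real ((ks ! i + ls ! i - 1) choose (ls ! i))))"

definition zeta_S_hat :: "regularization \<Rightarrow> nat list \<Rightarrow> real fps" where
  "zeta_S_hat b ks =
     (\<Sum>i\<le>length ks.
        fps_const ((-1) ^ sum_list (drop i ks) * zeta_reg b (take i ks)) *
        Abs_fps (\<lambda>m. zeta_shift b m (rev (drop i ks))))"

text \<open>The residue class in \<open>Z[[t]]/t\<^sup>m\<close>, where \<open>Z\<close> stands for \<open>mzv_space\<close>, is the
  coset of the ideal \<open>t\<^sup>m Z[[t]]\<close>. Equality of the classes of two power series with
  real coefficients means that their difference lies in this ideal.\<close>

definition mzv_fps :: "real fps set" where
  "mzv_fps = {f. \<forall>i. fps_nth f i \<in> mzv_space}"

definition residue_class :: "nat \<Rightarrow> real fps \<Rightarrow> real fps set" where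
  "residue_class m f = {f + fps_X ^ m * h | h. h \<in> mzv_fps}"

definition zeta_S :: "regularization \<Rightarrow> nat \<Rightarrow> nat list \<Rightarrow> real fps set" where
  "zeta_S b m ks = residue_class m (zeta_S_hat b ks)"

text \<open>Convention: the value at 1 is 0.\<close>

definition riemann_zeta :: "nat \<Rightarrow> real" where
  "riemann_zeta k = (if k = 1 then 0 else suminf (\<lambda>j. 1 / real (Suc j) ^ k))"

end

theory Submission
  imports Defs "HOL-Real_Asymp.Real_Asymp"
begin

text \<open>
  Both regularizations are constant terms: the truncated sums at \<open>N\<close> are polynomials in the
  harmonic number \<open>H\<^sub>N\<close> up to a negligible error, the multiple polylogarithms at \<open>z < 1\<close> are
  polynomials in \<open>- ln (1 - z)\<close>, and taking constant terms is multiplicative. The two agree on the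
  indices occurring below, which have at most one trailing 1.

  Up to a constant factor, the coefficient of \<open>t\<^sup>m\<close> is therefore the constant term of the coefficient of
  \<open>x\<^sup>2\<^sup>n\<^sup>+\<^sup>1\<close> in \<open>G\<^sub>0 E\<^sub>m - E\<^sub>0 G\<^sub>m\<close>, where \<open>E\<close> and \<open>G\<close> collect the polylogarithms of the prefixes
  of even and odd length of \<open>1, 3, 1, 3, \<dots>\<close> with denominators \<open>n - t\<close>. Modulo \<open>t\<^sup>3\<close> the
  differential system for \<open>(E, G)\<close> is homogeneous and is solved by products of solutions of
  \<open>(1 - z) \<theta>\<^sup>2 y = - x z y\<close> and \<open>(1 - z) \<theta>\<^sup>2 y = x z y\<close>, with \<open>\<theta> = z d/dz\<close>. If \<open>P\<close> and
  \<open>P log z + Q\<close> are the Frobenius solutions of the first equation and \<open>P'\<close>, \<open>Q'\<close> belong to the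
  second one, the constancy of the Wronskian reduces the two combinations to
  \<open>(P'\<^sup>2 - P\<^sup>2) / 2\<close> and \<open>(P Q - P' Q') / 2\<close>. Their values at 1 come from
  \<open>P = \<Prod> (1 - x / k\<^sup>2)\<close> and \<open>Q = 2 P \<Sum> x\<^sup>k \<zeta>(2k + 1)\<close>.
\<close>

section \<open>Linear extension to formal combinations\<close>

text \<open>The index has odd length, is a palindrome and has only odd entries: a reversed suffix is
  again a prefix, and its sign depends only on the parity of its length. This gives the symmetric
  sum the shape of a Wronskian. A shift weighted with the binomials is the
  \<open>t\<close>-expansion of \<open>1/(n - t)^k\<close>, so appending \<open>k\<close> to an
  index means multiplying by \<open>z/(1-z)\<close> and inverting \<open>(\<theta> - t)^k\<close>.
  The only inhomogeneous term comes from the empty index: \<open>(\<theta> - t)^3 1 = - t^3\<close>,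
  which is why one works modulo \<open>t^3\<close>. Writing the unknowns as \<open>z^t F\<close> and
  \<open>z^t H\<close> and rescaling the depth leaves \<open>\<theta>^3 F = 2 x z/(1-z) H\<close>
  and \<open>\<theta> H = - 2 x z/(1-z) F\<close>. If \<open>y\<close> and \<open>w\<close> solve
  the two second-order equations, then \<open>F = y w\<close> and
  \<open>H = (\<theta> y) w - y (\<theta> w)\<close> solve this system, because the right-hand sides
  of the two equations have opposite signs. Both equations have the double exponent 0 at
  \<open>z = 0\<close>; the logarithms in their second solutions cancel against the expansion of
  \<open>z^t\<close>, so that only power series remain.\<close>

locale rat_embedding =
  fixes e :: "rat \<Rightarrow> 'v::comm_ring_1"
  assumes e_add: "e (a + b) = e a + e b"
    and e_mult: "e (a * b) = e a * e b"
    and e_one: "e 1 = 1"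
begin

lemma e_zero: "e 0 = 0"
  using e_add[of 0 0] by simp

definition lin :: "('a \<Rightarrow> 'v) \<Rightarrow> ('a \<Rightarrow>\<^sub>0 rat) \<Rightarrow> 'v" where
  "lin F u = (\<Sum>a\<in>Poly_Mapping.keys u. e (Poly_Mapping.lookup u a) * F a)"

lemma lin_superset:
  assumes "finite A" "Poly_Mapping.keys u \<subseteq> A"
  shows "lin F u = (\<Sum>a\<in>A. e (Poly_Mapping.lookup u a) * F a)"
  unfolding lin_def using assms by (intro sum.mono_neutral_left) (auto simp: in_keys_iff e_zero)

lemma lin_cong:
  assumes "\<And>a. a \<in> Poly_Mapping.keys u \<Longrightarrow> F a = G a"
  shows "lin F u = lin G u"
  unfolding lin_def using assms by (intro sum.cong) auto

lemma lin_zero [simp]: "lin F 0 = 0"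
  by (simp add: lin_def)

lemma lin_single [simp]: "lin F (Poly_Mapping.single a c) = e c * F a"
  by (subst lin_superset[of "{a}"]) auto

lemma lin_add: "lin F (u + v) = lin F u + lin F v"
proof -
  let ?A = "Poly_Mapping.keys u \<union> Poly_Mapping.keys v"
  have "Poly_Mapping.keys (u + v) \<subseteq> ?A"
    by (rule keys_add)
  then show ?thesis
    by (simp add: lin_superset[of ?A] lookup_add e_add algebra_simps sum.distrib)
qed

lemma lin_sum: "lin F (sum f A) = (\<Sum>x\<in>A. lin F (f x))"
  by (induction A rule: infinite_finite_induct) (simp_all add: lin_add)

end

text \<open>The three targets are the coefficients of formal combinations, real values of basis
  elements, and power series such as polylogarithms.\<close>

interpretation rat_lin: rat_embedding "\<lambda>q::rat. q"
  by unfold_locales auto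

interpretation real_lin: rat_embedding "of_rat :: rat \<Rightarrow> real"
  by unfold_locales (auto simp: of_rat_add of_rat_mult)

interpretation fps_lin: rat_embedding "\<lambda>q. fps_const (of_rat q) :: real fps"
  by unfold_locales (auto simp: of_rat_add of_rat_mult)

lemma lookup_qscale [simp]: "Poly_Mapping.lookup (qscale c u) a = c * Poly_Mapping.lookup u a"
  by (simp add: qscale_def map.rep_eq when_def)

lemma keys_qscale_subset: "Poly_Mapping.keys (qscale c u) \<subseteq> Poly_Mapping.keys u"
  by (rule subsetI) (simp add: in_keys_iff)

lemma qscale_one [simp]: "qscale 1 u = u"
  by (rule poly_mapping_eqI) simp

lemma qscale_zero: "qscale c 0 = 0"
  by (rule poly_mapping_eqI) simp

lemma qscale_qscale [simp]: "qscale c (qscale d u) = qscale (c * d) u"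
  by (rule poly_mapping_eqI) simp

lemma qscale_single [simp]: "qscale c (Poly_Mapping.single a d) = Poly_Mapping.single a (c * d)"
  by (rule poly_mapping_eqI) (simp add: lookup_single when_def)

lemma (in rat_embedding) lin_qscale [simp]: "lin F (qscale c u) = e c * lin F u"
  by (subst lin_superset[OF finite_keys keys_qscale_subset])
    (simp add: lin_def e_mult sum_distrib_left mult.assoc)

lemma (in rat_embedding) lin_linear_ext: "lin F (linear_ext g u) = lin (\<lambda>a. lin F (g a)) u"
  by (simp add: linear_ext_def lin_sum) (simp add: lin_def)

lemma lookup_linear_ext:
  "Poly_Mapping.lookup (linear_ext g u) b = rat_lin.lin (\<lambda>a. Poly_Mapping.lookup (g a) b) u"
  by (simp add: linear_ext_def rat_lin.lin_def lookup_sum)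

lemma linear_ext_add: "linear_ext g (u + v) = linear_ext g u + linear_ext g v"
  by (rule poly_mapping_eqI) (simp add: lookup_linear_ext lookup_add rat_lin.lin_add)

lemma linear_ext_single [simp]: "linear_ext g (Poly_Mapping.single a c) = qscale c (g a)"
  by (rule poly_mapping_eqI) (simp add: lookup_linear_ext)

lemma keys_linear_ext_subset:
  "Poly_Mapping.keys (linear_ext g u) \<subseteq> (\<Union>a\<in>Poly_Mapping.keys u. Poly_Mapping.keys (g a))"
  unfolding linear_ext_def by (rule order_trans[OF keys_sum UN_mono[OF subset_refl keys_qscale_subset]])

lemma keys_bilinear_ext_subset:
  "Poly_Mapping.keys (bilinear_ext g u v) \<subseteq>
     (\<Union>a\<in>Poly_Mapping.keys u. \<Union>b\<in>Poly_Mapping.keys v. Poly_Mapping.keys (g a b))"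
  unfolding bilinear_ext_def
  by (rule order_trans[OF keys_linear_ext_subset UN_mono[OF subset_refl keys_linear_ext_subset]])

lemma bilinear_ext_single [simp]:
  "bilinear_ext g (Poly_Mapping.single a c) (Poly_Mapping.single b d) = qscale (c * d) (g a b)"
  by (simp add: bilinear_ext_def)

lemma (in rat_embedding) lin_bilinear_ext:
  assumes "\<And>a b. a \<in> Poly_Mapping.keys u \<Longrightarrow> b \<in> Poly_Mapping.keys v \<Longrightarrow> lin F (g a b) = F a * F b"
  shows "lin F (bilinear_ext g u v) = lin F u * lin F v"
proof -
  have "lin F (bilinear_ext g u v) = lin (\<lambda>a. lin (\<lambda>b. F a * F b) v) u"
    unfolding bilinear_ext_def lin_linear_ext using assms by (intro lin_cong) auto
  also have "\<dots> = lin F u * lin F v"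
    unfolding lin_def sum_product by (simp add: sum_distrib_left mult_ac)
  finally show ?thesis .
qed

definition supp_in :: "('a \<Rightarrow> bool) \<Rightarrow> ('a \<Rightarrow>\<^sub>0 rat) set" where
  "supp_in S = {u. \<forall>a\<in>Poly_Mapping.keys u. S a}"

lemma index_space_eq: "index_space = supp_in is_index"
  by (simp add: index_space_def supp_in_def)

lemma word_space_eq: "word_space = supp_in (\<lambda>w. w = [] \<or> hd w = Y)"
  by (simp add: word_space_def supp_in_def)

lemma supp_in_zero [simp]: "0 \<in> supp_in S"
  by (simp add: supp_in_def)

lemma supp_in_single: "S a \<Longrightarrow> Poly_Mapping.single a c \<in> supp_in S"
  by (simp add: supp_in_def)

lemma supp_in_add: "u \<in> supp_in S \<Longrightarrow> v \<in> supp_in S \<Longrightarrow> u + v \<in> supp_in S"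
  unfolding supp_in_def using keys_add[of u v] by blast

lemma supp_in_qscale: "u \<in> supp_in S \<Longrightarrow> qscale c u \<in> supp_in S"
  unfolding supp_in_def using keys_qscale_subset[of c u] by blast

lemma supp_in_linear_ext:
  assumes "u \<in> supp_in S" "\<And>a. S a \<Longrightarrow> g a \<in> supp_in S'"
  shows "linear_ext g u \<in> supp_in S'"
  using assms keys_linear_ext_subset[of g u] unfolding supp_in_def by blast

lemma supp_in_bilinear_ext:
  assumes "u \<in> supp_in S" "v \<in> supp_in S" "\<And>a b. S a \<Longrightarrow> S b \<Longrightarrow> g a b \<in> supp_in S"
  shows "bilinear_ext g u v \<in> supp_in S"
  using assms keys_bilinear_ext_subset[of g u v] unfolding supp_in_def by blast

lemma supp_in_mono: "u \<in> supp_in S \<Longrightarrow> (\<And>a. S a \<Longrightarrow> S' a) \<Longrightarrow> u \<in> supp_in S'"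
  by (auto simp: supp_in_def)

lemma poly_mapping_decomp: "u = (\<Sum>a\<in>Poly_Mapping.keys u. qscale (Poly_Mapping.lookup u a) (Poly_Mapping.single a 1))"
proof (rule poly_mapping_eqI)
  fix b
  have "Poly_Mapping.lookup (\<Sum>a\<in>Poly_Mapping.keys u. qscale (Poly_Mapping.lookup u a) (Poly_Mapping.single a 1)) b
      = (\<Sum>a\<in>Poly_Mapping.keys u. if a = b then Poly_Mapping.lookup u a else 0)"
    unfolding lookup_sum by (intro sum.cong refl) (auto simp: lookup_single when_def)
  also have "\<dots> = (if b \<in> Poly_Mapping.keys u then Poly_Mapping.lookup u b else 0)"
    by (rule sum.delta) (rule finite_keys)
  also have "\<dots> = Poly_Mapping.lookup u b"
    by (simp add: in_keys_iff)
  finally show "Poly_Mapping.lookup u b = Poly_Mapping.lookup (\<Sum>a\<in>Poly_Mapping.keys u. qscale (Poly_Mapping.lookup u a) (Poly_Mapping.single a 1)) b" ..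
qed

lemma supp_in_induct:
  assumes u: "u \<in> supp_in S"
    and zero: "Pd 0"
    and single: "\<And>a. S a \<Longrightarrow> Pd (Poly_Mapping.single a 1)"
    and add: "\<And>u v. u \<in> supp_in S \<Longrightarrow> v \<in> supp_in S \<Longrightarrow> Pd u \<Longrightarrow> Pd v \<Longrightarrow> Pd (u + v)"
    and scale: "\<And>c u. u \<in> supp_in S \<Longrightarrow> Pd u \<Longrightarrow> Pd (qscale c u)"
  shows "Pd u"
proof -
  let ?f = "\<lambda>a. qscale (Poly_Mapping.lookup u a) (Poly_Mapping.single a 1)"
  have "sum ?f A \<in> supp_in S \<and> Pd (sum ?f A)" if "finite A" "A \<subseteq> Poly_Mapping.keys u" for A
    using that
  proof (induction A rule: finite_induct)
    case empty
    then show ?case using zero by simp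
  next
    case (insert a A)
    then have "S a" using u by (auto simp: supp_in_def)
    then have "Poly_Mapping.single a 1 \<in> supp_in S" "Pd (Poly_Mapping.single a 1)"
      using single supp_in_single by metis+
    then have "?f a \<in> supp_in S" "Pd (?f a)"
      using scale supp_in_qscale by metis+
    then show ?case
      using insert add[of "?f a" "sum ?f A"] supp_in_add[of "?f a" S "sum ?f A"] by simp
  qed
  from this[of "Poly_Mapping.keys u"] show ?thesis
    using poly_mapping_decomp[of u] by simp
qed

text \<open>A space whose basis is filtered by \<open>d\<close> is spanned by \<open>d = 0\<close> and the images of an operator
  \<open>\<Phi>\<close> raising the degree by one with nonzero leading coefficient.\<close>

lemma filtered_span_induct:
  fixes d :: "'a \<Rightarrow> nat"
  assumes u: "u \<in> supp_in S"
    and base: "\<And>a. S a \<Longrightarrow> d a = 0 \<Longrightarrow> Pd (Poly_Mapping.single a 1)"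
    and add: "\<And>u v. u \<in> supp_in S \<Longrightarrow> v \<in> supp_in S \<Longrightarrow> Pd u \<Longrightarrow> Pd v \<Longrightarrow> Pd (u + v)"
    and scale: "\<And>c u. u \<in> supp_in S \<Longrightarrow> Pd u \<Longrightarrow> Pd (qscale c u)"
    and step: "\<And>u. u \<in> supp_in S \<Longrightarrow> Pd u \<Longrightarrow> Pd (\<Phi> u)"
    and closed: "\<And>u. u \<in> supp_in S \<Longrightarrow> \<Phi> u \<in> supp_in S"
    and lead: "\<And>a n. S a \<Longrightarrow> d a = Suc n \<Longrightarrow> \<exists>b c r. S b \<and> d b = n \<and> c \<noteq> 0 \<and>
        r \<in> supp_in (\<lambda>x. S x \<and> d x \<le> n) \<and>
        \<Phi> (Poly_Mapping.single b 1) = Poly_Mapping.single a c + r"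
    and zero: "Pd 0"
  shows "Pd u"
proof -
  have *: "Pd (Poly_Mapping.single a 1)" if "S a" for a
    using that
  proof (induction "d a" arbitrary: a rule: less_induct)
    case less
    show ?case
    proof (cases "d a")
      case 0
      then show ?thesis using base less.prems by blast
    next
      case (Suc n)
      obtain b c r where b: "S b" "d b = n" "c \<noteq> 0"
        and r: "r \<in> supp_in (\<lambda>x. S x \<and> d x \<le> n)"
        and eq: "\<Phi> (Poly_Mapping.single b 1) = Poly_Mapping.single a c + r"
        using lead[OF less.prems Suc] by blast
      have sub: "u \<in> supp_in S" if "u \<in> supp_in (\<lambda>x. S x \<and> d x \<le> n)" for u
        using that by (rule supp_in_mono) simp
      have Pr: "Pd r"
        using r
      proof (rule supp_in_induct)
        show "Pd (Poly_Mapping.single x 1)" if "S x \<and> d x \<le> n" for x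
          using that less Suc by simp
      qed (use zero add scale sub in auto)
      have b1: "Poly_Mapping.single b 1 \<in> supp_in S"
        using b by (simp add: supp_in_single)
      have Pb: "Pd (Poly_Mapping.single b 1)"
        using less(1)[of b] b Suc by simp
      \<comment> \<open>The leading-term equation is solved for the basis vector of
        \<open>a\<close>; \<open>b\<close> and the remainder have degree below \<open>d a\<close>,
        so the induction hypothesis covers both.\<close>
      have "Poly_Mapping.single a 1 =
          qscale (1 / c) (\<Phi> (Poly_Mapping.single b 1) + qscale (-1) r)"
        using b(3) by (intro poly_mapping_eqI) (simp add: eq lookup_add lookup_single when_def)
      also have "Pd \<dots>"
        using b1 Pb Pr r by (intro scale add supp_in_add supp_in_qscale step closed sub[OF r])
      finally show ?thesis .
    qed
  qed
  show ?thesis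
    using u by (rule supp_in_induct) (use zero add scale * in auto)
qed

section \<open>Polynomial asymptotics along a divergent scale\<close>

text \<open>Used with \<open>T = harm\<close> for \<open>N\<close> tending to infinity and with
  \<open>T = log1m\<close> for \<open>z\<close> tending to 1 from the left.\<close>

locale log_scale =
  fixes Fl :: "'a filter" and T :: "'a \<Rightarrow> real"
  assumes Fl_nontrivial: "Fl \<noteq> bot"
    and T_at_top: "filterlim T at_top Fl"
begin

text \<open>Convergence to 0 alone would not survive multiplication by a polynomial in
  \<open>T\<close>; decay against every power makes constant terms multiplicative.\<close>

definition negligible :: "('a \<Rightarrow> real) \<Rightarrow> bool" where
  "negligible f \<longleftrightarrow> (\<forall>m. ((\<lambda>v. f v * T v ^ m) \<longlongrightarrow> 0) Fl)"

lemma negligible_tendsto: "negligible f \<Longrightarrow> (f \<longlongrightarrow> 0) Fl"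
  unfolding negligible_def by (drule spec[of _ 0]) simp

lemma negligible_zero [simp]: "negligible (\<lambda>v. 0)"
  by (simp add: negligible_def)

lemma negligible_add: "negligible f \<Longrightarrow> negligible g \<Longrightarrow> negligible (\<lambda>v. f v + g v)"
  unfolding negligible_def by (auto simp: algebra_simps intro: tendsto_add_zero)

lemma negligible_cmult: "negligible f \<Longrightarrow> negligible (\<lambda>v. c * f v)"
  unfolding negligible_def by (auto simp: mult.assoc intro: tendsto_mult_right_zero)

lemma negligible_mult: "negligible f \<Longrightarrow> negligible g \<Longrightarrow> negligible (\<lambda>v. f v * g v)"
  unfolding negligible_def
proof (intro allI)
  fix m
  assume f: "\<forall>m. ((\<lambda>v. f v * T v ^ m) \<longlongrightarrow> 0) Fl" and g: "\<forall>m. ((\<lambda>v. g v * T v ^ m) \<longlongrightarrow> 0) Fl"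
  have "((\<lambda>v. (f v * T v ^ m) * (g v * T v ^ 0)) \<longlongrightarrow> 0) Fl"
    by (rule tendsto_mult_zero) (use f g in blast)+
  then show "((\<lambda>v. f v * g v * T v ^ m) \<longlongrightarrow> 0) Fl"
    by (simp add: mult_ac)
qed

lemma negligible_mult_T: "negligible f \<Longrightarrow> negligible (\<lambda>v. f v * T v)"
  unfolding negligible_def
proof (intro allI)
  fix m
  assume "\<forall>m. ((\<lambda>v. f v * T v ^ m) \<longlongrightarrow> 0) Fl"
  then have "((\<lambda>v. f v * T v ^ Suc m) \<longlongrightarrow> 0) Fl"
    by blast
  then show "((\<lambda>v. f v * T v * T v ^ m) \<longlongrightarrow> 0) Fl"
    by (simp add: mult_ac)
qed

lemma negligible_mult_poly: "negligible f \<Longrightarrow> negligible (\<lambda>v. f v * poly p (T v))"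
proof (induction p)
  case (pCons a p)
  then have "negligible (\<lambda>v. a * f v + (f v * poly p (T v)) * T v)"
    by (intro negligible_add negligible_cmult negligible_mult_T)
  then show ?case
    by (simp add: algebra_simps)
qed simp

lemma negligible_cong:
  assumes "eventually (\<lambda>v. f v = g v) Fl"
  shows "negligible f \<longleftrightarrow> negligible g"
  unfolding negligible_def
  by (intro all_cong1 tendsto_cong) (use assms in eventually_elim, simp)

definition asym :: "('a \<Rightarrow> real) \<Rightarrow> real poly \<Rightarrow> bool" where
  "asym f p \<longleftrightarrow> negligible (\<lambda>v. f v - poly p (T v))"

lemma asym_cong:
  assumes "eventually (\<lambda>v. f v = g v) Fl"
  shows "asym f p \<longleftrightarrow> asym g p"
  unfolding asym_def by (intro negligible_cong) (use assms in eventually_elim, simp)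

lemma asym_poly: "asym (\<lambda>v. poly p (T v)) p"
  by (simp add: asym_def)

lemma asym_add:
  assumes "asym f p" "asym g q"
  shows "asym (\<lambda>v. f v + g v) (p + q)"
  using negligible_add[OF assms[unfolded asym_def]] by (simp add: asym_def algebra_simps)

lemma asym_mult:
  assumes "asym f p" "asym g q"
  shows "asym (\<lambda>v. f v * g v) (p * q)"
proof -
  have f: "negligible (\<lambda>v. f v - poly p (T v))" and g: "negligible (\<lambda>v. g v - poly q (T v))"
    using assms by (simp_all add: asym_def)
  have "negligible (\<lambda>v. (f v - poly p (T v)) * (g v - poly q (T v))
      + ((f v - poly p (T v)) * poly q (T v) + (g v - poly q (T v)) * poly p (T v)))"
    by (intro negligible_add negligible_mult negligible_mult_poly f g)
  then show ?thesis
    by (simp add: asym_def algebra_simps)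
qed

text \<open>Up to sign a nonzero polynomial eventually stays above its positive leading coefficient.
  Hence a function has at most one asymptotic polynomial.\<close>

lemma poly_T_tendsto_0_imp_0:
  assumes "((\<lambda>v. poly p (T v)) \<longlongrightarrow> 0) Fl"
  shows "p = 0"
proof (rule ccontr)
  have pos: False if p: "lead_coeff p > 0" "((\<lambda>v. poly p (T v)) \<longlongrightarrow> 0) Fl" for p :: "real poly"
  proof -
    obtain n where n: "\<And>x. x \<ge> n \<Longrightarrow> lead_coeff p \<le> poly p x"
      using poly_pinfty_gt_lc[OF p(1)] by blast
    have "eventually (\<lambda>v. T v \<ge> n) Fl"
      using T_at_top by (simp add: filterlim_at_top)
    moreover have "eventually (\<lambda>v. poly p (T v) < lead_coeff p) Fl"
      using p by (intro order_tendstoD(2)[of _ 0]) auto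
    ultimately have "eventually (\<lambda>v. False) Fl"
      by eventually_elim (use n in force)
    then show False
      using Fl_nontrivial by (simp add: trivial_limit_def)
  qed
  assume "p \<noteq> 0"
  then have "lead_coeff p > 0 \<or> lead_coeff (- p) > 0"
    using leading_coeff_neq_0[of p] unfolding lead_coeff_minus by linarith
  then show False
    using pos[of p] pos[of "- p"] assms tendsto_minus[OF assms] by auto
qed

text \<open>Once some expansion is known to exist, convergence without any rate identifies
  it.\<close>

lemma asym_imp_eq:
  assumes "asym f p" "((\<lambda>v. f v - poly q (T v)) \<longlongrightarrow> 0) Fl"
  shows "p = q"
proof -
  have "((\<lambda>v. (f v - poly q (T v)) - (f v - poly p (T v))) \<longlongrightarrow> 0 - 0) Fl"
    using assms negligible_tendsto by (intro tendsto_diff) (auto simp: asym_def)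
  then have "((\<lambda>v. poly (p - q) (T v)) \<longlongrightarrow> 0) Fl"
    by simp
  then show ?thesis
    using poly_T_tendsto_0_imp_0[of "p - q"] by simp
qed

lemma asym_unique: "asym f p \<Longrightarrow> asym f q \<Longrightarrow> p = q"
  by (rule asym_imp_eq) (auto simp: asym_def dest: negligible_tendsto)

definition has_asym :: "('a \<Rightarrow> real) \<Rightarrow> bool" where
  "has_asym f \<longleftrightarrow> (\<exists>p. asym f p)"

definition const_term :: "('a \<Rightarrow> real) \<Rightarrow> real" where
  "const_term f = coeff (THE p. asym f p) 0"

lemma const_term_eq: "asym f p \<Longrightarrow> const_term f = coeff p 0"
  unfolding const_term_def using asym_unique by (subst the_equality[of _ p]) auto

lemma has_asymI: "asym f p \<Longrightarrow> has_asym f"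
  by (auto simp: has_asym_def)

lemma has_asym_const [simp]: "has_asym (\<lambda>v. c)"
  and const_term_const [simp]: "const_term (\<lambda>v. c) = c"
  using has_asymI[OF asym_poly[of "[:c:]"]] const_term_eq[OF asym_poly[of "[:c:]"]] by simp_all

lemma has_asym_T: "has_asym T"
  and const_term_T: "const_term T = 0"
  using has_asymI[OF asym_poly[of "[:0, 1:]"]] const_term_eq[OF asym_poly[of "[:0, 1:]"]] by simp_all

lemma
  assumes "has_asym f" "has_asym g"
  shows has_asym_add: "has_asym (\<lambda>v. f v + g v)"
    and const_term_add: "const_term (\<lambda>v. f v + g v) = const_term f + const_term g"
    and has_asym_mult: "has_asym (\<lambda>v. f v * g v)"
    and const_term_mult: "const_term (\<lambda>v. f v * g v) = const_term f * const_term g"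
proof -
  obtain p q where p: "asym f p" and q: "asym g q"
    using assms unfolding has_asym_def by blast
  note * = asym_add[OF p q] asym_mult[OF p q]
  show "has_asym (\<lambda>v. f v + g v)" "has_asym (\<lambda>v. f v * g v)"
    using * by (blast intro: has_asymI)+
  show "const_term (\<lambda>v. f v + g v) = const_term f + const_term g"
    "const_term (\<lambda>v. f v * g v) = const_term f * const_term g"
    using *[THEN const_term_eq] p[THEN const_term_eq] q[THEN const_term_eq]
    by (simp_all add: coeff_mult)
qed

lemma
  assumes "has_asym f"
  shows has_asym_cmult: "has_asym (\<lambda>v. c * f v)"
    and const_term_cmult: "const_term (\<lambda>v. c * f v) = c * const_term f"
  using has_asym_mult[OF has_asym_const[of c] assms] const_term_mult[OF has_asym_const[of c] assms]
  by simp_all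

lemma has_asym_cong:
  assumes "eventually (\<lambda>v. f v = g v) Fl"
  shows "has_asym f \<longleftrightarrow> has_asym g" "const_term f = const_term g"
proof -
  have "asym f = asym g"
    using asym_cong[OF assms] by blast
  then show "has_asym f \<longleftrightarrow> has_asym g" "const_term f = const_term g"
    unfolding has_asym_def const_term_def by simp_all
qed

lemma has_asym_tendsto_const:
  assumes "negligible (\<lambda>v. f v - c)"
  shows "has_asym f" "const_term f = c"
proof -
  have "asym f [:c:]"
    using assms by (simp add: asym_def)
  then show "has_asym f" "const_term f = c"
    using const_term_eq by (auto intro: has_asymI)
qed

lemma asym_sum:
  assumes "\<And>x. x \<in> A \<Longrightarrow> has_asym (f x)"
  shows "has_asym (\<lambda>v. \<Sum>x\<in>A. f x v)"
    and "const_term (\<lambda>v. \<Sum>x\<in>A. f x v) = (\<Sum>x\<in>A. const_term (f x))"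
proof -
  have "has_asym (\<lambda>v. \<Sum>x\<in>A. f x v) \<and> const_term (\<lambda>v. \<Sum>x\<in>A. f x v) = (\<Sum>x\<in>A. const_term (f x))"
    using assms by (induction A rule: infinite_finite_induct) (simp_all add: has_asym_add const_term_add)
  then show "has_asym (\<lambda>v. \<Sum>x\<in>A. f x v)"
    "const_term (\<lambda>v. \<Sum>x\<in>A. f x v) = (\<Sum>x\<in>A. const_term (f x))"
    by blast+
qed

definition reg_lin :: "('b \<Rightarrow> 'a \<Rightarrow> real) \<Rightarrow> ('b \<Rightarrow>\<^sub>0 rat) \<Rightarrow> real" where
  "reg_lin F u = real_lin.lin (\<lambda>a. const_term (F a)) u"

lemma has_asym_lin:
  assumes "\<And>a. a \<in> Poly_Mapping.keys u \<Longrightarrow> has_asym (F a)"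
  shows "has_asym (\<lambda>v. real_lin.lin (\<lambda>a. F a v) u)"
    and "const_term (\<lambda>v. real_lin.lin (\<lambda>a. F a v) u) = reg_lin F u"
  using assms unfolding real_lin.lin_def reg_lin_def
  by (simp_all add: asym_sum has_asym_cmult const_term_cmult)

text \<open>The product rule holds exactly for the functions \<open>F a\<close> near the limit, and
  passing to constant terms respects both linear combinations and products.\<close>

lemma reg_lin_bilinear_ext:
  assumes F: "\<And>a. S a \<Longrightarrow> has_asym (F a)"
    and mult: "\<And>a b. S a \<Longrightarrow> S b \<Longrightarrow>
      eventually (\<lambda>v. real_lin.lin (\<lambda>c. F c v) (g a b) = F a v * F b v) Fl"
    and closed: "\<And>a b. S a \<Longrightarrow> S b \<Longrightarrow> g a b \<in> supp_in S"
    and u: "u \<in> supp_in S" and v: "v \<in> supp_in S"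
  shows "reg_lin F (bilinear_ext g u v) = reg_lin F u * reg_lin F v"
  unfolding reg_lin_def
proof (rule real_lin.lin_bilinear_ext)
  fix a b
  assume "a \<in> Poly_Mapping.keys u" "b \<in> Poly_Mapping.keys v"
  then have ab: "S a" "S b"
    using u v by (auto simp: supp_in_def)
  have keys: "has_asym (F c)" if "c \<in> Poly_Mapping.keys (g a b)" for c
    using that closed[OF ab] F by (auto simp: supp_in_def)
  have "real_lin.lin (\<lambda>c. const_term (F c)) (g a b) = const_term (\<lambda>v. real_lin.lin (\<lambda>c. F c v) (g a b))"
    using has_asym_lin(2)[of "g a b" F, OF keys] by (simp add: reg_lin_def)
  also have "\<dots> = const_term (\<lambda>v. F a v * F b v)"
    by (rule has_asym_cong(2)[OF mult[OF ab]])
  also have "\<dots> = const_term (F a) * const_term (F b)"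
    using ab F const_term_mult by blast
  finally show "real_lin.lin (\<lambda>c. const_term (F c)) (g a b) = const_term (F a) * const_term (F b)" .
qed

end

section \<open>Truncated multiple zeta sums\<close>

context rat_embedding begin

lemma lin_fun_add: "lin (\<lambda>a. F a + G a) u = lin F u + lin G u"
  by (simp add: lin_def algebra_simps sum.distrib)

lemma lin_fun_cmult: "lin (\<lambda>a. c * F a) u = c * lin F u"
  by (simp add: lin_def sum_distrib_left mult_ac)

lemma lin_fun_zero [simp]: "lin (\<lambda>a. 0) u = 0"
  by (simp add: lin_def)

lemma lin_snoc_lin: "lin F (snoc_lin k u) = lin (\<lambda>ks. F (ks @ [k])) u"
  by (simp add: snoc_lin_def lin_linear_ext e_one)

end

text \<open>The \<open>n\<close>-th Taylor coefficient of a multiple polylogarithm, that is, the sum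
  over chains whose largest entry is \<open>n\<close>. The index is reversed because the recursion
  removes its last component; the value 1 at \<open>n = 0\<close> for the empty index lets every
  chain start above 0.\<close>

fun rev_li_coeff :: "nat list \<Rightarrow> nat \<Rightarrow> real" where
  "rev_li_coeff [] n = (if n = 0 then 1 else 0)"
| "rev_li_coeff (k # ks) n = (\<Sum>j<n. rev_li_coeff ks j) / real n ^ k"

definition li_coeff :: "nat list \<Rightarrow> nat \<Rightarrow> real" where
  "li_coeff ks = rev_li_coeff (rev ks)"

definition hsum :: "nat list \<Rightarrow> nat \<Rightarrow> real" where
  "hsum ks N = (\<Sum>n\<le>N. li_coeff ks n)"

lemma li_coeff_Nil: "li_coeff [] n = (if n = 0 then 1 else 0)"
  by (simp add: li_coeff_def)

lemma li_coeff_snoc: "li_coeff (ks @ [k]) n = (\<Sum>j<n. li_coeff ks j) / real n ^ k"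
  by (simp add: li_coeff_def)

lemma li_coeff_snoc_0 [simp]: "li_coeff (ks @ [k]) 0 = 0"
  by (simp add: li_coeff_snoc)

lemma li_coeff_snoc_Suc: "li_coeff (ks @ [k]) (Suc n) = hsum ks n / real (Suc n) ^ k"
  by (simp add: li_coeff_snoc hsum_def lessThan_Suc_atMost)

lemma hsum_Nil [simp]: "hsum [] N = 1"
  by (simp add: hsum_def li_coeff_Nil)

lemma hsum_snoc_0 [simp]: "hsum (ks @ [k]) 0 = 0"
  by (simp add: hsum_def)

lemma hsum_snoc_Suc: "hsum (ks @ [k]) (Suc N) = hsum (ks @ [k]) N + hsum ks N / real (Suc N) ^ k"
  by (simp add: hsum_def[of "ks @ [k]"] li_coeff_snoc_Suc)

lemma li_coeff_nonneg: "li_coeff ks n \<ge> 0"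
  by (induction ks arbitrary: n rule: rev_induct) (auto simp: li_coeff_Nil li_coeff_snoc intro!: sum_nonneg divide_nonneg_nonneg)

lemma hsum_nonneg: "hsum ks N \<ge> 0"
  by (auto simp: hsum_def li_coeff_nonneg intro!: sum_nonneg)

lemma hsum_mono: "M \<le> N \<Longrightarrow> hsum ks M \<le> hsum ks N"
  unfolding hsum_def by (intro sum_mono2) (auto simp: li_coeff_nonneg)

lemma hsum_1: "hsum [Suc 0] N = harm N"
  by (induction N) (use hsum_snoc_0[of "[]" 1] hsum_snoc_Suc[of "[]" 1] in
    \<open>simp_all add: harm_Suc divide_inverse harm_expand\<close>)

text \<open>Going from \<open>N\<close> to \<open>N + 1\<close> adds the terms in which the first
  chain, the second chain, or both reach \<open>N + 1\<close>; these are the three terms of the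
  recursion of the product.\<close>

lemma hsum_harmonic_aux:
  "real_lin.lin (\<lambda>c. hsum c N) (harmonic_aux ks ls) = hsum (rev ks) N * hsum (rev ls) N"
proof (induction ks ls arbitrary: N rule: harmonic_aux.induct)
  case (3 k ks l ls)
  show ?case
  proof (induction N)
    case 0
    then show ?case
      by (simp add: real_lin.lin_add real_lin.lin_snoc_lin)
  next
    case (Suc N)
    have "real_lin.lin (\<lambda>c. hsum c (Suc N)) (harmonic_aux (k # ks) (l # ls)) =
        real_lin.lin (\<lambda>c. hsum c N) (harmonic_aux (k # ks) (l # ls))
        + (1 / real (Suc N) ^ k) * real_lin.lin (\<lambda>c. hsum c N) (harmonic_aux ks (l # ls))
        + (1 / real (Suc N) ^ (k + l)) * real_lin.lin (\<lambda>c. hsum c N) (harmonic_aux ks ls)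
        + (1 / real (Suc N) ^ l) * real_lin.lin (\<lambda>c. hsum c N) (harmonic_aux (k # ks) ls)"
      unfolding real_lin.lin_fun_cmult[symmetric] harmonic_aux.simps(3)
        real_lin.lin_add real_lin.lin_snoc_lin hsum_snoc_Suc real_lin.lin_fun_add
      by simp
    also have "\<dots> = hsum (rev (k # ks)) (Suc N) * hsum (rev (l # ls)) (Suc N)"
      unfolding 3 Suc.IH rev.simps hsum_snoc_Suc
      by (simp add: power_add divide_simps) (simp add: algebra_simps)
    finally show ?case .
  qed
qed simp_all

lemma hsum_harmonic_basis:
  "real_lin.lin (\<lambda>c. hsum c N) (harmonic_basis ks ls) = hsum ks N * hsum ls N"
  by (simp add: harmonic_basis_def hsum_harmonic_aux)

section \<open>Truncated sums as sums over chains, and their limits\<close>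

definition chains :: "nat \<Rightarrow> nat list set" where
  "chains r = {ns. length ns = r \<and> sorted_wrt (<) ns \<and> (\<forall>n\<in>set ns. 1 \<le> n)}"

definition bounded_chains :: "nat \<Rightarrow> nat \<Rightarrow> nat list set" where
  "bounded_chains r N = {ns \<in> chains r. \<forall>n\<in>set ns. n \<le> N}"

definition chain_term :: "nat list \<Rightarrow> nat list \<Rightarrow> real" where
  "chain_term ks ns = (\<Prod>i<length ks. 1 / real (ns ! i) ^ (ks ! i))"

lemma mzv_altdef: "mzv ks = infsum (chain_term ks) (chains (length ks))"
  by (simp add: mzv_def chain_term_def[abs_def] chains_def)

lemma finite_bounded_chains: "finite (bounded_chains r N)"
  by (rule finite_subset[OF _ finite_lists_length_eq[of "{..N}" r]])
    (auto simp: bounded_chains_def chains_def)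

lemma bounded_chains_0: "bounded_chains 0 N = {[]}"
  by (auto simp: bounded_chains_def chains_def)

lemma bounded_chains_Suc:
  "bounded_chains (Suc r) N =
     (\<lambda>(m, ns). ns @ [Suc m]) ` (SIGMA m:{..<N}. bounded_chains r m)"
proof (intro equalityI subsetI)
  fix ns
  assume ns: "ns \<in> bounded_chains (Suc r) N"
  then have "ns \<noteq> []"
    by (auto simp: bounded_chains_def chains_def)
  then obtain ms m where ns_eq: "ns = ms @ [m]"
    by (metis append_butlast_last_id)
  with ns have "m > 0" "m \<le> N" "ms \<in> bounded_chains r (m - 1)"
    by (auto simp: bounded_chains_def chains_def sorted_wrt_append)
  then show "ns \<in> (\<lambda>(m, ns). ns @ [Suc m]) ` (SIGMA m:{..<N}. bounded_chains r m)"
    by (intro image_eqI[of _ _ "(m - 1, ms)"]) (auto simp: ns_eq)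
next
  fix ns
  assume "ns \<in> (\<lambda>(m, ns). ns @ [Suc m]) ` (SIGMA m:{..<N}. bounded_chains r m)"
  then show "ns \<in> bounded_chains (Suc r) N"
    by (fastforce simp: bounded_chains_def chains_def sorted_wrt_append)
qed

lemma sum_atMost_Suc_shift0: "f 0 = 0 \<Longrightarrow> (\<Sum>n\<le>N. f n) = (\<Sum>m<N. f (Suc m))" for f :: "nat \<Rightarrow> real"
  by (induction N) auto

lemma hsum_eq_chain_sum: "hsum ks N = (\<Sum>ns\<in>bounded_chains (length ks) N. chain_term ks ns)"
proof (induction ks arbitrary: N rule: rev_induct)
  case Nil
  then show ?case
    by (simp add: bounded_chains_0 chain_term_def)
next
  case (snoc k ks)
  have inj: "inj_on (\<lambda>(m, ns). ns @ [Suc m]) (SIGMA m:{..<N}. bounded_chains (length ks) m)"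
    by (auto simp: inj_on_def)
  have "hsum (ks @ [k]) N = (\<Sum>m<N. hsum ks m / real (Suc m) ^ k)"
    unfolding hsum_def[of "ks @ [k]"] by (subst sum_atMost_Suc_shift0) (simp_all add: li_coeff_snoc_Suc)
  also have "\<dots> = (\<Sum>m<N. \<Sum>ns\<in>bounded_chains (length ks) m. chain_term (ks @ [k]) (ns @ [Suc m]))"
    unfolding snoc sum_divide_distrib
    by (intro sum.cong refl) (auto simp: chain_term_def bounded_chains_def chains_def nth_append)
  also have "\<dots> = (\<Sum>(m, ns)\<in>(SIGMA m:{..<N}. bounded_chains (length ks) m). chain_term (ks @ [k]) (ns @ [Suc m]))"
    by (rule sum.Sigma) (auto simp: finite_bounded_chains)
  also have "\<dots> = (\<Sum>ns\<in>bounded_chains (length (ks @ [k])) N. chain_term (ks @ [k]) ns)"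
    by (simp add: bounded_chains_Suc sum.reindex[OF inj] case_prod_unfold
        sum.reindex[OF inj, unfolded case_prod_unfold])
  finally show ?case .
qed

text \<open>All terms are nonnegative and every finite set of chains is contained in a bounded one,
  so the unordered sum is the supremum of the truncated sums.\<close>

lemma mzv_eqI:
  assumes "hsum ks \<longlonglongrightarrow> L"
  shows "mzv ks = L"
proof -
  let ?C = "chains (length ks)"
  have nonneg: "chain_term ks ns \<ge> 0" for ns
    by (auto simp: chain_term_def intro: prod_nonneg)
  have le_L: "hsum ks N \<le> L" for N
    using assms by (rule incseq_le[rotated]) (auto simp: incseq_def hsum_mono)
  have fin: "sum (chain_term ks) F \<le> L" if F: "finite F" "F \<subseteq> ?C" for F
  proof -
    define N where "N = Max (insert 0 (\<Union>ns\<in>F. set ns))"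
    have "F \<subseteq> bounded_chains (length ks) N"
      using F by (auto simp: bounded_chains_def N_def intro!: Max_ge)
    then have "sum (chain_term ks) F \<le> hsum ks N"
      unfolding hsum_eq_chain_sum using nonneg by (intro sum_mono2 finite_bounded_chains) auto
    with le_L show ?thesis
      by (rule order_trans[rotated])
  qed
  then have summable: "chain_term ks summable_on ?C"
    using nonneg by (intro nonneg_bdd_above_summable_on) (auto simp: bdd_above_def)
  have "infsum (chain_term ks) ?C \<le> L"
    using infsum_le_finite_sums[OF summable] fin by blast
  moreover have "hsum ks N \<le> infsum (chain_term ks) ?C" for N
    unfolding hsum_eq_chain_sum using nonneg
    by (intro finite_sum_le_infsum summable finite_bounded_chains) (auto simp: bounded_chains_def)
  then have "L \<le> infsum (chain_term ks) ?C"
    by (intro LIMSEQ_le_const2[OF assms]) auto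
  ultimately show ?thesis
    by (simp add: mzv_altdef)
qed

section \<open>Growth and tail estimates\<close>

lemma harm_power_bound: "\<exists>C. \<forall>n\<ge>1. harm n ^ M \<le> C * real n powr (1 / 4)"
proof -
  \<comment> \<open>Chosen such that \<open>a * M\<close> is at most 1/4, so that the
    \<open>M\<close>-th power of the logarithmic bound costs at most a quarter power of
    \<open>n\<close>.\<close>
  define a :: real where "a = 1 / (4 * (real M + 1))"
  have a: "a > 0" "a * real M \<le> 1 / 4"
    by (auto simp: a_def field_simps)
  have "harm n ^ M \<le> (1 + 1 / a) ^ M * real n powr (1 / 4)" if n: "n \<ge> 1" for n :: nat
  proof -
    have "harm n - ln (real n) \<le> harm 1 - ln (real 1)"
      using euler_mascheroni_sequence_decreasing[of 1 n] n by simp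
    then have "harm n \<le> 1 + ln (real n)"
      by (simp add: harm_expand)
    also have "\<dots> \<le> real n powr a + real n powr a / a"
      using n a ge_one_powr_ge_zero[of "real n" a] by (intro add_mono ln_powr_bound) auto
    finally have "harm n \<le> (1 + 1 / a) * real n powr a"
      by (simp add: algebra_simps)
    then have "harm n ^ M \<le> ((1 + 1 / a) * real n powr a) ^ M"
      by (intro power_mono harm_nonneg)
    also have "\<dots> = (1 + 1 / a) ^ M * real n powr (a * real M)"
      using n by (simp add: power_mult_distrib powr_power mult.commute)
    also have "\<dots> \<le> (1 + 1 / a) ^ M * real n powr (1 / 4)"
      using n a by (intro mult_left_mono powr_mono) auto
    finally show ?thesis .
  qed
  then show ?thesis
    by blast
qed

text \<open>All exponents are at least 1, so each of the nested summations contributes at most one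
  factor \<open>harm N\<close>.\<close>

lemma hsum_le_harm_power: "is_index ks \<Longrightarrow> hsum ks N \<le> harm N ^ length ks"
proof (induction ks arbitrary: N rule: rev_induct)
  case (snoc k ks)
  then have k: "k \<ge> 1" and IH: "hsum ks m \<le> harm m ^ length ks" for m
    by (auto simp: is_index_def Suc_le_eq)
  have "hsum (ks @ [k]) N = (\<Sum>m<N. hsum ks m / real (Suc m) ^ k)"
    unfolding hsum_def[of "ks @ [k]"] by (subst sum_atMost_Suc_shift0) (simp_all add: li_coeff_snoc_Suc)
  also have "\<dots> \<le> (\<Sum>m<N. harm N ^ length ks / real (Suc m))"
  proof (intro sum_mono frac_le)
    fix m
    assume "m \<in> {..<N}"
    then show "hsum ks m \<le> harm N ^ length ks"
      using IH[of m] power_mono[OF harm_mono[of m N, where 'a = real] harm_nonneg, of "length ks"] by auto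
    show "real (Suc m) \<le> real (Suc m) ^ k"
      using k self_le_power[of "real (Suc m)" k] by simp
  qed (auto simp: harm_nonneg)
  also have "\<dots> = harm N ^ length (ks @ [k])"
    by (simp add: harm_altdef sum_distrib_left sum_distrib_right divide_inverse mult.commute)
  finally show ?case .
qed simp

lemma admissible_cases:
  assumes "admissible ks"
  obtains "ks = []" | ks' k where "ks = ks' @ [k]" "k \<ge> 2" "is_index ks'"
  using assms by (cases ks rule: rev_cases) (auto simp: admissible_def is_index_def)

lemma admissible_imp_is_index: "admissible ks \<Longrightarrow> is_index ks"
  by (simp add: admissible_def)

text \<open>The last exponent gives \<open>n^(-2)\<close>, the logarithmic factors cost
  \<open>n^(1/4)\<close> and the weight costs \<open>n^(1/2)\<close>, which leaves the summable
  \<open>n^(-5/4)\<close>. The square root in the weight later yields rates of convergence.\<close>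

lemma summable_li_coeff_weighted:
  assumes "admissible ks"
  shows "summable (\<lambda>n. li_coeff ks n * (sqrt (real n) * harm n ^ m))"
  using assms
proof (cases ks rule: admissible_cases)
  case 1
  have "(\<lambda>n. li_coeff ks n * (sqrt (real n) * harm n ^ m)) = (\<lambda>n. 0)"
    by (rule ext) (simp add: 1 li_coeff_Nil)
  then show ?thesis
    by simp
next
  case (2 ks' k)
  obtain C where C: "\<And>n. n \<ge> 1 \<Longrightarrow> harm n ^ (length ks' + m) \<le> C * real n powr (1 / 4)"
    using harm_power_bound by blast
  have "li_coeff ks n * (sqrt (real n) * harm n ^ m) \<le> C * real n powr (-5/4)" if "n \<ge> 1" for n
  proof -
    obtain n' where n': "n = Suc n'"
      using \<open>n \<ge> 1\<close> by (cases n) auto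
    have "li_coeff ks n = hsum ks' n' / real n ^ k"
      by (simp add: 2 n' li_coeff_snoc_Suc)
    also have "\<dots> \<le> harm n ^ length ks' / real n ^ 2"
    proof (rule frac_le)
      show "hsum ks' n' \<le> harm n ^ length ks'"
        using hsum_le_harm_power[OF 2(3), of n]  hsum_mono[of n' n ks'] n' by simp
      show "real n ^ 2 \<le> real n ^ k"
        using that 2 by (intro power_increasing) auto
    qed (use that in \<open>auto simp: harm_nonneg\<close>)
    finally have "li_coeff ks n * (sqrt (real n) * harm n ^ m)
        \<le> harm n ^ length ks' / real n ^ 2 * (sqrt (real n) * harm n ^ m)"
      by (intro mult_right_mono) (auto simp: harm_nonneg)
    also have "\<dots> = harm n ^ (length ks' + m) * (sqrt (real n) / real n ^ 2)"
      by (simp add: power_add)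
    also have "\<dots> \<le> C * real n powr (1 / 4) * (sqrt (real n) / real n ^ 2)"
      using C[OF that] by (intro mult_right_mono) auto
    also have "sqrt (real n) / real n ^ 2 = real n powr (1/2 - 2)"
      unfolding powr_diff using that by (simp add: powr_half_sqrt)
    also have "C * real n powr (1 / 4) * \<dots> = C * real n powr (-5/4)"
      by (simp add: powr_add[symmetric])
    finally show ?thesis .
  qed
  then have "\<exists>N. \<forall>n\<ge>N. norm (li_coeff ks n * (sqrt (real n) * harm n ^ m)) \<le> C * real n powr (-5/4)"
    by (intro exI[of _ 1]) (auto simp: li_coeff_nonneg harm_nonneg)
  moreover have "summable (\<lambda>n. C * real n powr (-5/4))"
    by (intro summable_mult) (simp add: summable_real_powr_iff)
  ultimately show ?thesis
    by (rule summable_comparison_test)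
qed

lemma summable_li_coeff_harm:
  assumes "admissible ks"
  shows "summable (\<lambda>n. li_coeff ks n * harm n ^ m)"
proof (rule summable_comparison_test[OF _ summable_li_coeff_weighted[OF assms, of m]])
  have "li_coeff ks n * harm n ^ m \<le> li_coeff ks n * (sqrt (real n) * harm n ^ m)" if "n \<ge> 1" for n
    using that mult_right_mono[of 1 "sqrt (real n)" "harm n ^ m"]
    by (intro mult_left_mono li_coeff_nonneg) (simp add: harm_nonneg)
  then show "\<exists>N. \<forall>n\<ge>N. norm (li_coeff ks n * harm n ^ m) \<le> li_coeff ks n * (sqrt (real n) * harm n ^ m)"
    by (intro exI[of _ 1]) (auto simp: li_coeff_nonneg harm_nonneg)
qed

lemma summable_li_coeff: "admissible ks \<Longrightarrow> summable (li_coeff ks)"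
  using summable_li_coeff_harm[of ks 0] by simp

lemma mzv_eq_suminf: "admissible ks \<Longrightarrow> mzv ks = suminf (li_coeff ks)"
  by (intro mzv_eqI) (simp add: hsum_def[abs_def] summable_LIMSEQ' summable_li_coeff)

lemma hsum_tendsto_mzv: "admissible ks \<Longrightarrow> hsum ks \<longlonglongrightarrow> mzv ks"
  by (simp add: mzv_eq_suminf hsum_def[abs_def] summable_LIMSEQ' summable_li_coeff)

lemma mzv_minus_hsum:
  assumes "admissible ks"
  shows "mzv ks - hsum ks N = suminf (\<lambda>n. li_coeff ks (n + Suc N))"
  using suminf_minus_initial_segment[OF summable_li_coeff[OF assms], of "Suc N"]
  by (simp add: mzv_eq_suminf[OF assms] hsum_def lessThan_Suc_atMost)

section \<open>Regularization by constant terms\<close>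

lemma qlinear_on_zero:
  assumes "qlinear_on V f" "0 \<in> V"
  shows "f (0 :: 'a \<Rightarrow>\<^sub>0 rat) = 0"
proof -
  have "f (qscale 0 0) = of_rat 0 * f 0"
    using assms unfolding qlinear_on_def by blast
  then show ?thesis
    by (simp add: qscale_zero)
qed

text \<open>The common shape of both regularizations: \<open>d\<close> counts trailing copies of the
  generator, \<open>F\<close> realizes basis elements as functions whose pointwise product is the
  product \<open>g\<close>, and \<open>lead\<close> says that multiplication by the generator
  creates one more trailing copy with nonzero coefficient, up to lower terms.\<close>

locale regularization_data = log_scale Fl T for Fl :: "'a filter" and T :: "'a \<Rightarrow> real" +
  fixes S :: "'b \<Rightarrow> bool" and g :: "'b \<Rightarrow> 'b \<Rightarrow> ('b \<Rightarrow>\<^sub>0 rat)" and gen :: 'b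
    and d :: "'b \<Rightarrow> nat" and F :: "'b \<Rightarrow> 'a \<Rightarrow> real"
  assumes gen: "S gen" "eventually (\<lambda>v. F gen v = T v) Fl"
    and closed: "\<And>a b. S a \<Longrightarrow> S b \<Longrightarrow> g a b \<in> supp_in S"
    and lead: "\<And>a n. S a \<Longrightarrow> d a = Suc n \<Longrightarrow> \<exists>b c r. S b \<and> d b = n \<and> c \<noteq> 0 \<and>
      r \<in> supp_in (\<lambda>x. S x \<and> d x \<le> n) \<and> g b gen = Poly_Mapping.single a c + r"
    and mult: "\<And>a b. S a \<Longrightarrow> S b \<Longrightarrow>
      eventually (\<lambda>v. real_lin.lin (\<lambda>c. F c v) (g a b) = F a v * F b v) Fl"
    and base: "\<And>a. S a \<Longrightarrow> d a = 0 \<Longrightarrow> has_asym (F a)"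
begin

lemma closed_ext: "u \<in> supp_in S \<Longrightarrow> v \<in> supp_in S \<Longrightarrow> bilinear_ext g u v \<in> supp_in S"
  using supp_in_bilinear_ext closed by metis

lemma span_induct:
  assumes u: "u \<in> supp_in S"
    and zero: "Pd 0"
    and base: "\<And>a. S a \<Longrightarrow> d a = 0 \<Longrightarrow> Pd (Poly_Mapping.single a 1)"
    and add: "\<And>u v. u \<in> supp_in S \<Longrightarrow> v \<in> supp_in S \<Longrightarrow> Pd u \<Longrightarrow> Pd v \<Longrightarrow> Pd (u + v)"
    and scale: "\<And>c u. u \<in> supp_in S \<Longrightarrow> Pd u \<Longrightarrow> Pd (qscale c u)"
    and step: "\<And>u. u \<in> supp_in S \<Longrightarrow> Pd u \<Longrightarrow> Pd (bilinear_ext g u (Poly_Mapping.single gen 1))"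
  shows "Pd u"
proof (rule filtered_span_induct[where \<Phi> = "\<lambda>u. bilinear_ext g u (Poly_Mapping.single gen 1)"
      and d = d and S = S])
  show "bilinear_ext g u (Poly_Mapping.single gen 1) \<in> supp_in S" if "u \<in> supp_in S" for u
    using that gen by (intro closed_ext supp_in_single)
  show "\<exists>b c r. S b \<and> d b = n \<and> c \<noteq> 0 \<and> r \<in> supp_in (\<lambda>x. S x \<and> d x \<le> n) \<and>
      bilinear_ext g (Poly_Mapping.single b 1) (Poly_Mapping.single gen 1) = Poly_Mapping.single a c + r"
    if "S a" "d a = Suc n" for a n
    using lead[OF that] by simp
qed (use assms in auto)

text \<open>Functions of degree 0 have an expansion by assumption, multiplication by the generator
  multiplies the function by \<open>T\<close>, and these two sources span everything.\<close>

lemma has_asym_F: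
  assumes "S a"
  shows "has_asym (F a)"
proof -
  define Fu where "Fu u v = real_lin.lin (\<lambda>a. F a v) u" for u v
  have "Poly_Mapping.single a 1 \<in> supp_in S"
    using assms by (rule supp_in_single)
  then have "has_asym (Fu (Poly_Mapping.single a 1))"
  proof (rule span_induct)
    show "has_asym (Fu 0)"
      by (simp add: Fu_def[abs_def])
    show "has_asym (Fu (Poly_Mapping.single a 1))" if "S a" "d a = 0" for a
      using base[OF that] by (simp add: Fu_def[abs_def])
    show "has_asym (Fu (u + v))" if "has_asym (Fu u)" "has_asym (Fu v)" for u v
      using has_asym_add[OF that] by (simp add: Fu_def[abs_def] real_lin.lin_add)
    show "has_asym (Fu (qscale c u))" if "has_asym (Fu u)" for c u
      using has_asym_cmult[OF that] by (simp add: Fu_def[abs_def])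
    show "has_asym (Fu (bilinear_ext g u (Poly_Mapping.single gen 1)))"
      if u: "u \<in> supp_in S" and asym: "has_asym (Fu u)" for u
    proof -
      \<comment> \<open>The product rule holds eventually for each basis element; the support of
        \<open>u\<close> is finite, so it holds eventually for all of them at once.\<close>
      have "eventually (\<lambda>v. \<forall>a\<in>Poly_Mapping.keys u. real_lin.lin (\<lambda>c. F c v) (g a gen) = F a v * F gen v) Fl"
        using u mult gen by (intro eventually_ball_finite) (auto simp: supp_in_def)
      then have "eventually (\<lambda>v. Fu (bilinear_ext g u (Poly_Mapping.single gen 1)) v = Fu u v * T v) Fl"
        using gen(2)
      proof eventually_elim
        case (elim v)
        have "Fu (bilinear_ext g u (Poly_Mapping.single gen 1)) v = Fu u v * Fu (Poly_Mapping.single gen 1) v"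
          unfolding Fu_def using elim(1) by (intro real_lin.lin_bilinear_ext) auto
        then show ?case
          using elim(2) by (simp add: Fu_def)
      qed
      from has_asym_cong(1)[OF this] show ?thesis
        using has_asym_mult[OF asym has_asym_T] by simp
    qed
  qed
  then show ?thesis
    by (simp add: Fu_def[abs_def])
qed

definition is_reg :: "(('b \<Rightarrow>\<^sub>0 rat) \<Rightarrow> real) \<Rightarrow> bool" where
  "is_reg f \<longleftrightarrow>
     f \<in> extensional (supp_in S) \<and>
     qlinear_on (supp_in S) f \<and>
     (\<forall>u\<in>supp_in S. \<forall>v\<in>supp_in S. f (bilinear_ext g u v) = f u * f v) \<and>
     (\<forall>a. S a \<and> d a = 0 \<longrightarrow> f (Poly_Mapping.single a 1) = const_term (F a)) \<and>
     f (Poly_Mapping.single gen 1) = 0"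

definition reg :: "('b \<Rightarrow>\<^sub>0 rat) \<Rightarrow> real" where
  "reg = restrict (reg_lin F) (supp_in S)"

lemma reg_single: "S a \<Longrightarrow> reg (Poly_Mapping.single a 1) = const_term (F a)"
  by (simp add: reg_def reg_lin_def supp_in_single)

lemma is_reg_reg: "is_reg reg"
proof -
  have "const_term (F gen) = 0"
    using has_asym_cong(2)[OF gen(2)] const_term_T by simp
  moreover have "reg (bilinear_ext g u v) = reg u * reg v" if "u \<in> supp_in S" "v \<in> supp_in S" for u v
    using that closed_ext[OF that] reg_lin_bilinear_ext[of S F g u v] has_asym_F mult closed
    by (simp add: reg_def)
  moreover have "qlinear_on (supp_in S) reg"
    unfolding qlinear_on_def by (auto simp: reg_def supp_in_add supp_in_qscale reg_lin_def real_lin.lin_add)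
  ultimately show ?thesis
    unfolding is_reg_def using gen(1) by (auto simp: reg_single) (simp add: reg_def)
qed

text \<open>Two such maps agree in degree 0, and both vanish on every multiple of the
  generator.\<close>

lemma is_reg_unique:
  assumes "is_reg f"
  shows "f = reg"
proof
  fix u
  show "f u = reg u"
  proof (cases "u \<in> supp_in S")
    case False
    then show ?thesis
      using assms by (simp add: is_reg_def reg_def extensional_def)
  next
    case True
    have lin: "qlinear_on (supp_in S) f" "qlinear_on (supp_in S) reg"
      using assms is_reg_reg by (simp_all add: is_reg_def)
    show ?thesis
      using True
    proof (rule span_induct)
      show "f 0 = reg 0"
        using qlinear_on_zero[OF lin(1)] qlinear_on_zero[OF lin(2)] by simp
      show "f (Poly_Mapping.single a 1) = reg (Poly_Mapping.single a 1)" if "S a" "d a = 0" for a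
        using that assms is_reg_reg by (simp add: is_reg_def)
      show "f (bilinear_ext g u (Poly_Mapping.single gen 1)) = reg (bilinear_ext g u (Poly_Mapping.single gen 1))"
        if "u \<in> supp_in S" for u
        using that assms is_reg_reg supp_in_single[of S gen 1, OF gen(1)] by (simp add: is_reg_def)
    qed (use lin in \<open>auto simp: qlinear_on_def\<close>)
  qed
qed

lemma The_is_reg: "(THE f. is_reg f) = reg"
  using is_reg_reg is_reg_unique by blast

text \<open>The regularization annihilates every multiple of the generator, so all its values are
  rational combinations of those in degree 0.\<close>

lemma reg_in_subspace:
  assumes u: "u \<in> supp_in S"
    and base: "\<And>a. S a \<Longrightarrow> d a = 0 \<Longrightarrow> const_term (F a) \<in> V"
    and zero: "0 \<in> V"
    and add: "\<And>x y. x \<in> V \<Longrightarrow> y \<in> V \<Longrightarrow> x + y \<in> V"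
    and scale: "\<And>c x. x \<in> V \<Longrightarrow> of_rat c * x \<in> V"
  shows "reg u \<in> V"
proof -
  have lin: "qlinear_on (supp_in S) reg"
    and m: "\<And>u v. u \<in> supp_in S \<Longrightarrow> v \<in> supp_in S \<Longrightarrow> reg (bilinear_ext g u v) = reg u * reg v"
    and r0: "reg (Poly_Mapping.single gen 1) = 0"
    using is_reg_reg by (simp_all add: is_reg_def)
  show ?thesis
    using u
  proof (rule span_induct)
    show "reg 0 \<in> V"
      using qlinear_on_zero[OF lin] zero by simp
    show "reg (bilinear_ext g u (Poly_Mapping.single gen 1)) \<in> V" if "u \<in> supp_in S" for u
      using m[OF that supp_in_single[of S gen 1, OF gen(1)]] r0 zero by simp
  qed (use lin add scale base reg_single in \<open>auto simp: qlinear_on_def\<close>)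
qed

end

section \<open>The harmonic regularization\<close>

lemma linear_ext_linear_ext: "linear_ext g (linear_ext h u) = linear_ext (\<lambda>a. linear_ext g (h a)) u"
  by (rule poly_mapping_eqI) (simp add: lookup_linear_ext rat_lin.lin_linear_ext)

section \<open>Trailing ones and the harmonic product with the index \<open>[1]\<close>\<close>

definition trailing :: "'a \<Rightarrow> 'a list \<Rightarrow> nat" where
  "trailing c xs = length (takeWhile (\<lambda>x. x = c) (rev xs))"

lemma trailing_Nil [simp]: "trailing c [] = 0"
  by (simp add: trailing_def)

lemma trailing_snoc [simp]: "trailing c (xs @ [x]) = (if x = c then Suc (trailing c xs) else 0)"
  by (simp add: trailing_def)

lemma trailing_append_replicate [simp]: "trailing c (xs @ replicate n c) = n + trailing c xs"
proof (induction n)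
  case (Suc n)
  then show ?case
    using trailing_snoc[of c "xs @ replicate n c" c] by (simp add: replicate_append_same)
qed simp

lemma trailing_decomp:
  "trailing c xs = n \<Longrightarrow> \<exists>ys. xs = ys @ replicate n c \<and> trailing c ys = 0"
proof (induction n arbitrary: xs)
  case 0
  then show ?case
    by (intro exI[of _ xs]) simp
next
  case (Suc n)
  then obtain zs where zs: "xs = zs @ [c]" "trailing c zs = n"
    by (cases xs rule: rev_cases) (auto split: if_splits)
  from Suc.IH[OF zs(2)] obtain ys where "zs = ys @ replicate n c" "trailing c ys = 0"
    by blast
  then show ?case
    by (intro exI[of _ ys]) (simp add: zs replicate_append_same)
qed

lemma trailing_eq_0_iff: "trailing c xs = 0 \<longleftrightarrow> xs = [] \<or> last xs \<noteq> c"
  by (cases xs rule: rev_cases) auto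

lemma trailing_Cons: "x \<in> set xs \<Longrightarrow> x \<noteq> c \<Longrightarrow> trailing c (a # xs) = trailing c xs"
  unfolding trailing_def rev.simps by (subst takeWhile_append1[of x]) auto

lemma snoc_lin_single [simp]: "snoc_lin k (Poly_Mapping.single a c) = Poly_Mapping.single (a @ [k]) c"
  by (simp add: snoc_lin_def)

lemma snoc_lin_add: "snoc_lin k (u + v) = snoc_lin k u + snoc_lin k v"
  by (simp add: snoc_lin_def linear_ext_add)

lemma supp_in_snoc_lin:
  assumes "u \<in> supp_in S" "\<And>a. S a \<Longrightarrow> S' (a @ [k])"
  shows "snoc_lin k u \<in> supp_in S'"
  unfolding snoc_lin_def using assms by (intro supp_in_linear_ext[of u S]) (auto intro: supp_in_single)

lemma is_index_snoc [simp]: "is_index (ks @ [k]) \<longleftrightarrow> is_index ks \<and> 0 < k"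
  by (auto simp: is_index_def)

lemma is_index_append_ones [simp]: "is_index (ks @ replicate n (Suc 0)) \<longleftrightarrow> is_index ks"
  by (auto simp: is_index_def)

lemma harmonic_aux_closed:
  "is_index ks \<Longrightarrow> is_index ls \<Longrightarrow> harmonic_aux ks ls \<in> supp_in is_index"
proof (induction ks ls rule: harmonic_aux.induct)
  case (3 k ks l ls)
  then have "is_index ks" "is_index ls" "k > 0" "l > 0"
    by (auto simp: is_index_def)
  with 3 show ?case
    unfolding harmonic_aux.simps by (intro supp_in_add supp_in_snoc_lin[of _ is_index]) auto
qed (auto simp: is_index_def intro!: supp_in_single)

lemma harmonic_basis_closed:
  "is_index ks \<Longrightarrow> is_index ls \<Longrightarrow> harmonic_basis ks ls \<in> supp_in is_index"
  unfolding harmonic_basis_def by (rule harmonic_aux_closed) (auto simp: is_index_def)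

text \<open>The additional 1 has \<open>n + 1\<close> places in the trailing block. In every other
  term it stands further left or is merged with a component, and at most \<open>n\<close> trailing
  ones remain.\<close>

lemma harmonic_basis_ones:
  assumes "is_index ks" "trailing 1 ks = 0"
  shows "\<exists>r\<in>supp_in (\<lambda>x. is_index x \<and> trailing 1 x \<le> n).
    harmonic_basis (ks @ replicate n 1) [1] = Poly_Mapping.single (ks @ replicate (Suc n) 1) (of_nat (Suc n)) + r"
proof (induction n)
  case 0
  show ?case
  proof (cases ks rule: rev_cases)
    case Nil
    then show ?thesis
      by (intro bexI[of _ 0]) (auto simp: harmonic_basis_Nil)
  next
    case (snoc ls l)
    have l: "is_index ls" "l > 0" "l \<noteq> 1"
      using assms snoc by (auto split: if_splits)
    let ?r = "snoc_lin l (harmonic_basis ls [1]) + Poly_Mapping.single (ls @ [l + 1]) 1"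
    have "?r \<in> supp_in (\<lambda>x. is_index x \<and> trailing 1 x \<le> 0)"
      using l harmonic_basis_closed[of ls "[1]"]
      by (intro supp_in_add supp_in_single supp_in_snoc_lin[of _ is_index]) (auto simp: is_index_def)
    then show ?thesis
      using harmonic_basis_snoc[of ls l "[]" 1]
      by (intro bexI[of _ ?r]) (auto simp: snoc harmonic_basis_Nil add_ac)
  qed
next
  case (Suc n)
  then obtain r where r: "r \<in> supp_in (\<lambda>x. is_index x \<and> trailing 1 x \<le> n)"
    and eq: "harmonic_basis (ks @ replicate n 1) [1] = Poly_Mapping.single (ks @ replicate (Suc n) 1) (of_nat (Suc n)) + r"
    by blast
  let ?r = "snoc_lin 1 r + Poly_Mapping.single (ks @ replicate n 1 @ [2]) 1"
  have rr: "?r \<in> supp_in (\<lambda>x. is_index x \<and> trailing 1 x \<le> Suc n)"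
    using r assms(1) trailing_snoc[of 1 "ks @ replicate n 1" 2] is_index_snoc[of "ks @ replicate n 1" 2]
    by (intro supp_in_add supp_in_single supp_in_snoc_lin[OF r]) auto
  have rep: "ks @ replicate (Suc m) (1::nat) = (ks @ replicate m 1) @ [1]" for m
    by (simp add: replicate_append_same)
  have "harmonic_basis (ks @ replicate (Suc n) 1) [1] =
      snoc_lin 1 (harmonic_basis (ks @ replicate n 1) [1])
      + Poly_Mapping.single (ks @ replicate n 1 @ [2]) 1
      + Poly_Mapping.single (ks @ replicate (Suc (Suc n)) 1) 1"
    unfolding rep[of n] rep[of "Suc n"] using harmonic_basis_snoc[of "ks @ replicate n 1" 1 "[]" 1]
    by (simp add: harmonic_basis_Nil numeral_2_eq_2)
  also have "\<dots> = Poly_Mapping.single (ks @ replicate (Suc (Suc n)) 1) (of_nat (Suc (Suc n))) + ?r"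
    unfolding eq snoc_lin_add snoc_lin_single rep[of "Suc n", symmetric]
    by (simp add: add_ac flip: single_add)
  finally show ?case
    using rr by blast
qed

interpretation harm_scale: log_scale sequentially "harm :: nat \<Rightarrow> real"
  by unfold_locales (simp_all add: harm_at_top)

text \<open>The error is the tail of the series over \<open>n > N\<close>. There
  \<open>harm N ^ m \<le> harm n ^ m\<close>, so error times power is bounded by the tail of a
  convergent weighted series.\<close>

lemma negligible_hsum:
  assumes "admissible ks"
  shows "harm_scale.negligible (\<lambda>N. hsum ks N - mzv ks)"
  unfolding harm_scale.negligible_def
proof
  fix m
  let ?f = "\<lambda>n. li_coeff ks n * harm n ^ m"
  have sf: "summable (\<lambda>n. ?f (n + N))" and sl: "summable (\<lambda>n. li_coeff ks (n + N))" for N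
    using summable_ignore_initial_segment[OF summable_li_coeff_harm[OF assms, of m], of N]
      summable_ignore_initial_segment[OF summable_li_coeff[OF assms], of N] by simp_all
  have bound: "norm ((hsum ks N - mzv ks) * harm N ^ m) \<le> suminf (\<lambda>n. ?f (n + Suc N))" for N
  proof -
    have "norm ((hsum ks N - mzv ks) * harm N ^ m) = (mzv ks - hsum ks N) * harm N ^ m"
      unfolding norm_mult norm_minus_commute[of "hsum ks N"]
      by (simp add: mzv_minus_hsum[OF assms] suminf_nonneg[OF sl] li_coeff_nonneg harm_nonneg del: add_Suc_right)
    also have "\<dots> = suminf (\<lambda>n. li_coeff ks (n + Suc N) * harm N ^ m)"
      unfolding mzv_minus_hsum[OF assms] by (rule suminf_mult2[OF sl])
    also have "\<dots> \<le> suminf (\<lambda>n. ?f (n + Suc N))"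
      by (intro suminf_le sf summable_mult2 sl mult_left_mono power_mono harm_mono harm_nonneg li_coeff_nonneg) auto
    finally show ?thesis .
  qed
  show "(\<lambda>N. (hsum ks N - mzv ks) * harm N ^ m) \<longlonglongrightarrow> 0"
    by (rule Lim_null_comparison[OF _ LIMSEQ_Suc[OF suminf_exist_split2[OF summable_li_coeff_harm[OF assms, of m]]]])
      (use bound in auto)
qed

lemma admissible_iff: "admissible ks \<longleftrightarrow> is_index ks \<and> trailing 1 ks = 0"
  by (cases ks rule: rev_cases) (auto simp: admissible_def)

interpretation harm_reg: regularization_data sequentially "harm :: nat \<Rightarrow> real"
  is_index harmonic_basis "[1]" "trailing 1" hsum
proof unfold_locales
  show "is_index [1]"
    by (simp add: is_index_def)
  show "\<forall>\<^sub>F v in sequentially. hsum [1] v = harm v"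
    by (simp add: hsum_1)
  show "harmonic_basis a b \<in> supp_in is_index" if "is_index a" "is_index b" for a b
    using that by (rule harmonic_basis_closed)
  show "\<exists>b c r. is_index b \<and> trailing 1 b = n \<and> c \<noteq> 0 \<and> r \<in> supp_in (\<lambda>x. is_index x \<and> trailing 1 x \<le> n)
      \<and> harmonic_basis b [1] = Poly_Mapping.single a c + r"
    if a: "is_index a" "trailing 1 a = Suc n" for a n
  proof -
    obtain ks where ks: "a = ks @ replicate (Suc n) 1" "trailing 1 ks = 0"
      using trailing_decomp[OF a(2)] by blast
    have ind: "is_index ks"
      using a(1) unfolding ks(1) is_index_def set_append by (rule ball_Un[THEN iffD1, THEN conjunct1])
    obtain r where r: "r \<in> supp_in (\<lambda>x. is_index x \<and> trailing 1 x \<le> n)"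
      "harmonic_basis (ks @ replicate n 1) [1] = Poly_Mapping.single a (of_nat (Suc n)) + r"
      using harmonic_basis_ones[OF ind ks(2), of n] unfolding ks(1) by blast
    have "is_index (ks @ replicate n 1)" "trailing 1 (ks @ replicate n 1) = n"
      using ind ks(2) by simp_all
    moreover have "(of_nat (Suc n) :: rat) \<noteq> 0"
      by (simp only: of_nat_eq_0_iff)
    ultimately show ?thesis
      using r by blast
  qed
  show "\<forall>\<^sub>F v in sequentially. real_lin.lin (\<lambda>c. hsum c v) (harmonic_basis a b) = hsum a v * hsum b v" for a b
    by (simp add: hsum_harmonic_basis)
  show "harm_scale.has_asym (hsum a)" if "is_index a" "trailing 1 a = 0" for a
    using that harm_scale.has_asym_tendsto_const(1)[OF negligible_hsum] by (simp add: admissible_iff)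
qed

lemma const_term_hsum: "admissible ks \<Longrightarrow> harm_scale.const_term (hsum ks) = mzv ks"
  by (rule harm_scale.has_asym_tendsto_const(2)[OF negligible_hsum])

lemma is_harmonic_reg_iff: "is_harmonic_reg f \<longleftrightarrow> harm_reg.is_reg f"
proof -
  have "(\<forall>a. is_index a \<and> trailing 1 a = 0 \<longrightarrow> f (Poly_Mapping.single a 1) = harm_scale.const_term (hsum a))
      \<longleftrightarrow> (\<forall>ks. admissible ks \<longrightarrow> f (Poly_Mapping.single ks 1) = mzv ks)"
    using const_term_hsum by (auto simp: admissible_iff)
  then show ?thesis
    unfolding is_harmonic_reg_def harm_reg.is_reg_def index_space_eq harmonic_prod_def by simp
qed

lemma zeta_harmonic_eq: "is_index ks \<Longrightarrow> zeta_harmonic ks = harm_scale.const_term (hsum ks)"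
  unfolding zeta_harmonic_def is_harmonic_reg_iff harm_reg.The_is_reg by (rule harm_reg.reg_single)

section \<open>The rational span of the multiple zeta values is an algebra\<close>

lemma module_rat_real: "module (\<lambda>(q::rat) (x::real). of_rat q * x)"
  by (rule module.intro) (simp_all add: of_rat_add of_rat_mult distrib_left distrib_right mult.assoc)

lemma mzv_space_zero: "0 \<in> mzv_space"
  unfolding mzv_space_def by (rule module.span_zero[OF module_rat_real])

lemma mzv_space_add: "x \<in> mzv_space \<Longrightarrow> y \<in> mzv_space \<Longrightarrow> x + y \<in> mzv_space"
  unfolding mzv_space_def by (rule module.span_add[OF module_rat_real])

lemma mzv_space_scale: "x \<in> mzv_space \<Longrightarrow> of_rat c * x \<in> mzv_space"
  unfolding mzv_space_def by (rule module.span_scale[OF module_rat_real])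

lemma mzv_in_mzv_space: "admissible ks \<Longrightarrow> mzv ks \<in> mzv_space"
  unfolding mzv_space_def by (intro module.span_base[OF module_rat_real] imageI CollectI)

lemma mzv_space_induct:
  assumes "x \<in> mzv_space" "Pd 0"
    and "\<And>c ks y. admissible ks \<Longrightarrow> y \<in> mzv_space \<Longrightarrow> Pd y \<Longrightarrow> Pd (of_rat c * mzv ks + y)"
  shows "Pd x"
proof -
  have "x \<in> mzv_space \<and> Pd x"
    using assms(1) unfolding mzv_space_def
  proof (rule module.span_induct_alt[OF module_rat_real])
    show "0 \<in> module.span (\<lambda>(q::rat) (x::real). of_rat q * x) (mzv ` {ks. admissible ks}) \<and> Pd 0"
      using mzv_space_zero assms(2) by (simp add: mzv_space_def)
    show "of_rat c * z + y \<in> module.span (\<lambda>(q::rat) (x::real). of_rat q * x) (mzv ` {ks. admissible ks}) \<and> Pd (of_rat c * z + y)"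
      if "z \<in> mzv ` {ks. admissible ks}"
        "y \<in> module.span (\<lambda>(q::rat) (x::real). of_rat q * x) (mzv ` {ks. admissible ks}) \<and> Pd y" for c z y
      using that assms(3) mzv_space_add[OF mzv_space_scale[OF mzv_in_mzv_space]]
      unfolding mzv_space_def[symmetric] by blast
  qed
  then show ?thesis ..
qed

lemma harm_reg_in_mzv_space: "u \<in> supp_in is_index \<Longrightarrow> harm_reg.reg u \<in> mzv_space"
proof (rule harm_reg.reg_in_subspace)
  show "harm_scale.const_term (hsum a) \<in> mzv_space" if "is_index a" "trailing 1 a = 0" for a
    using that mzv_in_mzv_space[of a] by (simp add: const_term_hsum admissible_iff)
qed (auto intro: mzv_space_zero mzv_space_add mzv_space_scale)

lemma zeta_harmonic_in_mzv_space: "is_index ks \<Longrightarrow> zeta_harmonic ks \<in> mzv_space"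
  using harm_reg_in_mzv_space[OF supp_in_single[of is_index ks 1]]
  by (simp only: zeta_harmonic_eq harm_reg.reg_single)

text \<open>For admissible indices the product of the values is the regularized value of their
  harmonic product, and all regularized values lie in the span. The general case follows by
  bilinearity.\<close>

lemma mzv_space_mult:
  assumes "x \<in> mzv_space" "y \<in> mzv_space"
  shows "x * y \<in> mzv_space"
proof -
  have basis: "mzv ks * mzv ls \<in> mzv_space" if "admissible ks" "admissible ls" for ks ls
  proof -
    have ind: "is_index ks" "is_index ls"
      using that by (simp_all add: admissible_imp_is_index)
    then have s: "Poly_Mapping.single ks 1 \<in> supp_in is_index" "Poly_Mapping.single ls 1 \<in> supp_in is_index"
      by (simp_all add: supp_in_single)
    have "harm_reg.reg (bilinear_ext harmonic_basis (Poly_Mapping.single ks 1) (Poly_Mapping.single ls 1)) = mzv ks * mzv ls"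
      using harm_reg.is_reg_reg[unfolded harm_reg.is_reg_def] s
      by (simp only: harm_reg.reg_single[OF ind(1)] harm_reg.reg_single[OF ind(2)]
          const_term_hsum[OF that(1)] const_term_hsum[OF that(2)])
    then show ?thesis
      using harm_reg_in_mzv_space[OF harm_reg.closed_ext[OF s]] by simp
  qed
  have left: "x * mzv ls \<in> mzv_space" if ls: "admissible ls" and x: "x \<in> mzv_space" for x ls
    using x
  proof (rule mzv_space_induct)
    fix c ks y
    assume "admissible ks" "y * mzv ls \<in> mzv_space"
    then have "of_rat c * (mzv ks * mzv ls) + y * mzv ls \<in> mzv_space"
      by (intro mzv_space_add mzv_space_scale basis ls)
    then show "(of_rat c * mzv ks + y) * mzv ls \<in> mzv_space"
      by (simp only: distrib_right mult.assoc)
  qed (simp add: mzv_space_zero)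
  show ?thesis
    using assms(2)
  proof (rule mzv_space_induct)
    fix c ks y
    assume "admissible ks" "x * y \<in> mzv_space"
    then have "of_rat c * (x * mzv ks) + x * y \<in> mzv_space"
      by (intro mzv_space_add mzv_space_scale left assms(1))
    then show "x * (of_rat c * mzv ks + y) \<in> mzv_space"
      by (simp only: distrib_left mult.left_commute)
  qed (simp add: mzv_space_zero)
qed

section \<open>Multiple polylogarithms and the shuffle regularization\<close>

definition theta :: "real fps \<Rightarrow> real fps" where
  "theta f = fps_X * fps_deriv f"

lemma theta_nth [simp]: "fps_nth (theta f) n = real n * fps_nth f n"
  by (cases n) (simp_all add: theta_def)

lemma theta_mult: "theta (f * g) = theta f * g + f * theta g"
  by (simp add: theta_def algebra_simps)

lemma theta_add: "theta (f + g) = theta f + theta g"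
  by (simp add: theta_def algebra_simps)

lemma theta_sum: "theta (sum f A) = (\<Sum>x\<in>A. theta (f x))"
  by (simp add: theta_def fps_deriv_sum sum_distrib_left)

lemma theta_eqD:
  assumes "theta f = theta g" "fps_nth f 0 = fps_nth g 0"
  shows "f = g"
proof (rule fps_ext)
  fix n
  have "real n * fps_nth f n = real n * fps_nth g n"
    using assms(1) by (metis theta_nth)
  then show "fps_nth f n = fps_nth g n"
    using assms(2) by (cases n) simp_all
qed

text \<open>The expansion of \<open>z/(1-z)\<close>. Its vanishing constant term makes the partial
  sums run over \<open>j < n\<close>, in accordance with the strict inequalities in a chain.\<close>

definition geo :: "real fps" where
  "geo = Abs_fps (\<lambda>n. if n = 0 then 0 else 1)"

lemma geo_mult_nth: "fps_nth (geo * f) n = (\<Sum>j<n. fps_nth f j)"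
proof -
  have "fps_nth (f * geo) n = (\<Sum>j=0..n. if j = n then 0 else fps_nth f j)"
    by (auto simp: fps_mult_nth geo_def intro!: sum.cong)
  also have "\<dots> = (\<Sum>j<n. fps_nth f j)"
    by (simp add: atLeast0AtMost flip: lessThan_Suc_atMost)
  finally show ?thesis
    by (simp add: mult.commute)
qed

text \<open>Iterated integrals from 0 of \<open>dz/z\<close> for \<open>X\<close> and
  \<open>dz/(1-z)\<close> for \<open>Y\<close>, the last letter of the word being the outermost
  form. Integrating against \<open>dz/z\<close> divides the \<open>n\<close>-th coefficient by
  \<open>n\<close>; division by 0 gives 0, which is the right constant of integration.\<close>

fun rev_word_li :: "letter list \<Rightarrow> real fps" where
  "rev_word_li [] = 1"
| "rev_word_li (X # w) = Abs_fps (\<lambda>n. fps_nth (rev_word_li w) n / real n)"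
| "rev_word_li (Y # w) = Abs_fps (\<lambda>n. fps_nth (geo * rev_word_li w) n / real n)"

definition word_li :: "letter list \<Rightarrow> real fps" where
  "word_li w = rev_word_li (rev w)"

lemma word_li_Nil [simp]: "word_li [] = 1"
  by (simp add: word_li_def)

lemma word_li_snoc_X: "word_li (w @ [X]) = Abs_fps (\<lambda>n. fps_nth (word_li w) n / real n)"
  and word_li_snoc_Y: "word_li (w @ [Y]) = Abs_fps (\<lambda>n. fps_nth (geo * word_li w) n / real n)"
  by (simp_all add: word_li_def)

lemma word_li_nth_0: "w \<noteq> [] \<Longrightarrow> fps_nth (word_li w) 0 = 0"
  by (cases w rule: rev_cases; cases "last w") (auto simp: word_li_snoc_X word_li_snoc_Y)

definition letter_form :: "letter \<Rightarrow> real fps" where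
  "letter_form a = (case a of X \<Rightarrow> 1 | Y \<Rightarrow> geo)"

text \<open>The exceptional word \<open>[X]\<close> would require the logarithm of \<open>z\<close>,
  whereas the value of division by 0 makes \<open>word_li [X]\<close> vanish.\<close>

lemma theta_word_li_snoc:
  assumes "w \<noteq> [] \<or> a = Y"
  shows "theta (word_li (w @ [a])) = letter_form a * word_li w"
proof (rule fps_ext)
  fix n
  show "fps_nth (theta (word_li (w @ [a]))) n = fps_nth (letter_form a * word_li w) n"
    using assms word_li_nth_0[of w]
    by (cases a; cases n) (auto simp: word_li_snoc_X word_li_snoc_Y letter_form_def geo_mult_nth geo_def)
qed

lemma word_li_append_X:
  "fps_nth (word_li (w @ replicate m X)) n = fps_nth (word_li w) n / real n ^ m"
proof (induction m)
  case (Suc m)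
  have rep: "w @ replicate (Suc m) X = (w @ replicate m X) @ [X]"
    by (simp add: replicate_append_same)
  show ?case
    unfolding rep word_li_snoc_X using Suc by simp
qed simp

lemma word_of_index_snoc: "word_of_index (ks @ [k]) = word_of_index ks @ Y # replicate (k - 1) X"
  by (simp add: word_of_index_def)

lemma word_li_word_of_index: "is_index ks \<Longrightarrow> word_li (word_of_index ks) = Abs_fps (li_coeff ks)"
proof (induction ks rule: rev_induct)
  case Nil
  show ?case
    by (rule fps_ext) (simp add: word_of_index_def li_coeff_Nil)
next
  case (snoc k ks)
  then have k: "k = Suc (k - 1)"
    by (auto simp: is_index_def)
  show ?case
  proof (rule fps_ext)
    fix n
    have w: "word_of_index (ks @ [k]) = (word_of_index ks @ [Y]) @ replicate (k - 1) X"
      by (simp add: word_of_index_snoc)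
    have "fps_nth (word_li (word_of_index (ks @ [k]))) n =
        (\<Sum>j<n. li_coeff ks j) / real n / real n ^ (k - 1)"
      unfolding w word_li_append_X word_li_snoc_Y using snoc by (simp add: geo_mult_nth)
    also have "\<dots> = li_coeff (ks @ [k]) n"
      by (subst k) (simp add: li_coeff_snoc)
    finally show "fps_nth (word_li (word_of_index (ks @ [k]))) n = fps_nth (Abs_fps (li_coeff (ks @ [k]))) n"
      by simp
  qed
qed

definition snoc_word_lin :: "letter \<Rightarrow> (letter list \<Rightarrow>\<^sub>0 rat) \<Rightarrow> (letter list \<Rightarrow>\<^sub>0 rat)" where
  "snoc_word_lin a = linear_ext (\<lambda>w. Poly_Mapping.single (w @ [a]) 1)"

lemma snoc_word_lin_single [simp]: "snoc_word_lin a (Poly_Mapping.single w c) = Poly_Mapping.single (w @ [a]) c"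
  by (simp add: snoc_word_lin_def)

lemma cons_lin_single [simp]: "cons_lin a (Poly_Mapping.single w c) = Poly_Mapping.single (a # w) c"
  by (simp add: cons_lin_def)

lemma snoc_word_lin_add: "snoc_word_lin a (u + v) = snoc_word_lin a u + snoc_word_lin a v"
  by (simp add: snoc_word_lin_def linear_ext_add)

lemma cons_lin_add: "cons_lin a (u + v) = cons_lin a u + cons_lin a v"
  by (simp add: cons_lin_def linear_ext_add)

lemma snoc_word_lin_cons_lin: "snoc_word_lin a (cons_lin b u) = cons_lin b (snoc_word_lin a u)"
  by (simp add: snoc_word_lin_def cons_lin_def linear_ext_linear_ext)

lemma shuffle_basis_Nil_right [simp]: "shuffle_basis v [] = Poly_Mapping.single v 1"
  by (cases v) simp_all

text \<open>The definition peels first letters, but differentiating iterated integrals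
  removes last letters.\<close>

lemma shuffle_basis_snoc:
  "shuffle_basis (v @ [a]) (w @ [b]) =
     snoc_word_lin a (shuffle_basis v (w @ [b])) + snoc_word_lin b (shuffle_basis (v @ [a]) w)"
proof (induction v w rule: shuffle_basis.induct)
  case (1 w)
  show ?case
    by (induction w) (simp_all add: snoc_word_lin_add snoc_word_lin_cons_lin cons_lin_add add_ac)
next
  case (2 c v)
  have "shuffle_basis (v @ [a]) [b] = snoc_word_lin a (shuffle_basis v [b]) + Poly_Mapping.single (v @ [a, b]) 1"
    for v
    by (induction v) (simp_all add: snoc_word_lin_add snoc_word_lin_cons_lin cons_lin_add add_ac)
  from this[of "c # v"] show ?case
    by simp
next
  case (3 c v d w)
  have "shuffle_basis ((c # v) @ [a]) ((d # w) @ [b]) =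
      cons_lin c (shuffle_basis (v @ [a]) ((d # w) @ [b])) + cons_lin d (shuffle_basis ((c # v) @ [a]) (w @ [b]))"
    by simp
  also have "\<dots> = snoc_word_lin a (shuffle_basis (c # v) ((d # w) @ [b]))
      + snoc_word_lin b (shuffle_basis ((c # v) @ [a]) (d # w))"
    unfolding 3 by (simp add: snoc_word_lin_add snoc_word_lin_cons_lin cons_lin_add add_ac)
  finally show ?case .
qed

abbreviation y_word :: "letter list \<Rightarrow> bool" where
  "y_word w \<equiv> w = [] \<or> hd w = Y"

lemma y_word_snocD: "y_word (w @ [a]) \<Longrightarrow> y_word w \<and> (w \<noteq> [] \<or> a = Y)"
  by (cases w) auto

text \<open>Keeps the exceptional case of \<open>theta_word_li_snoc\<close>, an \<open>X\<close>
  appended to the empty word, from arising in shuffles.\<close>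

lemma shuffle_basis_nonempty:
  "v \<noteq> [] \<or> w \<noteq> [] \<Longrightarrow> shuffle_basis v w \<in> supp_in (\<lambda>x. x \<noteq> [])"
proof (induction v w rule: shuffle_basis.induct)
  case (3 a v b w)
  then show ?case
    unfolding shuffle_basis.simps cons_lin_def
    by (intro supp_in_add supp_in_linear_ext[of _ "\<lambda>x. x \<noteq> []"]) (auto intro: supp_in_single)
qed (auto intro: supp_in_single)

lemma shuffle_basis_closed: "y_word v \<Longrightarrow> y_word w \<Longrightarrow> shuffle_basis v w \<in> supp_in y_word"
proof (cases v; cases w)
  fix a v' b w'
  assume *: "y_word v" "y_word w" "v = a # v'" "w = b # w'"
  have "u \<in> supp_in (\<lambda>_. True)" for u :: "letter list \<Rightarrow>\<^sub>0 rat"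
    by (simp add: supp_in_def)
  then show ?thesis
    using * unfolding * shuffle_basis.simps cons_lin_def
    by (intro supp_in_add supp_in_linear_ext[of _ "\<lambda>_. True"]) (auto intro: supp_in_single)
qed (auto intro: supp_in_single)

lemma theta_fps_lin: "theta (fps_lin.lin F u) = fps_lin.lin (\<lambda>a. theta (F a)) u"
  unfolding fps_lin.lin_def theta_sum by (intro sum.cong refl fps_ext) simp

lemma fps_lin_snoc_word_lin: "fps_lin.lin F (snoc_word_lin a u) = fps_lin.lin (\<lambda>w. F (w @ [a])) u"
  by (simp add: snoc_word_lin_def fps_lin.lin_linear_ext fps_lin.e_one)

lemma theta_lin_snoc_word_lin:
  assumes "u \<in> supp_in (\<lambda>x. x \<noteq> [] \<or> a = Y)"
  shows "theta (fps_lin.lin word_li (snoc_word_lin a u)) = letter_form a * fps_lin.lin word_li u"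
proof -
  have "theta (fps_lin.lin word_li (snoc_word_lin a u)) = fps_lin.lin (\<lambda>w. letter_form a * word_li w) u"
    unfolding fps_lin_snoc_word_lin theta_fps_lin
    using assms by (intro fps_lin.lin_cong theta_word_li_snoc) (auto simp: supp_in_def)
  then show ?thesis
    by (simp add: fps_lin.lin_fun_cmult)
qed

text \<open>By the Leibniz rule \<open>theta\<close> of the product removes the last letter of one
  factor at a time, exactly as \<open>shuffle_basis_snoc\<close> does on the other side. Induction
  on the total length gives equal derivatives, and both sides vanish at 0.\<close>

lemma word_li_shuffle_basis:
  "y_word v \<Longrightarrow> y_word w \<Longrightarrow> fps_lin.lin word_li (shuffle_basis v w) = word_li v * word_li w"
proof (induction "length v + length w" arbitrary: v w rule: less_induct)
  case less
  consider "v = []" | "w = []" | v' a w' b where "v = v' @ [a]" "w = w' @ [b]"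
    by (metis append_butlast_last_id)
  then show ?case
  proof cases
    case (3 v' a w' b)
    have v': "y_word v'" "v' \<noteq> [] \<or> a = Y" and w': "y_word w'" "w' \<noteq> [] \<or> b = Y"
      using less.prems 3 y_word_snocD by blast+
    have IH1: "fps_lin.lin word_li (shuffle_basis v' (w' @ [b])) = word_li v' * word_li (w' @ [b])"
      using less.prems v' 3 by (intro less.hyps) auto
    have IH2: "fps_lin.lin word_li (shuffle_basis (v' @ [a]) w') = word_li (v' @ [a]) * word_li w'"
      using less.prems w' 3 by (intro less.hyps) auto
    have s1: "shuffle_basis v' (w' @ [b]) \<in> supp_in (\<lambda>x. x \<noteq> [] \<or> a = Y)"
      and s2: "shuffle_basis (v' @ [a]) w' \<in> supp_in (\<lambda>x. x \<noteq> [] \<or> b = Y)"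
      by (rule supp_in_mono[OF shuffle_basis_nonempty]; simp)+
    show ?thesis
      unfolding 3
    proof (rule theta_eqD)
      show "theta (fps_lin.lin word_li (shuffle_basis (v' @ [a]) (w' @ [b]))) =
          theta (word_li (v' @ [a]) * word_li (w' @ [b]))"
        unfolding shuffle_basis_snoc fps_lin.lin_add theta_add theta_lin_snoc_word_lin[OF s1]
          theta_lin_snoc_word_lin[OF s2] IH1 IH2 theta_mult theta_word_li_snoc[OF v'(2)] theta_word_li_snoc[OF w'(2)]
        by (simp add: mult_ac)
      show "fps_nth (fps_lin.lin word_li (shuffle_basis (v' @ [a]) (w' @ [b]))) 0 =
          fps_nth (word_li (v' @ [a]) * word_li (w' @ [b])) 0"
        unfolding shuffle_basis_snoc fps_lin.lin_add fps_lin_snoc_word_lin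
        by (simp add: fps_lin.lin_def fps_sum_nth word_li_nth_0)
    qed
  qed (simp_all add: fps_lin.e_one)
qed

section \<open>Convergence and evaluation in the unit disc\<close>

lemma fps_conv_radius_mono:
  fixes f g :: "real fps"
  assumes "\<And>n. \<bar>fps_nth g n\<bar> \<le> \<bar>fps_nth f n\<bar>"
  shows "fps_conv_radius f \<le> fps_conv_radius g"
  unfolding fps_conv_radius_def[of g]
proof (rule conv_radius_geI_ex')
  fix r :: real
  assume r: "0 < r" "ereal r < fps_conv_radius f"
  then have "summable (\<lambda>n. norm (fps_nth f n * of_real r ^ n))"
    by (intro abs_summable_in_conv_radius) (simp_all add: fps_conv_radius_def)
  then show "summable (\<lambda>n. fps_nth g n * of_real r ^ n)"
    by (rule summable_comparison_test'[of _ 0])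
      (use assms r in \<open>auto simp: abs_mult intro!: mult_right_mono\<close>)
qed

lemma fps_conv_radius_geo: "fps_conv_radius geo \<ge> 1"
  unfolding fps_conv_radius_def
proof (rule conv_radius_geI_ex')
  fix r :: real
  assume r: "0 < r" "ereal r < 1"
  then have "summable (\<lambda>n. r ^ n)"
    by (intro summable_geometric) simp
  then show "summable (\<lambda>n. fps_nth geo n * of_real r ^ n)"
    by (rule summable_comparison_test'[of _ 0]) (use r in \<open>auto simp: geo_def\<close>)
qed

lemma fps_conv_radius_mult_ge:
  "fps_conv_radius f \<ge> R \<Longrightarrow> fps_conv_radius g \<ge> R \<Longrightarrow> fps_conv_radius (f * g) \<ge> R" for f g :: "real fps"
  using fps_conv_radius_mult[of f g] by (meson min.boundedI order_trans)

lemma fps_conv_radius_word_li: "fps_conv_radius (word_li w) \<ge> 1"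
proof (induction w rule: rev_induct)
  case (snoc a w)
  have le: "\<bar>x\<bar> / real n \<le> \<bar>x\<bar>" for x n
    by (cases n) (auto simp: field_simps)
  show ?case
  proof (cases a)
    case X
    have "fps_conv_radius (word_li w) \<le> fps_conv_radius (word_li (w @ [a]))"
      unfolding X word_li_snoc_X by (rule fps_conv_radius_mono) (simp add: le)
    with snoc show ?thesis
      by (rule order_trans)
  next
    case Y
    have "fps_conv_radius (geo * word_li w) \<le> fps_conv_radius (word_li (w @ [a]))"
      unfolding Y word_li_snoc_Y by (rule fps_conv_radius_mono) (simp add: le)
    with fps_conv_radius_mult_ge[OF fps_conv_radius_geo snoc] show ?thesis
      by (rule order_trans)
  qed
qed simp

lemma eval_fps_sum:
  fixes f :: "'a \<Rightarrow> real fps"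
  assumes "\<And>x. x \<in> A \<Longrightarrow> fps_conv_radius (f x) \<ge> 1" "\<bar>z\<bar> < 1"
  shows "eval_fps (\<Sum>x\<in>A. f x) z = (\<Sum>x\<in>A. eval_fps (f x) z) \<and> fps_conv_radius (\<Sum>x\<in>A. f x) \<ge> 1"
  using assms(1)
proof (induction A rule: infinite_finite_induct)
  case (insert x A)
  have z: "ereal (norm z) < fps_conv_radius g" if "fps_conv_radius g \<ge> 1" for g :: "real fps"
    using less_le_trans[OF _ that, of "ereal (norm z)"] assms(2) by simp
  show ?case
    using insert z fps_conv_radius_add[of "f x" "sum f A"]
    by (auto simp: eval_fps_add intro: order_trans[rotated])
qed auto

lemma eval_fps_mult_1:
  fixes f g :: "real fps"
  assumes "fps_conv_radius f \<ge> 1" "fps_conv_radius g \<ge> 1" "\<bar>z\<bar> < 1"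
  shows "eval_fps (f * g) z = eval_fps f z * eval_fps g z"
  using assms less_le_trans[of "ereal (norm z)" 1] by (intro eval_fps_mult) auto

lemma eval_fps_lin:
  assumes "\<bar>z\<bar> < 1"
  shows "eval_fps (fps_lin.lin word_li u) z = real_lin.lin (\<lambda>w. eval_fps (word_li w) z) u"
proof -
  have r: "fps_conv_radius (fps_const c * word_li w) \<ge> 1" for c w
    by (intro fps_conv_radius_mult_ge fps_conv_radius_word_li) simp
  show ?thesis
    unfolding fps_lin.lin_def real_lin.lin_def using assms r
    by (simp add: eval_fps_sum eval_fps_mult_1 fps_conv_radius_word_li)
qed

section \<open>Asymptotics of polylogarithms at \<open>z = 1\<close>\<close>

definition log1m :: "real \<Rightarrow> real" where
  "log1m z = - ln (1 - z)"

interpretation log_scale_1: log_scale "at_left (1::real)" log1m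
proof
  show "filterlim log1m at_top (at_left 1)"
    unfolding log1m_def[abs_def] by real_asymp
qed simp

lemma eventually_at_left_1: "eventually (\<lambda>z::real. 0 < z \<and> z < 1) (at_left 1)"
  by (rule eventually_at_leftI[of 0]) auto

lemma eval_word_li_Y:
  assumes "0 < z" "z < 1"
  shows "eval_fps (word_li [Y]) z = log1m z"
proof -
  have "(\<lambda>n. - ((- (- z)) ^ n) / of_nat n) sums ln (1 + (- z))"
    using assms by (intro ln_series') auto
  then have "(\<lambda>n. - (- ((- (- z)) ^ n) / of_nat n)) sums log1m z"
    unfolding log1m_def using sums_minus by fastforce
  moreover have "fps_nth (word_li [Y]) n * z ^ n = - (- ((- (- z)) ^ n) / of_nat n)" for n
    using word_li_snoc_Y[of "[]"] by (cases n) (auto simp: geo_def)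
  ultimately have "(\<lambda>n. fps_nth (word_li [Y]) n * z ^ n) sums log1m z"
    by simp
  then show ?thesis
    by (simp add: eval_fps_def sums_iff)
qed

text \<open>Bernoulli gives the bound \<open>n (1 - z)\<close>, and since the left side lies between
  0 and 1 two square roots may be taken. The fourth root asks for only \<open>n^(1/4)\<close> as a
  weight on coefficients; for coefficients of order \<open>n^(-3/2)\<close> a square root would end
  at the divergent \<open>n^(-1)\<close>.\<close>

lemma one_minus_power_le_root4:
  assumes "0 < z" "z < 1"
  shows "1 - z ^ n \<le> sqrt (sqrt (real n)) * sqrt (sqrt (1 - z))"
proof -
  have le_sqrt: "x \<le> sqrt y" if "0 \<le> x" "x \<le> 1" "x \<le> y" for x y :: real
    using that mult_left_le[of x x] by (intro real_le_rsqrt) (simp add: power2_eq_square)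
  have x: "0 \<le> 1 - z ^ n" "1 - z ^ n \<le> 1"
    using assms by (simp_all add: power_le_one)
  have "1 - z ^ n \<le> real n * (1 - z)"
    using Bernoulli_inequality[of "z - 1" n] assms by (simp add: algebra_simps)
  then have "1 - z ^ n \<le> sqrt (sqrt (real n * (1 - z)))"
    by (intro le_sqrt x)
  then show ?thesis
    by (simp add: real_sqrt_mult)
qed

text \<open>In terms of \<open>L = log1m z\<close> the fourth root is \<open>exp (- L / 4)\<close>,
  which beats every power of \<open>L\<close>.\<close>

lemma negligible_root4: "log_scale_1.negligible (\<lambda>z. sqrt (sqrt (1 - z)))"
  unfolding log_scale_1.negligible_def
proof
  fix m
  have "filterlim (\<lambda>z::real. log1m z / 4) at_top (at_left 1)"
    unfolding log1m_def[abs_def] by real_asymp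
  then have "((\<lambda>z. (log1m z / 4) ^ m / exp (log1m z / 4)) \<longlongrightarrow> 0) (at_left 1)"
    by (rule filterlim_compose[OF tendsto_power_div_exp_0])
  then have *: "((\<lambda>z. 4 ^ m * ((log1m z / 4) ^ m / exp (log1m z / 4))) \<longlongrightarrow> 0) (at_left 1)"
    by (rule tendsto_mult_right_zero)
  have "4 ^ m * ((log1m z / 4) ^ m / exp (log1m z / 4)) = sqrt (sqrt (1 - z)) * log1m z ^ m" if "0 < z" "z < 1" for z
  proof -
    have "sqrt (sqrt (1 - z)) = exp (ln (1 - z) / 4)"
      using that by (simp add: powr_def flip: powr_half_sqrt)
    also have "\<dots> = inverse (exp (log1m z / 4))"
      by (simp add: log1m_def exp_minus[symmetric])
    finally have sqrt_eq: "sqrt (sqrt (1 - z)) = inverse (exp (log1m z / 4))" .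
    show ?thesis
      unfolding sqrt_eq power_divide by (simp add: divide_simps)
  qed
  then show "((\<lambda>z. sqrt (sqrt (1 - z)) * log1m z ^ m) \<longlongrightarrow> 0) (at_left 1)"
    by (intro Lim_transform_eventually[OF *] eventually_mono[OF eventually_at_left_1]) auto
qed

text \<open>Abel's theorem with a rate: the difference is the sum of the coefficients times
  \<open>1 - z^n\<close>, hence at most a constant times the fourth root of
  \<open>1 - z\<close>.\<close>

lemma negligible_eval_summable:
  fixes f :: "real fps"
  assumes "summable (\<lambda>n. \<bar>fps_nth f n\<bar> * sqrt (sqrt (real n)))"
  shows "log_scale_1.negligible (\<lambda>z. eval_fps f z - suminf (fps_nth f))"
proof -
  define K where "K = suminf (\<lambda>n. \<bar>fps_nth f n\<bar> * sqrt (sqrt (real n)))"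
  have s0: "summable (\<lambda>n. \<bar>fps_nth f n\<bar>)"
  proof (rule summable_comparison_test[OF _ assms], intro exI allI impI)
    fix n :: nat
    assume "n \<ge> 1"
    then show "norm \<bar>fps_nth f n\<bar> \<le> \<bar>fps_nth f n\<bar> * sqrt (sqrt (real n))"
      by (simp add: mult_le_cancel_left1)
  qed
  then have sf: "summable (fps_nth f)"
    by (rule summable_rabs_cancel)
  have bound: "\<bar>eval_fps f z - suminf (fps_nth f)\<bar> \<le> K * sqrt (sqrt (1 - z))" if z: "0 < z" "z < 1" for z
  proof -
    have sz: "summable (\<lambda>n. fps_nth f n * z ^ n)"
      using z by (intro summable_comparison_test'[OF s0, of 0]) (auto simp: abs_mult power_abs mult_left_le power_le_one)
    have eq: "suminf (fps_nth f) - eval_fps f z = suminf (\<lambda>n. fps_nth f n * (1 - z ^ n))"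
      unfolding eval_fps_def by (simp add: suminf_diff[OF sf sz] algebra_simps)
    have le: "norm (fps_nth f n * (1 - z ^ n)) \<le> \<bar>fps_nth f n\<bar> * sqrt (sqrt (real n)) * sqrt (sqrt (1 - z))" for n
      using one_minus_power_le_root4[OF z, of n] z power_le_one[of z n]
      by (simp add: abs_mult mult.assoc mult_left_mono)
    have "norm (suminf (fps_nth f) - eval_fps f z)
        \<le> suminf (\<lambda>n. \<bar>fps_nth f n\<bar> * sqrt (sqrt (real n)) * sqrt (sqrt (1 - z)))"
      unfolding eq by (rule norm_suminf_le[OF le summable_mult2[OF assms]])
    also have "\<dots> = K * sqrt (sqrt (1 - z))"
      unfolding K_def by (rule suminf_mult2[OF assms, symmetric])
    finally show ?thesis
      by (simp add: abs_minus_commute)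
  qed
  show ?thesis
    unfolding log_scale_1.negligible_def
  proof
    fix m
    have *: "((\<lambda>z. K * \<bar>sqrt (sqrt (1 - z)) * log1m z ^ m\<bar>) \<longlongrightarrow> 0) (at_left 1)"
      using negligible_root4 unfolding log_scale_1.negligible_def
      by (intro tendsto_mult_right_zero tendsto_rabs_zero) blast
    have "norm ((eval_fps f z - suminf (fps_nth f)) * log1m z ^ m) \<le> K * \<bar>sqrt (sqrt (1 - z)) * log1m z ^ m\<bar>"
      if z: "0 < z" "z < 1" for z
      using mult_right_mono[OF bound[OF z], of "\<bar>log1m z ^ m\<bar>"] z by (simp add: abs_mult mult_ac)
    then show "((\<lambda>z. (eval_fps f z - suminf (fps_nth f)) * log1m z ^ m) \<longlongrightarrow> 0) (at_left 1)"
      by (intro Lim_null_comparison[OF _ *] eventually_mono[OF eventually_at_left_1]) auto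
  qed
qed

definition li :: "nat list \<Rightarrow> real fps" where
  "li ks = Abs_fps (li_coeff ks)"

lemma negligible_li:
  assumes "admissible ks"
  shows "log_scale_1.negligible (\<lambda>z. eval_fps (li ks) z - mzv ks)"
proof -
  have "fps_nth (li ks) = li_coeff ks"
    by (simp add: li_def fun_eq_iff)
  moreover have "summable (\<lambda>n. \<bar>li_coeff ks n\<bar> * sqrt (sqrt (real n)))"
  proof (rule summable_comparison_test'[OF summable_li_coeff_weighted[OF assms, of 0], of 1])
    fix n :: nat
    assume "n \<ge> 1"
    then have "sqrt (sqrt (real n)) \<le> sqrt (real n)"
      using real_sqrt_le_mono[of "sqrt (real n)" "real n"] self_le_power[of "sqrt (real n)" 2] by simp
    then show "norm (\<bar>li_coeff ks n\<bar> * sqrt (sqrt (real n))) \<le> li_coeff ks n * (sqrt (real n) * harm n ^ 0)"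
      by (simp add: li_coeff_nonneg mult_left_mono)
  qed
  ultimately show ?thesis
    using negligible_eval_summable[of "li ks"] by (simp add: mzv_eq_suminf[OF assms])
qed

text \<open>The additional \<open>Y\<close> has \<open>n + 1\<close> places in the trailing block
  and otherwise stands to the left of an \<open>X\<close>. That words of the remainder contain an
  \<open>X\<close> is carried along because prepending a letter then cannot lengthen the trailing
  block.\<close>

lemma shuffle_basis_Y:
  assumes "v = [] \<or> last v = X"
  shows "\<exists>r\<in>supp_in (\<lambda>x. X \<in> set x \<and> trailing Y x \<le> n).
    shuffle_basis (v @ replicate n Y) [Y] = Poly_Mapping.single (v @ replicate (Suc n) Y) (of_nat (Suc n)) + r"
  using assms
proof (induction v)
  case Nil
  have "shuffle_basis (replicate n Y) [Y] = Poly_Mapping.single (replicate (Suc n) Y) (of_nat (Suc n))" for n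
    by (induction n) (simp_all add: add_ac flip: single_add)
  then show ?case
    by (intro bexI[of _ 0]) simp_all
next
  case (Cons a v)
  let ?P = "\<lambda>x. X \<in> set x \<and> trailing Y x \<le> n"
  have last: "last (a # v) = X"
    using Cons.prems by simp
  then obtain r where r: "r \<in> supp_in ?P"
    "shuffle_basis (v @ replicate n Y) [Y] = Poly_Mapping.single (v @ replicate (Suc n) Y) (of_nat (Suc n)) + r"
    using Cons.IH by (cases "v = []") auto
  have X: "X \<in> set (a # v)"
    using last last_in_set[of "a # v"] by simp
  have "trailing Y ((a # v) @ replicate n Y) = n"
    unfolding trailing_append_replicate using last trailing_eq_0_iff[of Y "a # v"] by simp
  then have t: "trailing Y (Y # (a # v) @ replicate n Y) = n"
    using X by (subst trailing_Cons[of X]) auto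
  have "cons_lin a r \<in> supp_in ?P"
    unfolding cons_lin_def
    by (rule supp_in_linear_ext[OF r(1)]) (auto intro!: supp_in_single simp: trailing_Cons[of X])
  moreover have "Poly_Mapping.single (Y # (a # v) @ replicate n Y) 1 \<in> supp_in ?P"
    using X t by (intro supp_in_single) auto
  ultimately have "cons_lin a r + Poly_Mapping.single (Y # (a # v) @ replicate n Y) 1 \<in> supp_in ?P"
    by (rule supp_in_add)
  then show ?case
    using r(2) by (intro bexI) (auto simp: cons_lin_add add_ac)
qed

lemma y_word_eq_word_of_index:
  assumes "y_word w"
  shows "\<exists>ks. is_index ks \<and> w = word_of_index ks"
  using assms
proof (induction w rule: length_induct)
  case (1 w)
  show ?case
  proof (cases "w = []")
    case True
    then show ?thesis
      by (intro exI[of _ "[]"]) (simp add: is_index_def word_of_index_def)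
  next
    case False
    obtain v where v: "w = v @ replicate (trailing X w) X" "trailing X v = 0"
      using trailing_decomp[of X w] by blast
    have "v \<noteq> []"
    proof
      assume "v = []"
      then have "w = replicate (trailing X w) X"
        using v by simp
      then have "hd w = X"
        using False by (metis hd_replicate replicate_0)
      then show False
        using "1.prems" False by simp
    qed
    then have "last v = Y"
      using v(2) letter.exhaust by (auto simp: trailing_eq_0_iff)
    then obtain v' where v': "v = v' @ [Y]"
      using \<open>v \<noteq> []\<close> by (metis append_butlast_last_id)
    have "hd w = hd v'" if "v' \<noteq> []"
      by (subst v(1)) (simp add: v' that)
    then have "y_word v'"
      using "1.prems" False by metis
    moreover have "length v' < length w"
      by (subst v(1)) (simp add: v')
    ultimately obtain ks where ks: "is_index ks" "v' = word_of_index ks"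
      using "1.IH" by blast
    have "w = word_of_index (ks @ [Suc (trailing X w)])"
      by (subst v(1)) (simp add: v' ks word_of_index_snoc)
    then show ?thesis
      using ks by (intro exI[of _ "ks @ [Suc (trailing X w)]"]) simp
  qed
qed

lemma y_word_word_of_index: "y_word (word_of_index ks)"
  by (cases ks) (simp_all add: word_of_index_def)

lemma trailing_word_of_index:
  assumes "is_index ks"
  shows "trailing Y (word_of_index ks) = 0 \<longleftrightarrow> admissible ks"
proof (cases ks rule: rev_cases)
  case Nil
  then show ?thesis
    by (simp add: word_of_index_def admissible_def is_index_def)
next
  case (snoc ls l)
  then show ?thesis
    using assms by (cases "l = 1")
      (auto simp: admissible_def word_of_index_snoc trailing_eq_0_iff)
qed

lemma eval_word_of_index: "is_index ks \<Longrightarrow> word_li (word_of_index ks) = li ks"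
  by (simp add: li_def word_li_word_of_index)

interpretation shuffle_reg: regularization_data "at_left (1::real)" log1m
  y_word shuffle_basis "[Y]" "trailing Y" "\<lambda>w. eval_fps (word_li w)"
proof unfold_locales
  show "y_word [Y]"
    by simp
  show "\<forall>\<^sub>F z in at_left 1. eval_fps (word_li [Y]) z = log1m z"
    using eventually_at_left_1 by eventually_elim (simp add: eval_word_li_Y)
  show "shuffle_basis a b \<in> supp_in y_word" if "y_word a" "y_word b" for a b
    using that by (rule shuffle_basis_closed)
  show "\<exists>b c r. y_word b \<and> trailing Y b = n \<and> c \<noteq> 0 \<and> r \<in> supp_in (\<lambda>x. y_word x \<and> trailing Y x \<le> n)
      \<and> shuffle_basis b [Y] = Poly_Mapping.single a c + r"
    if a: "y_word a" "trailing Y a = Suc n" for a n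
  proof -
    obtain v where v: "a = v @ replicate (Suc n) Y" "trailing Y v = 0"
      using trailing_decomp[OF a(2)] by (elim exE conjE)
    then have "v = [] \<or> last v = X"
      using letter.exhaust by (auto simp: trailing_eq_0_iff)
    then obtain r where r: "r \<in> supp_in (\<lambda>x. X \<in> set x \<and> trailing Y x \<le> n)"
      "shuffle_basis (v @ replicate n Y) [Y] = Poly_Mapping.single a (of_nat (Suc n)) + r"
      using shuffle_basis_Y[of v n] unfolding v(1) by blast
    have "y_word v"
      using a(1) unfolding v(1) by (cases v) simp_all
    then have "y_word (v @ replicate n Y)"
      by (cases v; cases n) simp_all
    moreover have "trailing Y (v @ replicate n Y) = n"
      using v(2) by (simp only: trailing_append_replicate add_0_right)
    ultimately have b: "y_word (v @ replicate n Y)" "trailing Y (v @ replicate n Y) = n"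
      by blast+
    \<comment> \<open>\<open>shuffle_basis_Y\<close> does not control the first letters in the
      remainder. They follow by subtraction, as the product of words starting with \<open>Y\<close>
      stays in their span.\<close>
    have "r = shuffle_basis (v @ replicate n Y) [Y] + qscale (-1) (Poly_Mapping.single a (of_nat (Suc n)))"
      unfolding r(2) by (rule poly_mapping_eqI) (simp add: lookup_add lookup_single when_def)
    also have "\<dots> \<in> supp_in y_word"
      using a(1) b(1) by (intro supp_in_add supp_in_qscale supp_in_single shuffle_basis_closed) simp_all
    finally have "r \<in> supp_in (\<lambda>x. y_word x \<and> trailing Y x \<le> n)"
      using r(1) by (simp add: supp_in_def)
    moreover have "(of_nat (Suc n) :: rat) \<noteq> 0"
      by (simp only: of_nat_eq_0_iff)
    ultimately show ?thesis
      using r(2) b by blast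
  qed
  show "\<forall>\<^sub>F z in at_left 1. real_lin.lin (\<lambda>c. eval_fps (word_li c) z) (shuffle_basis a b) =
      eval_fps (word_li a) z * eval_fps (word_li b) z" if "y_word a" "y_word b" for a b
    using eventually_at_left_1
  proof eventually_elim
    case (elim z)
    then have "real_lin.lin (\<lambda>c. eval_fps (word_li c) z) (shuffle_basis a b) =
        eval_fps (fps_lin.lin word_li (shuffle_basis a b)) z"
      by (intro eval_fps_lin[symmetric]) simp
    also have "\<dots> = eval_fps (word_li a) z * eval_fps (word_li b) z"
      unfolding word_li_shuffle_basis[OF that] using elim
      by (intro eval_fps_mult_1 fps_conv_radius_word_li) simp
    finally show ?case .
  qed
  show "log_scale_1.has_asym (eval_fps (word_li a))" if a: "y_word a" "trailing Y a = 0" for a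
  proof -
    obtain ks where ks: "is_index ks" "a = word_of_index ks"
      using y_word_eq_word_of_index[OF a(1)] by (elim exE conjE)
    then have "admissible ks"
      using a(2) trailing_word_of_index[OF ks(1)] by simp
    then show ?thesis
      using log_scale_1.has_asym_tendsto_const(1)[OF negligible_li] ks by (simp add: eval_word_of_index)
  qed
qed

lemma const_term_li: "admissible ks \<Longrightarrow> log_scale_1.const_term (eval_fps (li ks)) = mzv ks"
  by (rule log_scale_1.has_asym_tendsto_const(2)[OF negligible_li])

lemma const_term_word_of_index:
  "admissible ks \<Longrightarrow> log_scale_1.const_term (eval_fps (word_li (word_of_index ks))) = mzv ks"
  by (simp only: eval_word_of_index[OF admissible_imp_is_index] const_term_li)

lemma y_word_admissible:
  assumes "y_word a" "trailing Y a = 0"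
  shows "\<exists>ks. admissible ks \<and> a = word_of_index ks"
  using y_word_eq_word_of_index[OF assms(1)] assms(2) trailing_word_of_index by blast

lemma is_shuffle_reg_iff: "is_shuffle_reg f \<longleftrightarrow> shuffle_reg.is_reg f"
proof -
  have "(\<forall>a. y_word a \<and> trailing Y a = 0 \<longrightarrow>
        f (Poly_Mapping.single a 1) = log_scale_1.const_term (eval_fps (word_li a)))
      \<longleftrightarrow> (\<forall>ks. admissible ks \<longrightarrow> f (Poly_Mapping.single (word_of_index ks) 1) = mzv ks)"
  proof (intro iffI allI impI)
    fix ks
    assume *: "\<forall>a. y_word a \<and> trailing Y a = 0 \<longrightarrow>
        f (Poly_Mapping.single a 1) = log_scale_1.const_term (eval_fps (word_li a))" "admissible ks"
    have "trailing Y (word_of_index ks) = 0"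
      using trailing_word_of_index *(2) admissible_imp_is_index by blast
    then show "f (Poly_Mapping.single (word_of_index ks) 1) = mzv ks"
      using *(1) y_word_word_of_index const_term_word_of_index[OF *(2)] by simp
  next
    fix a
    assume *: "\<forall>ks. admissible ks \<longrightarrow> f (Poly_Mapping.single (word_of_index ks) 1) = mzv ks"
      "y_word a \<and> trailing Y a = 0"
    then obtain ks where "admissible ks" "a = word_of_index ks"
      using y_word_admissible by blast
    then show "f (Poly_Mapping.single a 1) = log_scale_1.const_term (eval_fps (word_li a))"
      using *(1) const_term_word_of_index by simp
  qed
  moreover have "word_of_index [1] = [Y]"
    by (simp add: word_of_index_def)
  ultimately show ?thesis
    unfolding is_shuffle_reg_def shuffle_reg.is_reg_def word_space_eq shuffle_prod_def by simp
qed

lemma zeta_shuffle_eq_reg: "zeta_shuffle ks = shuffle_reg.reg (Poly_Mapping.single (word_of_index ks) 1)"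
  unfolding zeta_shuffle_def is_shuffle_reg_iff shuffle_reg.The_is_reg ..

lemma zeta_shuffle_eq:
  assumes "is_index ks"
  shows "zeta_shuffle ks = log_scale_1.const_term (eval_fps (li ks))"
  unfolding zeta_shuffle_eq_reg shuffle_reg.reg_single[OF y_word_word_of_index] eval_word_of_index[OF assms] ..

lemma has_asym_li: "is_index ks \<Longrightarrow> log_scale_1.has_asym (eval_fps (li ks))"
  using shuffle_reg.has_asym_F[OF y_word_word_of_index, of ks] by (simp only: eval_word_of_index)

lemma zeta_shuffle_in_mzv_space: "zeta_shuffle ks \<in> mzv_space"
  unfolding zeta_shuffle_eq_reg
proof (rule shuffle_reg.reg_in_subspace)
  show "Poly_Mapping.single (word_of_index ks) 1 \<in> supp_in y_word"
    by (intro supp_in_single y_word_word_of_index)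
  show "log_scale_1.const_term (eval_fps (word_li a)) \<in> mzv_space" if a: "y_word a" "trailing Y a = 0" for a
    using y_word_admissible[OF a] const_term_word_of_index mzv_in_mzv_space by auto
qed (auto intro: mzv_space_zero mzv_space_add mzv_space_scale)

lemma zeta_reg_in_mzv_space: "is_index ks \<Longrightarrow> zeta_reg b ks \<in> mzv_space"
  by (cases b) (simp_all add: zeta_harmonic_in_mzv_space zeta_shuffle_in_mzv_space)

section \<open>Comparison of the two regularizations\<close>

lemma zeta_reg_admissible: "admissible ks \<Longrightarrow> zeta_reg b ks = mzv ks"
  by (cases b) (simp_all add: zeta_harmonic_eq zeta_shuffle_eq admissible_imp_is_index const_term_hsum const_term_li)

text \<open>The \<open>n\<close>-th coefficient of \<open>mzv ks\<close> times
  \<open>- ln (1 - z)\<close> minus the polylogarithm of \<open>(ks, 1)\<close>: the cost of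
  replacing a truncated sum by its limit. Both regularized values at \<open>(ks, 1)\<close> are
  minus the sum of these coefficients.\<close>

definition hsum_defect :: "nat list \<Rightarrow> nat \<Rightarrow> real" where
  "hsum_defect ks n = (if n = 0 then 0 else (mzv ks - hsum ks (n - 1)) / real n)"

text \<open>In the tail beyond \<open>m\<close> the weight is at least \<open>sqrt (m + 1)\<close>,
  so the weighted sum \<open>K\<close> bounds the tail times this root. Dividing by
  \<open>n = m + 1\<close> gives the exponent -3/2.\<close>

lemma hsum_defect_bound:
  assumes "admissible ks"
  obtains K where "\<And>n. \<bar>hsum_defect ks n\<bar> \<le> K * real n powr (- 3 / 2)"
proof -
  have s: "summable (\<lambda>n. li_coeff ks n * sqrt (real n))"
    using summable_li_coeff_weighted[OF assms, of 0] by simp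
  define K where "K = suminf (\<lambda>n. li_coeff ks n * sqrt (real n))"
  have tail: "0 \<le> mzv ks - hsum ks m \<and> (mzv ks - hsum ks m) * sqrt (real (Suc m)) \<le> K" for m
  proof -
    have s1: "summable (\<lambda>n. li_coeff ks (n + Suc m))"
      by (rule summable_ignore_initial_segment[OF summable_li_coeff[OF assms]])
    have s2: "summable (\<lambda>n. li_coeff ks (n + Suc m) * sqrt (real (n + Suc m)))"
      by (rule summable_ignore_initial_segment[OF s])
    have nn: "0 \<le> mzv ks - hsum ks m"
      unfolding mzv_minus_hsum[OF assms] by (intro suminf_nonneg s1 li_coeff_nonneg)
    have "(mzv ks - hsum ks m) * sqrt (real (Suc m)) = suminf (\<lambda>n. li_coeff ks (n + Suc m) * sqrt (real (Suc m)))"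
      unfolding mzv_minus_hsum[OF assms] by (rule suminf_mult2[OF s1])
    also have "\<dots> \<le> suminf (\<lambda>n. li_coeff ks (n + Suc m) * sqrt (real (n + Suc m)))"
      by (intro suminf_le summable_mult2 s1 s2 mult_left_mono li_coeff_nonneg) simp
    also have "\<dots> = K - (\<Sum>n<Suc m. li_coeff ks n * sqrt (real n))"
      unfolding K_def by (rule suminf_minus_initial_segment[OF s])
    also have "\<dots> \<le> K"
      using sum_nonneg[of "{..<Suc m}" "\<lambda>n. li_coeff ks n * sqrt (real n)"] by (simp add: li_coeff_nonneg)
    finally show ?thesis
      using nn by blast
  qed
  have "\<bar>hsum_defect ks n\<bar> \<le> K * real n powr (- 3 / 2)" for n
  proof (cases n)
    case (Suc m)
    have "hsum_defect ks n = (mzv ks - hsum ks m) * sqrt (real n) / (real n * sqrt (real n))"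
      by (simp add: hsum_defect_def Suc)
    also have "\<dots> \<le> K / (real n * sqrt (real n))"
      using tail[of m] Suc by (intro divide_right_mono) auto
    also have "real n * sqrt (real n) = real n powr (3 / 2)"
      using powr_add[of "real n" 1 "1 / 2"] Suc by (simp add: powr_half_sqrt)
    finally show ?thesis
      using tail[of m] Suc by (simp add: hsum_defect_def powr_minus_divide)
  qed (simp add: hsum_defect_def)
  then show ?thesis
    by (rule that)
qed

lemma summable_hsum_defect:
  assumes "admissible ks"
  shows "summable (\<lambda>n. \<bar>hsum_defect ks n\<bar> * sqrt (sqrt (real n)))" "summable (hsum_defect ks)"
proof -
  obtain K where K: "\<And>n. \<bar>hsum_defect ks n\<bar> \<le> K * real n powr (- 3 / 2)"
    using hsum_defect_bound[OF assms] by blast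
  show "summable (hsum_defect ks)"
    by (rule summable_comparison_test'[of "\<lambda>n. K * real n powr (- 3 / 2)" 0])
      (use K in \<open>auto intro!: summable_mult simp: summable_real_powr_iff\<close>)
  show "summable (\<lambda>n. \<bar>hsum_defect ks n\<bar> * sqrt (sqrt (real n)))"
  proof (rule summable_comparison_test'[of "\<lambda>n. K * real n powr (- 5 / 4)" 0])
    fix n
    have root4: "sqrt (sqrt (real n)) = real n powr (1 / 4)"
      by (simp add: powr_powr flip: powr_half_sqrt)
    have "\<bar>hsum_defect ks n\<bar> * sqrt (sqrt (real n)) \<le> K * real n powr (- 3 / 2) * real n powr (1 / 4)"
      using K unfolding root4 by (intro mult_right_mono) simp_all
    also have "K * real n powr (- 3 / 2) * real n powr (1 / 4) = K * real n powr (- 5 / 4)"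
      using powr_add[of "real n" "- 3 / 2" "1 / 4"] by simp
    finally show "norm (\<bar>hsum_defect ks n\<bar> * sqrt (sqrt (real n))) \<le> K * real n powr (- 5 / 4)"
      by simp
  qed (auto intro!: summable_mult simp: summable_real_powr_iff)
qed

lemma is_index_snoc_1: "admissible ks \<Longrightarrow> is_index (ks @ [1])"
  by (simp add: admissible_imp_is_index)

text \<open>The truncated sum is \<open>mzv ks * harm N\<close> minus a partial sum of the defects.
  Convergence of the latter suffices, since an expansion is already known to exist.\<close>

lemma zeta_harmonic_snoc_1:
  assumes "admissible ks"
  shows "zeta_harmonic (ks @ [1]) = - suminf (hsum_defect ks)"
proof -
  obtain p where p: "harm_scale.asym (hsum (ks @ [1])) p"
    using harm_reg.has_asym_F[OF is_index_snoc_1[OF assms]] harm_scale.has_asym_def by blast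
  have "hsum (ks @ [1]) N = mzv ks * harm N - (\<Sum>n\<le>N. hsum_defect ks n)" for N
  proof (induction N)
    case (Suc N)
    then show ?case
      by (simp only: hsum_snoc_Suc sum.atMost_Suc)
        (simp add: hsum_defect_def harm_Suc divide_simps, simp add: algebra_simps)
  qed (simp only: hsum_snoc_0, simp add: hsum_defect_def harm_expand)
  then have "(\<lambda>N. hsum (ks @ [1]) N - poly [:- suminf (hsum_defect ks), mzv ks:] (harm N))
      = (\<lambda>N. suminf (hsum_defect ks) - (\<Sum>n\<le>N. hsum_defect ks n))"
    by (simp add: fun_eq_iff algebra_simps)
  moreover have "(\<lambda>N. suminf (hsum_defect ks) - (\<Sum>n\<le>N. hsum_defect ks n)) \<longlonglongrightarrow> 0"
    using tendsto_diff[OF tendsto_const summable_LIMSEQ'[OF summable_hsum_defect(2)[OF assms]]]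
    by (metis diff_self)
  ultimately have "p = [:- suminf (hsum_defect ks), mzv ks:]"
    using harm_scale.asym_imp_eq[OF p] by metis
  then show ?thesis
    using harm_scale.const_term_eq[OF p] zeta_harmonic_eq[OF is_index_snoc_1[OF assms]] by simp
qed

lemma fps_conv_radius_li: "is_index ks \<Longrightarrow> fps_conv_radius (li ks) \<ge> 1"
  using fps_conv_radius_word_li[of "word_of_index ks"] by (simp add: eval_word_of_index)

text \<open>The same decomposition for power series; here the defect series tends to its sum at the
  rate of \<open>negligible_eval_summable\<close>.\<close>

lemma zeta_shuffle_snoc_1:
  assumes "admissible ks"
  shows "zeta_shuffle (ks @ [1]) = - suminf (hsum_defect ks)"
proof -
  define D where "D = Abs_fps (hsum_defect ks)"
  have nthD: "fps_nth D = hsum_defect ks"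
    by (simp add: D_def fun_eq_iff)
  have li_eq: "li (ks @ [1]) = fps_const (mzv ks) * word_li [Y] - D"
  proof (rule fps_ext)
    fix n
    have "fps_nth (word_li [Y]) n = (if n = 0 then 0 else 1 / real n)"
      using word_li_snoc_Y[of "[]"] by (simp add: geo_def)
    moreover have "li_coeff (ks @ [1]) n = (if n = 0 then 0 else hsum ks (n - 1) / real n)"
      by (cases n) (simp_all only: li_coeff_snoc_Suc li_coeff_snoc_0, simp_all)
    ultimately show "fps_nth (li (ks @ [1])) n = fps_nth (fps_const (mzv ks) * word_li [Y] - D) n"
      by (simp add: li_def D_def hsum_defect_def diff_divide_distrib)
  qed
  then have "D = fps_const (mzv ks) * word_li [Y] - li (ks @ [1])"
    by simp
  then have rD: "fps_conv_radius D \<ge> 1"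
    using fps_conv_radius_li[OF is_index_snoc_1[OF assms]]
    by (auto intro!: order_trans[OF _ fps_conv_radius_diff] fps_conv_radius_mult_ge fps_conv_radius_word_li)
  have negl: "log_scale_1.negligible (\<lambda>z. eval_fps D z - suminf (hsum_defect ks))"
    using negligible_eval_summable[of D] summable_hsum_defect(1)[OF assms] by (simp add: nthD)
  have ev: "eventually (\<lambda>z. eval_fps (li (ks @ [1])) z = mzv ks * log1m z + (-1) * eval_fps D z) (at_left 1)"
    using eventually_at_left_1
  proof eventually_elim
    case (elim z)
    have lt: "ereal (norm z) < R" if "R \<ge> 1" for R
      using less_le_trans[OF _ that, of "ereal (norm z)"] elim by simp
    have r: "fps_conv_radius (fps_const (mzv ks) * word_li [Y]) \<ge> 1"
      by (intro fps_conv_radius_mult_ge fps_conv_radius_word_li) simp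
    have "eval_fps (li (ks @ [1])) z = eval_fps (fps_const (mzv ks) * word_li [Y]) z - eval_fps D z"
      unfolding li_eq by (intro eval_fps_diff lt r rD)
    also have "eval_fps (fps_const (mzv ks) * word_li [Y]) z = mzv ks * log1m z"
      using elim by (subst eval_fps_mult_1) (simp_all add: fps_conv_radius_word_li eval_word_li_Y)
    finally show ?case
      by simp
  qed
  have "log_scale_1.const_term (\<lambda>z. mzv ks * log1m z + (-1) * eval_fps D z) =
      mzv ks * 0 + (-1) * suminf (hsum_defect ks)"
    using log_scale_1.has_asym_tendsto_const[OF negl]
    by (simp only: log_scale_1.const_term_add log_scale_1.has_asym_cmult log_scale_1.const_term_cmult
        log_scale_1.has_asym_T log_scale_1.const_term_T)
  then show ?thesis
    unfolding zeta_shuffle_eq[OF is_index_snoc_1[OF assms]] log_scale_1.has_asym_cong(2)[OF ev] by simp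
qed

text \<open>Agreement ends with a second trailing 1: at \<open>(1, 1)\<close> the harmonic value is
  \<open>- \<zeta>(2) / 2\<close> and the shuffle value is 0.\<close>

lemma zeta_reg_eq_zeta_shuffle:
  assumes "admissible ks \<or> (\<exists>ls. ks = ls @ [1] \<and> admissible ls)"
  shows "zeta_reg b ks = zeta_shuffle ks"
  using assms
proof (elim disjE exE conjE)
  assume "admissible ks"
  then show ?thesis
    using zeta_reg_admissible[of ks b] zeta_reg_admissible[of ks Shuffle] by simp
next
  fix ls
  assume "ks = ls @ [1]" "admissible ls"
  then show ?thesis
    using zeta_harmonic_snoc_1 zeta_shuffle_snoc_1 by (cases b) auto
qed

section \<open>Shifted indices\<close>

definition compositions :: "nat \<Rightarrow> nat \<Rightarrow> nat list set" where
  "compositions r m = {ls. length ls = r \<and> sum_list ls = m}"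

text \<open>The function \<open>F\<close> is kept arbitrary so that one recursion serves Taylor
  coefficients, truncated sums and zeta values.\<close>

definition shift_sum :: "(nat list \<Rightarrow> real) \<Rightarrow> nat \<Rightarrow> nat list \<Rightarrow> real" where
  "shift_sum F m ks = (\<Sum>ls\<in>compositions (length ks) m.
     F (map2 (+) ks ls) * (\<Prod>i<length ks. real ((ks ! i + ls ! i - 1) choose (ls ! i))))"

lemma zeta_shift_altdef: "zeta_shift b m ks = shift_sum (zeta_reg b) m ks"
  by (simp add: zeta_shift_def shift_sum_def compositions_def)

lemma compositions_0: "compositions 0 m = (if m = 0 then {[]} else {})"
  by (auto simp: compositions_def)

lemma compositions_Suc:
  "compositions (Suc r) m = (\<lambda>(l, ls). ls @ [l]) ` (SIGMA l:{..m}. compositions r (m - l))"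
proof (intro equalityI subsetI)
  fix ls
  assume ls: "ls \<in> compositions (Suc r) m"
  then have "ls \<noteq> []"
    by (auto simp: compositions_def)
  then obtain ls' l where eq: "ls = ls' @ [l]"
    by (metis append_butlast_last_id)
  with ls show "ls \<in> (\<lambda>(l, ls). ls @ [l]) ` (SIGMA l:{..m}. compositions r (m - l))"
    by (intro image_eqI[of _ _ "(l, ls')"]) (auto simp: compositions_def)
qed (auto simp: compositions_def)

lemma finite_compositions: "finite (compositions r m)"
  by (induction r arbitrary: m) (simp_all add: compositions_0 compositions_Suc)

lemma shift_sum_Nil [simp]: "shift_sum F m [] = (if m = 0 then F [] else 0)"
  by (simp add: shift_sum_def compositions_0)

lemma shift_sum_snoc:
  "shift_sum F m (ks @ [k]) =
     (\<Sum>l\<le>m. real ((k + l - 1) choose l) * shift_sum (\<lambda>ks. F (ks @ [k + l])) (m - l) ks)"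
proof -
  let ?t = "\<lambda>ls. F (map2 (+) (ks @ [k]) ls) *
      (\<Prod>i<length (ks @ [k]). real (((ks @ [k]) ! i + ls ! i - 1) choose (ls ! i)))"
  have inj: "inj_on (\<lambda>(l, ls). ls @ [l]) (SIGMA l:{..m}. compositions (length ks) (m - l))"
    by (auto simp: inj_on_def)
  have "shift_sum F m (ks @ [k]) = sum (?t \<circ> (\<lambda>(l, ls). ls @ [l])) (SIGMA l:{..m}. compositions (length ks) (m - l))"
    unfolding shift_sum_def length_append_singleton compositions_Suc sum.reindex[OF inj] ..
  also have "\<dots> = (\<Sum>l\<le>m. \<Sum>ls\<in>compositions (length ks) (m - l). ?t (ls @ [l]))"
    by (subst sum.Sigma) (auto simp: finite_compositions case_prod_unfold)
  also have "\<dots> = (\<Sum>l\<le>m. real ((k + l - 1) choose l) * shift_sum (\<lambda>ks. F (ks @ [k + l])) (m - l) ks)"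
    unfolding shift_sum_def sum_distrib_left
  proof (intro sum.cong refl)
    fix l ls
    assume "ls \<in> compositions (length ks) (m - l)"
    then have len: "length ls = length ks"
      by (simp add: compositions_def)
    then show "?t (ls @ [l]) = real ((k + l - 1) choose l) * (F (map2 (+) ks ls @ [k + l]) *
        (\<Prod>i<length ks. real ((ks ! i + ls ! i - 1) choose (ls ! i))))"
      by (simp add: nth_append)
  qed
  finally show ?thesis .
qed

lemma shift_sum_cong:
  assumes "\<And>ls. length ls = length ks \<Longrightarrow> sum_list ls = m \<Longrightarrow> F (map2 (+) ks ls) = G (map2 (+) ks ls)"
  shows "shift_sum F m ks = shift_sum G m ks"
  unfolding shift_sum_def using assms by (intro sum.cong refl) (simp add: compositions_def)

lemma shift_sum_sum: "shift_sum (\<lambda>ks. \<Sum>x\<in>A. F x ks) m ks = (\<Sum>x\<in>A. shift_sum (F x) m ks)"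
  unfolding shift_sum_def sum_distrib_right by (rule sum.swap)

lemma shift_sum_divide: "shift_sum (\<lambda>ks. F ks / c) m ks = shift_sum F m ks / c"
  unfolding shift_sum_def sum_divide_distrib by simp

lemma is_index_map2_add: "is_index ks \<Longrightarrow> length ls = length ks \<Longrightarrow> is_index (map2 (+) ks ls)"
  by (auto simp: is_index_def set_zip in_set_conv_nth)

text \<open>The coefficient of \<open>t^m\<close> in the polylogarithm with factors
  \<open>1/(n - t)^k\<close> in place of \<open>1/n^k\<close>, by the binomial series.\<close>

definition li_shift :: "nat \<Rightarrow> nat list \<Rightarrow> real fps" where
  "li_shift m ks = Abs_fps (\<lambda>n. shift_sum (\<lambda>ks. li_coeff ks n) m ks)"

lemma li_shift_Nil: "li_shift m [] = (if m = 0 then 1 else 0)"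
  by (rule fps_ext) (simp add: li_shift_def li_coeff_Nil)

lemma li_shift_snoc_nth:
  "fps_nth (li_shift m (ks @ [k])) n =
     (\<Sum>l\<le>m. real ((k + l - 1) choose l) * fps_nth (geo * li_shift (m - l) ks) n / real n ^ (k + l))"
  unfolding li_shift_def fps_nth_Abs_fps shift_sum_snoc li_coeff_snoc shift_sum_divide shift_sum_sum
    geo_mult_nth by simp

lemma li_shift_eq_sum: "li_shift m ks = (\<Sum>ls\<in>compositions (length ks) m.
    fps_const (\<Prod>i<length ks. real ((ks ! i + ls ! i - 1) choose (ls ! i))) * li (map2 (+) ks ls))"
  by (rule fps_ext) (simp add: li_shift_def shift_sum_def fps_sum_nth li_def mult.commute)

lemma fps_conv_radius_li_shift:
  assumes "is_index ks"
  shows "fps_conv_radius (li_shift m ks) \<ge> 1"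
  unfolding li_shift_eq_sum
  by (rule conjunct2[OF eval_fps_sum[of _ _ 0]])
    (auto intro!: fps_conv_radius_mult_ge fps_conv_radius_li is_index_map2_add assms simp: compositions_def)

lemma eval_li_shift:
  assumes "is_index ks" "\<bar>z\<bar> < 1"
  shows "eval_fps (li_shift m ks) z = (\<Sum>ls\<in>compositions (length ks) m.
    (\<Prod>i<length ks. real ((ks ! i + ls ! i - 1) choose (ls ! i))) * eval_fps (li (map2 (+) ks ls)) z)"
proof -
  have r: "fps_conv_radius (li (map2 (+) ks ls)) \<ge> 1" if "ls \<in> compositions (length ks) m" for ls
    using that by (intro fps_conv_radius_li is_index_map2_add assms) (simp add: compositions_def)
  have "eval_fps (li_shift m ks) z = (\<Sum>ls\<in>compositions (length ks) m.
      eval_fps (fps_const (\<Prod>i<length ks. real ((ks ! i + ls ! i - 1) choose (ls ! i))) * li (map2 (+) ks ls)) z)"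
    unfolding li_shift_eq_sum using assms(2)
    by (intro conjunct1[OF eval_fps_sum] fps_conv_radius_mult_ge r) simp_all
  also have "\<dots> = (\<Sum>ls\<in>compositions (length ks) m.
      (\<Prod>i<length ks. real ((ks ! i + ls ! i - 1) choose (ls ! i))) * eval_fps (li (map2 (+) ks ls)) z)"
    using assms(2) r by (intro sum.cong refl) (simp add: eval_fps_mult_1)
  finally show ?thesis .
qed

lemma
  assumes "is_index ks"
  shows has_asym_li_shift: "log_scale_1.has_asym (eval_fps (li_shift m ks))"
    and const_term_li_shift: "log_scale_1.const_term (eval_fps (li_shift m ks)) = shift_sum zeta_shuffle m ks"
proof -
  let ?c = "\<lambda>ls. \<Prod>i<length ks. real ((ks ! i + ls ! i - 1) choose (ls ! i))"
  let ?g = "\<lambda>ls z. ?c ls * eval_fps (li (map2 (+) ks ls)) z"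
  have ind: "is_index (map2 (+) ks ls)" if "ls \<in> compositions (length ks) m" for ls
    using that by (intro is_index_map2_add assms) (simp add: compositions_def)
  have ev: "eventually (\<lambda>z. eval_fps (li_shift m ks) z = (\<Sum>ls\<in>compositions (length ks) m. ?g ls z)) (at_left 1)"
    using eventually_at_left_1 by eventually_elim (intro eval_li_shift assms, simp)
  have asym: "log_scale_1.has_asym (?g ls)" if "ls \<in> compositions (length ks) m" for ls
    by (intro log_scale_1.has_asym_cmult has_asym_li ind that)
  show "log_scale_1.has_asym (eval_fps (li_shift m ks))"
    unfolding log_scale_1.has_asym_cong(1)[OF ev] by (rule log_scale_1.asym_sum(1)[OF asym])
  have "log_scale_1.const_term (eval_fps (li_shift m ks)) = (\<Sum>ls\<in>compositions (length ks) m. log_scale_1.const_term (?g ls))"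
    unfolding log_scale_1.has_asym_cong(2)[OF ev] by (rule log_scale_1.asym_sum(2)[OF asym])
  also have "\<dots> = shift_sum zeta_shuffle m ks"
    unfolding shift_sum_def
    by (intro sum.cong refl) (simp add: log_scale_1.const_term_cmult[OF has_asym_li[OF ind]] zeta_shuffle_eq[OF ind])
  finally show "log_scale_1.const_term (eval_fps (li_shift m ks)) = shift_sum zeta_shuffle m ks" .
qed

text \<open>Bivariate series \<open>\<Sum> f\<^sub>j(z) x\<^sup>j\<close>: the outer variable \<open>x\<close> marks the depth.\<close>

definition Theta :: "real fps fps \<Rightarrow> real fps fps" where
  "Theta F = Abs_fps (\<lambda>j. theta (fps_nth F j))"

lemma Theta_nth [simp]: "fps_nth (Theta F) j = theta (fps_nth F j)"
  by (simp add: Theta_def)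

lemma theta_diff: "theta (f - g) = theta f - theta g"
  by (simp add: theta_def algebra_simps)

lemma theta_minus: "theta (- f) = - theta f"
  by (simp add: theta_def)

lemma theta_const_mult: "theta (fps_const c * f) = fps_const c * theta f"
  by (rule fps_ext) simp

lemma Theta_add: "Theta (F + G) = Theta F + Theta G"
  and Theta_diff: "Theta (F - G) = Theta F - Theta G"
  and Theta_minus: "Theta (- F) = - Theta F"
  by (rule fps_ext, simp add: theta_add theta_diff theta_minus)+

lemma Theta_mult: "Theta (F * G) = Theta F * G + F * Theta G"
  by (rule fps_ext) (simp add: fps_mult_nth theta_sum theta_mult sum.distrib)

lemma Theta_1 [simp]: "Theta 1 = 0"
  by (rule fps_ext) (simp add: theta_def)

lemma Theta_numeral [simp]: "Theta (numeral w) = 0"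
proof -
  have "theta (numeral w) = 0"
    by (rule fps_ext) (simp add: numeral_fps_const)
  then have "fps_nth (Theta (numeral w)) j = 0" for j
    by (cases "j = 0") (simp_all add: fps_numeral_nth, simp add: theta_def)
  then show ?thesis
    by (intro fps_ext) simp
qed

definition at0 :: "real fps fps \<Rightarrow> real fps" where
  "at0 F = Abs_fps (\<lambda>j. fps_nth (fps_nth F j) 0)"

lemma at0_nth [simp]: "fps_nth (at0 F) j = fps_nth (fps_nth F j) 0"
  by (simp add: at0_def)

lemma at0_add: "at0 (F + G) = at0 F + at0 G"
  and at0_diff: "at0 (F - G) = at0 F - at0 G"
  and at0_minus: "at0 (- F) = - at0 F"
  by (rule fps_ext, simp)+

lemma at0_mult: "at0 (F * G) = at0 F * at0 G"
  by (rule fps_ext) (simp add: fps_mult_nth fps_sum_nth)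

lemma at0_Theta [simp]: "at0 (Theta F) = 0"
  by (rule fps_ext) simp

lemma at0_1 [simp]: "at0 1 = 1"
  by (rule fps_ext) simp

lemma Theta_eqD:
  assumes "Theta F = Theta G" "at0 F = at0 G"
  shows "F = G"
proof (rule fps_ext)
  fix j
  have "theta (fps_nth F j) = theta (fps_nth G j)"
    using assms(1) by (metis Theta_nth)
  moreover have "fps_nth (fps_nth F j) 0 = fps_nth (fps_nth G j) 0"
    using assms(2) by (metis at0_nth)
  ultimately show "fps_nth F j = fps_nth G j"
    by (rule theta_eqD)
qed

section \<open>Generating series of the alternating index\<close>

definition alt_index :: "nat \<Rightarrow> nat list" where
  "alt_index r = map (\<lambda>i. if even i then 1 else 3) [0..<r]"

lemma alt_index_0 [simp]: "alt_index 0 = []"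
  by (simp add: alt_index_def)

lemma alt_index_Suc: "alt_index (Suc r) = alt_index r @ [if even r then 1 else 3]"
  by (simp add: alt_index_def)

lemma length_alt_index [simp]: "length (alt_index r) = r"
  by (simp add: alt_index_def)

lemma is_index_alt_index: "is_index (alt_index r)"
  by (auto simp: is_index_def alt_index_def)

abbreviation li_alt :: "nat \<Rightarrow> nat \<Rightarrow> real fps" where
  "li_alt m r \<equiv> li_shift m (alt_index r)"

abbreviation li_two :: "nat \<Rightarrow> nat \<Rightarrow> real fps" where
  "li_two m j \<equiv> li_shift m (replicate j 2)"

lemma geo_nth_0 [simp]: "fps_nth geo 0 = 0"
  by (simp add: geo_def)

lemma li_shift_snoc_nth_0: "0 < k \<Longrightarrow> fps_nth (li_shift m (ks @ [k])) 0 = 0"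
  by (simp add: li_shift_snoc_nth geo_nth_0)

text \<open>These are the coefficients of \<open>(\<theta> - t)\<^sup>k f = z/(1-z) h\<close> modulo \<open>t\<^sup>3\<close> (modulo \<open>t\<^sup>2\<close> for
  \<open>k = 2\<close>), where \<open>f\<close> and \<open>h\<close> are the generating series in \<open>t\<close> of the shifted polylogarithms
  of \<open>(ks, k)\<close> and \<open>ks\<close>.\<close>

lemma theta_li_shift_snoc_1:
  shows "theta (li_shift 0 (ks @ [1])) = geo * li_shift 0 ks"
    and "theta (li_shift 1 (ks @ [1])) = geo * li_shift 1 ks + li_shift 0 (ks @ [1])"
    and "theta (li_shift 2 (ks @ [1])) = geo * li_shift 2 ks + li_shift 1 (ks @ [1])"
proof -
  note * = li_shift_snoc_nth geo_nth_0 atMost_Suc numeral_2_eq_2 power2_eq_square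
  show "theta (li_shift 0 (ks @ [1])) = geo * li_shift 0 ks"
  proof (rule fps_ext)
    show "fps_nth (theta (li_shift 0 (ks @ [1]))) n = fps_nth (geo * li_shift 0 ks) n" for n
      by (cases "n = 0") (simp_all add: *)
  qed
  show "theta (li_shift 1 (ks @ [1])) = geo * li_shift 1 ks + li_shift 0 (ks @ [1])"
  proof (rule fps_ext)
    show "fps_nth (theta (li_shift 1 (ks @ [1]))) n = fps_nth (geo * li_shift 1 ks + li_shift 0 (ks @ [1])) n" for n
      by (cases "n = 0") (simp_all add: * field_simps)
  qed
  show "theta (li_shift 2 (ks @ [1])) = geo * li_shift 2 ks + li_shift 1 (ks @ [1])"
  proof (rule fps_ext)
    show "fps_nth (theta (li_shift 2 (ks @ [1]))) n = fps_nth (geo * li_shift 2 ks + li_shift 1 (ks @ [1])) n" for n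
      by (cases "n = 0") (simp_all add: * field_simps)
  qed
qed

lemma theta_li_shift_snoc_2:
  shows "theta (theta (li_shift 0 (ks @ [2]))) = geo * li_shift 0 ks"
    and "theta (theta (li_shift 1 (ks @ [2]))) = geo * li_shift 1 ks + 2 * theta (li_shift 0 (ks @ [2]))"
proof -
  note * = li_shift_snoc_nth geo_nth_0 power2_eq_square power3_eq_cube
  show "theta (theta (li_shift 0 (ks @ [2]))) = geo * li_shift 0 ks"
  proof (rule fps_ext)
    show "fps_nth (theta (theta (li_shift 0 (ks @ [2])))) n = fps_nth (geo * li_shift 0 ks) n" for n
      by (cases "n = 0") (simp_all add: *)
  qed
  show "theta (theta (li_shift 1 (ks @ [2]))) = geo * li_shift 1 ks + 2 * theta (li_shift 0 (ks @ [2]))"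
  proof (rule fps_ext)
    show "fps_nth (theta (theta (li_shift 1 (ks @ [2])))) n =
        fps_nth (geo * li_shift 1 ks + 2 * theta (li_shift 0 (ks @ [2]))) n" for n
      by (cases "n = 0") (simp_all add: * field_simps)
  qed
qed

lemma theta_li_shift_snoc_3:
  shows "theta (theta (theta (li_shift 0 (ks @ [3])))) = geo * li_shift 0 ks"
    and "theta (theta (theta (li_shift 1 (ks @ [3])))) =
      geo * li_shift 1 ks + 3 * theta (theta (li_shift 0 (ks @ [3])))"
    and "theta (theta (theta (li_shift 2 (ks @ [3])))) =
      geo * li_shift 2 ks + 3 * theta (theta (li_shift 1 (ks @ [3]))) - 3 * theta (li_shift 0 (ks @ [3]))"
proof -
  have c: "(5 choose 2) = (10 :: nat)" "(4 choose 2) = (6 :: nat)"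
    by (simp_all add: choose_two)
  have two: "{..2} = {0, 1, 2::nat}" "{..Suc 0} = {0, Suc 0}"
    by auto
  show "theta (theta (theta (li_shift 0 (ks @ [3])))) = geo * li_shift 0 ks"
  proof (rule fps_ext)
    show "fps_nth (theta (theta (theta (li_shift 0 (ks @ [3]))))) n = fps_nth (geo * li_shift 0 ks) n" for n
      by (cases "n = 0") (simp_all add: li_shift_snoc_nth geo_nth_0 power3_eq_cube)
  qed
  show "theta (theta (theta (li_shift 1 (ks @ [3])))) =
      geo * li_shift 1 ks + 3 * theta (theta (li_shift 0 (ks @ [3])))"
  proof (rule fps_ext)
    show "fps_nth (theta (theta (theta (li_shift 1 (ks @ [3]))))) n =
      fps_nth (geo * li_shift 1 ks + 3 * theta (theta (li_shift 0 (ks @ [3])))) n" for n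
      by (cases "n = 0") (simp_all add: li_shift_snoc_nth geo_nth_0 field_simps eval_nat_numeral)
  qed
  show "theta (theta (theta (li_shift 2 (ks @ [3])))) =
      geo * li_shift 2 ks + 3 * theta (theta (li_shift 1 (ks @ [3]))) - 3 * theta (li_shift 0 (ks @ [3]))"
  proof (rule fps_ext)
    fix n
    let ?s = "\<lambda>m. fps_nth (geo * li_shift m ks) n"
    show "fps_nth (theta (theta (theta (li_shift 2 (ks @ [3]))))) n =
      fps_nth (geo * li_shift 2 ks + 3 * theta (theta (li_shift 1 (ks @ [3]))) - 3 * theta (li_shift 0 (ks @ [3]))) n"
    proof (cases "n = 0")
      case False
      \<comment> \<open>The factors 1, 3, 6 are the coefficients of the expansion of
        \<open>(n - t)^(-3)\<close>.\<close>
      have eqs: "fps_nth (li_shift 0 (ks @ [3])) n = ?s 0 / real n ^ 3"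
        "fps_nth (li_shift 1 (ks @ [3])) n = ?s 1 / real n ^ 3 + 3 * ?s 0 / real n ^ 4"
        "fps_nth (li_shift 2 (ks @ [3])) n = ?s 2 / real n ^ 3 + 3 * ?s 1 / real n ^ 4 + 6 * ?s 0 / real n ^ 5"
        by (simp_all add: li_shift_snoc_nth two c)
      show ?thesis
        unfolding fps_sub_nth fps_add_nth theta_nth fps_mult_numeral_left eqs
        using False by (simp add: field_simps eval_nat_numeral)
    qed (simp add: geo_nth_0)
  qed
qed

text \<open>\<open>P + s Q\<close> is the Frobenius solution of exponent \<open>s\<close> of \<open>(1 - z) \<theta>\<^sup>2 y = - x z y\<close> modulo
  \<open>s\<^sup>2\<close>, divided by \<open>z\<^sup>s\<close>; the suffix \<open>t\<close> stands for \<open>x\<close> replaced by \<open>-x\<close>.\<close>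

definition P_ser :: "real fps fps" where "P_ser = Abs_fps (\<lambda>j. (-1) ^ j * li_two 0 j)"
definition Q_ser :: "real fps fps" where "Q_ser = Abs_fps (\<lambda>j. - ((-1) ^ j * li_two 1 j))"
definition Pt_ser :: "real fps fps" where "Pt_ser = Abs_fps (\<lambda>j. li_two 0 j)"
definition Qt_ser :: "real fps fps" where "Qt_ser = Abs_fps (\<lambda>j. - li_two 1 j)"

definition G_ser :: "real fps fps" where "G_ser = fps_const geo"

lemma replicate_Suc_snoc: "replicate (Suc n) x = replicate n x @ [x]"
  by (simp add: replicate_append_same)

lemma theta_neg1_power_mult: "theta ((-1) ^ j * f) = (-1) ^ j * theta f"
  by (cases "even j") (simp_all add: theta_minus)

lemma Theta_PQ:
  shows "Theta (Theta P_ser) = - (fps_X * (G_ser * P_ser))"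
    and "Theta (Theta Q_ser) = - (fps_X * (G_ser * Q_ser)) - 2 * Theta P_ser"
    and "Theta (Theta Pt_ser) = fps_X * (G_ser * Pt_ser)"
    and "Theta (Theta Qt_ser) = fps_X * (G_ser * Qt_ser) - 2 * Theta Pt_ser"
proof -
  have t1: "theta 1 = 0" "theta 0 = 0"
    by (simp_all add: theta_def)
  have n0: "fps_nth (2 * F) j = 2 * fps_nth F j" for F :: "real fps fps" and j
    by simp
  have *: "li_two m (Suc j) = li_shift m (replicate j 2 @ [2])" for m j
    by (simp only: replicate_Suc_snoc)
  show "Theta (Theta P_ser) = - (fps_X * (G_ser * P_ser))"
  proof (rule fps_ext)
    show "fps_nth (Theta (Theta P_ser)) j = fps_nth (- (fps_X * (G_ser * P_ser))) j" for j
      by (cases j) (simp_all add: P_ser_def G_ser_def li_shift_Nil t1 * theta_neg1_power_mult theta_minus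
          theta_li_shift_snoc_2 algebra_simps del: replicate_Suc)
  qed
  show "Theta (Theta Pt_ser) = fps_X * (G_ser * Pt_ser)"
  proof (rule fps_ext)
    show "fps_nth (Theta (Theta Pt_ser)) j = fps_nth (fps_X * (G_ser * Pt_ser)) j" for j
      by (cases j) (simp_all add: Pt_ser_def G_ser_def li_shift_Nil t1 *
          theta_li_shift_snoc_2 algebra_simps del: replicate_Suc)
  qed
  show "Theta (Theta Q_ser) = - (fps_X * (G_ser * Q_ser)) - 2 * Theta P_ser"
  proof (rule fps_ext)
    show "fps_nth (Theta (Theta Q_ser)) j = fps_nth (- (fps_X * (G_ser * Q_ser)) - 2 * Theta P_ser) j" for j
      by (cases j) (simp_all add: P_ser_def Q_ser_def G_ser_def li_shift_Nil t1 * theta_neg1_power_mult theta_minus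
          theta_li_shift_snoc_2 theta_li_shift_snoc_2(2)[unfolded One_nat_def] algebra_simps del: replicate_Suc)
  qed
  show "Theta (Theta Qt_ser) = fps_X * (G_ser * Qt_ser) - 2 * Theta Pt_ser"
  proof (rule fps_ext)
    show "fps_nth (Theta (Theta Qt_ser)) j = fps_nth (fps_X * (G_ser * Qt_ser) - 2 * Theta Pt_ser) j" for j
      by (cases j) (simp_all add: Pt_ser_def Qt_ser_def G_ser_def li_shift_Nil t1 * theta_minus
          theta_li_shift_snoc_2 theta_li_shift_snoc_2(2)[unfolded One_nat_def] algebra_simps del: replicate_Suc)
  qed
qed

lemma at0_PQ [simp]: "at0 P_ser = 1" "at0 Q_ser = 0" "at0 Pt_ser = 1" "at0 Qt_ser = 0"
proof -
  have *: "fps_nth (li_two m j) 0 = (if m = 0 \<and> j = 0 then 1 else 0)" for m j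
    by (cases j) (simp_all add: li_shift_Nil replicate_Suc_snoc li_shift_snoc_nth_0 del: replicate_Suc)
  have s: "fps_nth ((-1) ^ j * f) 0 = (-1) ^ j * fps_nth f 0" for j and f :: "real fps"
    by (cases "even j") simp_all
  show "at0 P_ser = 1" "at0 Q_ser = 0" "at0 Pt_ser = 1" "at0 Qt_ser = 0"
    by (rule fps_ext, simp add: P_ser_def Q_ser_def Pt_ser_def Qt_ser_def * s)+
qed

text \<open>This is the Wronskian of \<open>P\<close> and \<open>P log z + Q\<close> with respect to
  \<open>\<theta>\<close>. It is constant because the equation has no first-order term, and its
  value at \<open>z = 0\<close> is 1.\<close>

lemma wronskian:
  shows "P_ser * Theta Q_ser - Q_ser * Theta P_ser + P_ser * P_ser = 1"
    and "Pt_ser * Theta Qt_ser - Qt_ser * Theta Pt_ser + Pt_ser * Pt_ser = 1"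
  by (rule Theta_eqD; simp add: Theta_add Theta_diff Theta_mult Theta_PQ at0_add at0_diff at0_mult;
      simp add: algebra_simps)+

text \<open>To avoid denominators, \<open>E1\<close>, \<open>E2\<close>, \<open>G1\<close> and \<open>G2\<close> are twice the coefficients of \<open>t\<close> and
  \<open>t\<^sup>2\<close>.\<close>

definition "E0 = P_ser * Pt_ser"
definition "E1 = - (P_ser * Qt_ser + Q_ser * Pt_ser)"
definition "E2 = Q_ser * Qt_ser"
definition "G0 = Theta P_ser * Pt_ser - P_ser * Theta Pt_ser"
definition "G1 = - (Theta P_ser * Qt_ser - P_ser * Theta Qt_ser + Theta Q_ser * Pt_ser - Q_ser * Theta Pt_ser)"
definition "G2 = (P_ser + Theta Q_ser) * Qt_ser - Q_ser * (Pt_ser + Theta Qt_ser)"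

lemmas Theta_simps = Theta_add Theta_diff Theta_minus Theta_mult

text \<open>Each \<open>G\<close> is the part free of logarithms in
  \<open>(\<theta> y) w - y (\<theta> w)\<close> for the solutions \<open>y\<close> and
  \<open>w\<close> whose product gives the corresponding \<open>E\<close>. Multiplication by
  \<open>z^t\<close> removes the logarithms and produces the additional terms \<open>2 * G0\<close>
  and \<open>G1\<close>.\<close>

lemma Theta_G:
  shows "Theta G0 = - (2 * (fps_X * (G_ser * E0)))"
    and "Theta G1 = - (2 * (fps_X * (G_ser * E1))) + 2 * G0"
    and "Theta G2 = - (2 * (fps_X * (G_ser * E2))) + G1"
  by (simp_all add: E0_def E1_def E2_def G0_def G1_def G2_def Theta_simps Theta_PQ) (simp_all add: algebra_simps)

text \<open>The terms with a twice differentiated factor lose their multiples of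
  \<open>x z/(1-z)\<close>, which have opposite signs in the two equations. This cancellation is the
  reason for pairing \<open>x\<close> with \<open>-x\<close>.\<close>

lemma Theta2_E:
  shows "Theta (Theta E0) = 2 * (Theta P_ser * Theta Pt_ser)"
    and "Theta (Theta E1) = 2 * Theta E0 - 2 * (Theta P_ser * Theta Qt_ser + Theta Q_ser * Theta Pt_ser)"
    and "Theta (Theta E2) = 2 * (Theta Q_ser * Theta Qt_ser) - 2 * (Theta P_ser * Qt_ser + Q_ser * Theta Pt_ser)"
  by (simp_all add: E0_def E1_def E2_def Theta_simps Theta_PQ) (simp_all add: algebra_simps)

lemma Theta3_E:
  shows "Theta (Theta (Theta E0)) = 2 * (fps_X * (G_ser * G0))"
    and "Theta (Theta (Theta E1)) = 2 * (fps_X * (G_ser * G1)) + 6 * Theta (Theta E0)"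
    and "Theta (Theta (Theta E2)) = 2 * (fps_X * (G_ser * G2)) + 3 * Theta (Theta E1) - 6 * Theta E0"
  unfolding Theta2_E
  by (simp_all add: Theta_simps Theta_PQ Theta2_E)
    (simp_all add: E0_def G0_def G1_def G2_def Theta_simps Theta_PQ algebra_simps)

text \<open>Completing both differences to Wronskians subtracts the product of the two squares twice
  with opposite signs, so it cancels and only the difference of the squares remains.\<close>

lemma W1: "G0 * E1 - E0 * G1 = Pt_ser * Pt_ser - P_ser * P_ser"
proof -
  have "G0 * E1 - E0 * G1 =
      Pt_ser * Pt_ser * ((P_ser * Theta Q_ser - Q_ser * Theta P_ser + P_ser * P_ser) - P_ser * P_ser)
      - P_ser * P_ser * ((Pt_ser * Theta Qt_ser - Qt_ser * Theta Pt_ser + Pt_ser * Pt_ser) - Pt_ser * Pt_ser)"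
    by (simp add: E0_def E1_def G0_def G1_def algebra_simps)
  then show ?thesis
    unfolding wronskian by (simp add: algebra_simps)
qed

lemma W2: "G0 * E2 - E0 * G2 = P_ser * Q_ser - Pt_ser * Qt_ser"
proof -
  have "G0 * E2 - E0 * G2 =
      P_ser * Q_ser * (Pt_ser * Theta Qt_ser - Qt_ser * Theta Pt_ser + Pt_ser * Pt_ser)
      - Pt_ser * Qt_ser * (P_ser * Theta Q_ser - Q_ser * Theta P_ser + P_ser * P_ser)"
    by (simp add: E0_def E2_def G0_def G2_def algebra_simps)
  then show ?thesis
    unfolding wronskian by simp
qed

lemma at0_EG [simp]: "at0 E0 = 1" "at0 E1 = 0" "at0 E2 = 0" "at0 G0 = 0" "at0 G1 = 0" "at0 G2 = 0"
  by (simp_all add: E0_def E1_def E2_def G0_def G1_def G2_def at0_mult at0_add at0_diff at0_minus)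

text \<open>\<open>kap r x\<^sup>r\<close> is the weight of depth \<open>r\<close>: the system relates \<open>u\<^sup>2\<close> to \<open>-4 x\<^sup>2\<close>, where \<open>u\<close>
  marks the depth, and the odd part is rescaled to stay real.\<close>

definition kap :: "nat \<Rightarrow> real" where
  "kap r = (-4) ^ (r div 2) * (if even r then 1 else -2)"

lemma kap_Suc: "kap (Suc r) = (if even r then -2 else 2) * kap r"
  by (auto simp: kap_def)

lemma fps_const_kap_Suc: "fps_const (kap (Suc r)) = (if even r then - 2 else 2) * fps_const (kap r)"
  by (simp add: kap_Suc numeral_fps_const flip: fps_const_mult)

text \<open>For odd \<open>r\<close> exactly one of \<open>i\<close> and \<open>r - i\<close> is
  odd: halving produces no carry, and the factor -2 occurs once on each side.\<close>

lemma kap_mult: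
  assumes "odd r" "i \<le> r"
  shows "kap i * kap (r - i) = kap r"
proof -
  obtain j where r: "r = i + j"
    using le_Suc_ex[OF assms(2)] by blast
  have parity: "odd i = even j"
    using assms(1) unfolding r by simp
  have "(i + j) div 2 = i div 2 + j div 2"
    using parity by (cases "even i") (auto elim!: evenE oddE)
  then have "kap (i + j) = kap i * kap j"
    using parity by (cases "even i") (simp_all add: kap_def power_add)
  then show ?thesis
    by (simp add: r)
qed

section \<open>Identification of the alternating polylogarithms with the product solutions\<close>

definition KA :: "nat \<Rightarrow> nat \<Rightarrow> real fps" where
  "KA m r = fps_const (kap r) * li_alt m r"

text \<open>Prefixes of even length, nonempty ones ending in 3; the zeros at odd depth allow
  comparison with the coefficients of a series in all powers of \<open>x\<close>.\<close>

definition eT :: "nat \<Rightarrow> nat \<Rightarrow> real fps" where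
  "eT m r = (if even r then KA m r else 0)"

definition gT :: "nat \<Rightarrow> nat \<Rightarrow> real fps" where
  "gT m r = (if odd r then KA m r else 0)"

lemma theta_0 [simp]: "theta 0 = 0" and theta_1 [simp]: "theta 1 = 0"
  by (simp_all add: theta_def)

lemma theta_numeral_mult: "theta (numeral w * f) = numeral w * theta f"
  by (rule fps_ext) simp

lemma theta_gT:
  shows "theta (gT 0 (Suc r)) = - (2 * (geo * eT 0 r))"
    and "theta (gT 1 (Suc r)) = - (2 * (geo * eT 1 r)) + gT 0 (Suc r)"
    and "theta (gT 2 (Suc r)) = - (2 * (geo * eT 2 r)) + gT 1 (Suc r)"
  unfolding gT_def eT_def KA_def
  by (simp_all add: alt_index_Suc theta_li_shift_snoc_1 theta_li_shift_snoc_1[unfolded One_nat_def]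
      theta_const_mult fps_const_kap_Suc theta_numeral_mult theta_minus mult.assoc)
    (simp_all add: algebra_simps)

lemma theta_eT:
  shows "theta (theta (theta (eT 0 (Suc r)))) = 2 * (geo * gT 0 r)"
    and "theta (theta (theta (eT 1 (Suc r)))) = 2 * (geo * gT 1 r) + 3 * theta (theta (eT 0 (Suc r)))"
    and "theta (theta (theta (eT 2 (Suc r)))) =
      2 * (geo * gT 2 r) + 3 * theta (theta (eT 1 (Suc r))) - 3 * theta (eT 0 (Suc r))"
  unfolding gT_def eT_def KA_def
  by (simp_all add: alt_index_Suc theta_li_shift_snoc_3 theta_li_shift_snoc_3[unfolded One_nat_def]
      theta_const_mult fps_const_kap_Suc theta_numeral_mult theta_minus mult.assoc)
    (simp_all add: algebra_simps)

text \<open>An image under \<open>theta\<close> has no constant coefficient, so a single initial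
  value determines the solution of the third-order equation among power series.\<close>

lemma theta3_eqD:
  assumes "theta (theta (theta f)) = theta (theta (theta g))" "fps_nth f 0 = fps_nth g 0"
  shows "f = g"
proof -
  have "theta (theta f) = theta (theta g)"
    by (rule theta_eqD[OF assms(1)]) simp
  then have "theta f = theta g"
    by (rule theta_eqD) simp
  then show ?thesis
    using assms(2) by (rule theta_eqD)
qed

lemma eT_gT_nth_0: "fps_nth (eT m (Suc r)) 0 = 0" "fps_nth (gT m (Suc r)) 0 = 0"
  by (simp_all add: eT_def gT_def KA_def alt_index_Suc li_shift_snoc_nth_0)

lemma EG_recurrence:
  shows "theta (fps_nth G0 (Suc r)) = - (2 * (geo * fps_nth E0 r))"
    and "theta (fps_nth G1 (Suc r)) = - (2 * (geo * fps_nth E1 r)) + 2 * fps_nth G0 (Suc r)"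
    and "theta (fps_nth G2 (Suc r)) = - (2 * (geo * fps_nth E2 r)) + fps_nth G1 (Suc r)"
    and "theta (theta (theta (fps_nth E0 (Suc r)))) = 2 * (geo * fps_nth G0 r)"
    and "theta (theta (theta (fps_nth E1 (Suc r)))) =
      2 * (geo * fps_nth G1 r) + 6 * theta (theta (fps_nth E0 (Suc r)))"
    and "theta (theta (theta (fps_nth E2 (Suc r)))) =
      2 * (geo * fps_nth G2 r) + 3 * theta (theta (fps_nth E1 (Suc r))) - 6 * theta (fps_nth E0 (Suc r))"
  using Theta_G[THEN arg_cong, of "\<lambda>F. fps_nth F (Suc r)"] Theta3_E[THEN arg_cong, of "\<lambda>F. fps_nth F (Suc r)"]
  unfolding Theta_nth fps_add_nth fps_sub_nth fps_neg_nth fps_mult_numeral_left fps_X_mult_nth G_ser_def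
    fps_mult_left_const_nth by simp_all

text \<open>Both sides obey the same recurrences in the depth and vanish at \<open>z = 0\<close> in
  positive depth. In depth 0 only \<open>E0\<close> survives, with value 1, which is the empty
  index.\<close>

lemma EG_nth:
  "fps_nth E0 r = eT 0 r \<and> fps_nth E1 r = 2 * eT 1 r \<and> fps_nth E2 r = 2 * eT 2 r \<and>
   fps_nth G0 r = gT 0 r \<and> fps_nth G1 r = 2 * gT 1 r \<and> fps_nth G2 r = 2 * gT 2 r"
proof (induction r)
  case 0
  show ?case
    by (simp add: E0_def E1_def E2_def G0_def G1_def G2_def eT_def gT_def KA_def kap_def li_shift_Nil
        P_ser_def Q_ser_def Pt_ser_def Qt_ser_def)
next
  case (Suc r)
  then have IH: "fps_nth E0 r = eT 0 r" "fps_nth E1 r = 2 * eT 1 r" "fps_nth E2 r = 2 * eT 2 r"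
    "fps_nth G0 r = gT 0 r" "fps_nth G1 r = 2 * gT 1 r" "fps_nth G2 r = 2 * gT 2 r"
    by blast+
  have E_at0: "fps_nth (fps_nth E0 (Suc r)) 0 = 0" "fps_nth (fps_nth E1 (Suc r)) 0 = 0"
    "fps_nth (fps_nth E2 (Suc r)) 0 = 0"
    unfolding at0_nth[symmetric] at0_EG by simp_all
  have G_at0: "fps_nth (fps_nth G0 (Suc r)) 0 = 0" "fps_nth (fps_nth G1 (Suc r)) 0 = 0"
    "fps_nth (fps_nth G2 (Suc r)) 0 = 0"
    unfolding at0_nth[symmetric] at0_EG by simp_all
  have two0: "fps_nth (2 * f) 0 = 0" if "fps_nth f 0 = 0" for f :: "real fps"
    using that by simp
  have "theta (fps_nth G0 (Suc r)) = theta (gT 0 (Suc r))"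
    unfolding EG_recurrence IH theta_gT ..
  from theta_eqD[OF this] have G0: "fps_nth G0 (Suc r) = gT 0 (Suc r)"
    by (simp add: G_at0 eT_gT_nth_0)
  have "theta (fps_nth G1 (Suc r)) = theta (2 * gT 1 (Suc r))"
    unfolding EG_recurrence IH G0 theta_numeral_mult theta_gT by (simp add: algebra_simps)
  from theta_eqD[OF this] have G1: "fps_nth G1 (Suc r) = 2 * gT 1 (Suc r)"
    by (simp only: G_at0 eT_gT_nth_0 two0 simp_thms)
  have "theta (fps_nth G2 (Suc r)) = theta (2 * gT 2 (Suc r))"
    unfolding EG_recurrence(3) IH G1 theta_numeral_mult theta_gT(3) by (simp add: algebra_simps)
  from theta_eqD[OF this] have G2: "fps_nth G2 (Suc r) = 2 * gT 2 (Suc r)"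
    by (simp only: G_at0 eT_gT_nth_0 two0 simp_thms)
  have "theta (theta (theta (fps_nth E0 (Suc r)))) = theta (theta (theta (eT 0 (Suc r))))"
    unfolding EG_recurrence IH theta_eT ..
  from theta3_eqD[OF this] have E0: "fps_nth E0 (Suc r) = eT 0 (Suc r)"
    by (simp only: E_at0 eT_gT_nth_0 simp_thms)
  have "theta (theta (theta (fps_nth E1 (Suc r)))) = theta (theta (theta (2 * eT 1 (Suc r))))"
    unfolding EG_recurrence(5) IH E0 theta_numeral_mult theta_eT(2) by simp
  from theta3_eqD[OF this] have E1: "fps_nth E1 (Suc r) = 2 * eT 1 (Suc r)"
    by (simp only: E_at0 eT_gT_nth_0 two0 simp_thms)
  have "theta (theta (theta (fps_nth E2 (Suc r)))) = theta (theta (theta (2 * eT 2 (Suc r))))"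
    unfolding EG_recurrence(6) IH E0 E1 theta_numeral_mult theta_eT(3) by simp
  from theta3_eqD[OF this] have E2: "fps_nth E2 (Suc r) = 2 * eT 2 (Suc r)"
    by (simp only: E_at0 eT_gT_nth_0 two0 simp_thms)
  show ?case
    using E0 E1 E2 G0 G1 G2 by blast
qed

text \<open>For odd \<open>r\<close> just one of the two products is nonzero at each
  \<open>i\<close>: the first for odd \<open>i\<close>, the second for even \<open>i\<close>. The
  minus sign between them thus becomes the alternating sign.\<close>

lemma wronskian_nth:
  assumes "odd r"
  shows "fps_nth (G0 * E1 - E0 * G1) r =
      (\<Sum>i\<le>r. fps_const (2 * kap r * (-1) ^ (r - i)) * (li_alt 0 i * li_alt 1 (r - i)))"
    and "fps_nth (G0 * E2 - E0 * G2) r =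
      (\<Sum>i\<le>r. fps_const (2 * kap r * (-1) ^ (r - i)) * (li_alt 0 i * li_alt 2 (r - i)))"
proof -
  have *: "gT 0 i * (2 * eT m (r - i)) - eT 0 i * (2 * gT m (r - i)) =
      fps_const (2 * kap r * (-1) ^ (r - i)) * (li_alt 0 i * li_alt m (r - i))" if "i \<le> r" for i m
  proof -
    have "gT 0 i * (2 * eT m (r - i)) - eT 0 i * (2 * gT m (r - i)) = 2 * ((-1) ^ (r - i) * (KA 0 i * KA m (r - i)))"
      using assms that by (cases "even i") (simp_all add: gT_def eT_def)
    also have "\<dots> = 2 * ((-1) ^ (r - i) * (fps_const (kap i * kap (r - i)) * (li_alt 0 i * li_alt m (r - i))))"
      by (simp add: KA_def mult_ac flip: fps_const_mult)
    also have "\<dots> = fps_const (2 * kap r * (-1) ^ (r - i)) * (li_alt 0 i * li_alt m (r - i))"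
      unfolding kap_mult[OF assms that]
      by (cases "even (r - i)") (simp_all add: numeral_fps_const flip: fps_const_mult mult.assoc)
    finally show ?thesis .
  qed
  have "fps_nth G0 i * fps_nth E1 (r - i) - fps_nth E0 i * fps_nth G1 (r - i) =
      fps_const (2 * kap r * (-1) ^ (r - i)) * (li_alt 0 i * li_alt 1 (r - i))"
    "fps_nth G0 i * fps_nth E2 (r - i) - fps_nth E0 i * fps_nth G2 (r - i) =
      fps_const (2 * kap r * (-1) ^ (r - i)) * (li_alt 0 i * li_alt 2 (r - i))" if "i \<le> r" for i
    using *[OF that] by (simp_all only: EG_nth)
  then show "fps_nth (G0 * E1 - E0 * G1) r =
      (\<Sum>i\<le>r. fps_const (2 * kap r * (-1) ^ (r - i)) * (li_alt 0 i * li_alt 1 (r - i)))"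
    "fps_nth (G0 * E2 - E0 * G2) r =
      (\<Sum>i\<le>r. fps_const (2 * kap r * (-1) ^ (r - i)) * (li_alt 0 i * li_alt 2 (r - i)))"
    unfolding fps_sub_nth fps_mult_nth sum_subtractf[symmetric] atLeast0AtMost
    by (intro sum.cong refl; simp only: atMost_iff)+
qed

text \<open>\<open>P_ser\<close> and \<open>Q_ser\<close> arise from \<open>Pt_ser\<close> and
  \<open>Qt_ser\<close> by replacing \<open>x\<close> with \<open>-x\<close>, so in odd degree the
  two products are opposite and their difference doubles.\<close>

lemma PQ_nth:
  assumes "odd r"
  shows "fps_nth (Pt_ser * Pt_ser - P_ser * P_ser) r = (\<Sum>i\<le>r. 2 * (li_two 0 i * li_two 0 (r - i)))"
    and "fps_nth (P_ser * Q_ser - Pt_ser * Qt_ser) r = (\<Sum>i\<le>r. 2 * (li_two 0 i * li_two 1 (r - i)))"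
proof -
  have *: "(-1) ^ i * a * ((-1) ^ (r - i) * b) = - (a * b)" if "i \<le> r" for i and a b :: "real fps"
  proof -
    have "(-1) ^ i * (-1) ^ (r - i) = (-1 :: real fps)"
      using assms that by (simp flip: power_add)
    then show ?thesis
      by (metis mult.assoc mult.left_commute mult_minus1)
  qed
  show "fps_nth (Pt_ser * Pt_ser - P_ser * P_ser) r = (\<Sum>i\<le>r. 2 * (li_two 0 i * li_two 0 (r - i)))"
    "fps_nth (P_ser * Q_ser - Pt_ser * Qt_ser) r = (\<Sum>i\<le>r. 2 * (li_two 0 i * li_two 1 (r - i)))"
    unfolding fps_sub_nth fps_mult_nth sum_subtractf[symmetric] atLeast0AtMost
      P_ser_def Q_ser_def Pt_ser_def Qt_ser_def fps_nth_Abs_fps mult_minus_right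
    by (intro sum.cong refl, simp add: *)+
qed

section \<open>Constant terms of power series\<close>

definition good :: "real fps \<Rightarrow> bool" where
  "good f \<longleftrightarrow> fps_conv_radius f \<ge> 1 \<and> log_scale_1.has_asym (eval_fps f)"

definition CT :: "real fps \<Rightarrow> real" where
  "CT f = log_scale_1.const_term (eval_fps f)"

lemma good_const [simp]: "good (fps_const c)" and CT_const [simp]: "CT (fps_const c) = c"
  by (simp_all add: good_def CT_def eval_fps_const[abs_def])

lemma
  assumes "good f" "good g"
  shows good_mult: "good (f * g)" and CT_mult: "CT (f * g) = CT f * CT g"
proof -
  have ev: "eventually (\<lambda>z. eval_fps (f * g) z = eval_fps f z * eval_fps g z) (at_left 1)"
    using eventually_at_left_1 by eventually_elim (use assms in \<open>auto simp: good_def intro!: eval_fps_mult_1\<close>)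
  show "good (f * g)" "CT (f * g) = CT f * CT g"
    using assms unfolding good_def CT_def log_scale_1.has_asym_cong[OF ev]
    by (auto simp: log_scale_1.has_asym_mult log_scale_1.const_term_mult fps_conv_radius_mult_ge)
qed

lemma CT_sum:
  assumes "\<And>x. x \<in> A \<Longrightarrow> good (f x)"
  shows "CT (\<Sum>x\<in>A. f x) = (\<Sum>x\<in>A. CT (f x))"
proof -
  have ev: "eventually (\<lambda>z. eval_fps (\<Sum>x\<in>A. f x) z = (\<Sum>x\<in>A. eval_fps (f x) z)) (at_left 1)"
    using eventually_at_left_1
    by eventually_elim (use assms in \<open>auto simp: good_def intro!: conjunct1[OF eval_fps_sum]\<close>)
  show ?thesis
    unfolding CT_def log_scale_1.has_asym_cong(2)[OF ev]
    by (rule log_scale_1.asym_sum(2)) (use assms in \<open>auto simp: good_def\<close>)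
qed

lemma good_li_shift: "is_index ks \<Longrightarrow> good (li_shift m ks)"
  by (simp add: good_def fps_conv_radius_li_shift has_asym_li_shift)

lemma is_index_replicate_2: "is_index (replicate j 2)"
  by (auto simp: is_index_def)

text \<open>For odd \<open>r\<close> this turns out to be the coefficient of \<open>t^m\<close> in
  the symmetric multiple zeta value of the alternating index of length \<open>r\<close>.\<close>

definition wronski_coeff :: "nat \<Rightarrow> nat \<Rightarrow> real" where
  "wronski_coeff m r = (\<Sum>i\<le>r. (-1) ^ (r - i) * (CT (li_alt 0 i) * CT (li_alt m (r - i))))"

lemma wronski_coeff_eq:
  assumes "odd r"
  shows "kap r * wronski_coeff 1 r = (\<Sum>i\<le>r. CT (li_two 0 i) * CT (li_two 0 (r - i)))"
    and "kap r * wronski_coeff 2 r = (\<Sum>i\<le>r. CT (li_two 0 i) * CT (li_two 1 (r - i)))"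
proof -
  have good: "good (li_alt m i)" "good (li_two m i)" for m i
    by (simp_all add: good_li_shift is_index_alt_index is_index_replicate_2)
  have l: "CT (\<Sum>i\<le>r. fps_const (2 * kap r * (-1) ^ (r - i)) * (li_alt 0 i * li_alt m (r - i)))
      = 2 * (kap r * wronski_coeff m r)" for m
    by (simp add: CT_sum CT_mult good_mult good wronski_coeff_def sum_distrib_left mult_ac)
  have rr: "CT (\<Sum>i\<le>r. 2 * (li_two 0 i * li_two m (r - i))) = 2 * (\<Sum>i\<le>r. CT (li_two 0 i) * CT (li_two m (r - i)))" for m
    unfolding numeral_fps_const by (simp add: CT_sum CT_mult good_mult good sum_distrib_left)
  show "kap r * wronski_coeff 1 r = (\<Sum>i\<le>r. CT (li_two 0 i) * CT (li_two 0 (r - i)))"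
    using l[of 1] rr[of 0] W1 wronskian_nth(1)[OF assms] PQ_nth(1)[OF assms] by simp
  show "kap r * wronski_coeff 2 r = (\<Sum>i\<le>r. CT (li_two 0 i) * CT (li_two 1 (r - i)))"
    using l[of 2] rr[of 1] W2 wronskian_nth(2)[OF assms] PQ_nth(2)[OF assms] by simp
qed

section \<open>Evaluations at repeated twos\<close>

lemma shift_sum_add: "shift_sum (\<lambda>ks. F ks + G ks) m ks = shift_sum F m ks + shift_sum G m ks"
  by (simp add: shift_sum_def distrib_right sum.distrib)

lemma shift_sum_zero_fun [simp]: "shift_sum (\<lambda>ks. 0) m ks = 0"
  by (simp add: shift_sum_def)

definition two_sum :: "nat \<Rightarrow> nat \<Rightarrow> nat \<Rightarrow> real" where
  "two_sum m N j = shift_sum (\<lambda>ks. hsum ks N) m (replicate j 2)"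

lemma two_sum_0: "two_sum m N 0 = (if m = 0 then 1 else 0)"
  by (simp add: two_sum_def)

lemma two_sum_Suc_0: "two_sum m 0 (Suc j) = 0"
  unfolding two_sum_def replicate_Suc_snoc shift_sum_snoc by simp

lemma two_sum_Suc_Suc: "two_sum m (Suc N) (Suc j) =
    two_sum m N (Suc j) + (\<Sum>l\<le>m. real ((2 + l - 1) choose l) * (two_sum (m - l) N j / real (Suc N) ^ (2 + l)))"
  unfolding two_sum_def replicate_Suc_snoc shift_sum_snoc hsum_snoc_Suc shift_sum_add shift_sum_divide
  by (simp add: distrib_left sum.distrib)

lemma admissible_shift_two:
  assumes "length ls = j"
  shows "admissible (map2 (+) (replicate j 2) ls)"
proof (cases j)
  case (Suc i)
  then obtain ls' l where "ls = ls' @ [l]" "length ls' = i"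
    using assms by (cases ls rule: rev_cases) auto
  then have "map2 (+) (replicate j 2) ls = map2 (+) (replicate i 2) ls' @ [2 + l]"
    unfolding Suc replicate_Suc_snoc by simp
  moreover have "is_index (map2 (+) (replicate j 2) ls)"
    using assms by (intro is_index_map2_add is_index_replicate_2) simp
  ultimately show ?thesis
    by (simp add: admissible_def)
qed (simp add: admissible_def is_index_def)

lemma two_sum_tendsto: "(\<lambda>N. two_sum m N j) \<longlonglongrightarrow> CT (li_two m j)"
proof -
  have "CT (li_two m j) = shift_sum zeta_shuffle m (replicate j 2)"
    by (simp add: CT_def const_term_li_shift is_index_replicate_2)
  also have "\<dots> = shift_sum mzv m (replicate j 2)"
    by (rule shift_sum_cong) (simp add: admissible_shift_two zeta_reg_admissible[of _ Shuffle, simplified])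
  finally show ?thesis
    unfolding two_sum_def shift_sum_def
    by (auto intro!: tendsto_sum tendsto_mult_right hsum_tendsto_mzv admissible_shift_two simp: compositions_def)
qed

lemma two_sum_nonneg: "two_sum m N j \<ge> 0"
  unfolding two_sum_def shift_sum_def by (intro sum_nonneg mult_nonneg_nonneg prod_nonneg hsum_nonneg) simp

definition D_ser :: "nat \<Rightarrow> nat \<Rightarrow> real fps" where
  "D_ser m N = Abs_fps (two_sum m N)"

text \<open>\<open>D_ser m N\<close> is the coefficient of \<open>s^m\<close> in the product of the
  factors \<open>1 + x/(k - s)^2\<close> for \<open>1 \<le> k \<le> N\<close>, and
  \<open>- 2 * Z_ser N\<close> is the logarithmic derivative of this product at
  \<open>s = 0\<close>, expanded in \<open>x\<close>. That derivative has no constant term, which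
  matches the convention \<open>\<zeta>(1) = 0\<close>.\<close>

definition Z_ser :: "nat \<Rightarrow> real fps" where
  "Z_ser N = Abs_fps (\<lambda>k. if k = 0 then 0 else (-1) ^ k * (\<Sum>i<N. 1 / real (Suc i) ^ (2 * k + 1)))"

lemma D_ser_0: "D_ser 0 0 = 1" "D_ser 1 0 = 0"
proof -
  show "D_ser 0 0 = 1"
  proof (rule fps_ext)
    show "fps_nth (D_ser 0 0) j = fps_nth 1 j" for j
      by (cases j) (simp_all add: D_ser_def two_sum_0 two_sum_Suc_0)
  qed
  show "D_ser 1 0 = 0"
  proof (rule fps_ext)
    show "fps_nth (D_ser 1 0) j = fps_nth 0 j" for j
      by (cases j) (simp_all add: D_ser_def two_sum_0 two_sum_Suc_0)
  qed
qed

lemma D_ser_Suc: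
  shows "D_ser 0 (Suc N) = (1 + fps_const (1 / real (Suc N) ^ 2) * fps_X) * D_ser 0 N"
    and "D_ser 1 (Suc N) = (1 + fps_const (1 / real (Suc N) ^ 2) * fps_X) * D_ser 1 N
      + fps_const (2 / real (Suc N) ^ 3) * fps_X * D_ser 0 N"
proof -
  show "D_ser 0 (Suc N) = (1 + fps_const (1 / real (Suc N) ^ 2) * fps_X) * D_ser 0 N"
  proof (rule fps_ext)
    show "fps_nth (D_ser 0 (Suc N)) j = fps_nth ((1 + fps_const (1 / real (Suc N) ^ 2) * fps_X) * D_ser 0 N) j" for j
      by (cases j) (simp_all add: D_ser_def two_sum_0 two_sum_Suc_Suc distrib_right mult.assoc)
  qed
  show "D_ser 1 (Suc N) = (1 + fps_const (1 / real (Suc N) ^ 2) * fps_X) * D_ser 1 N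
      + fps_const (2 / real (Suc N) ^ 3) * fps_X * D_ser 0 N"
  proof (rule fps_ext)
    show "fps_nth (D_ser 1 (Suc N)) j = fps_nth ((1 + fps_const (1 / real (Suc N) ^ 2) * fps_X) * D_ser 1 N
      + fps_const (2 / real (Suc N) ^ 3) * fps_X * D_ser 0 N) j" for j
      by (cases j) (simp_all add: D_ser_def two_sum_0 two_sum_Suc_Suc distrib_right mult.assoc power2_eq_square power3_eq_cube)
  qed
qed

text \<open>With \<open>M = N + 1\<close> the increment is the geometric series
  \<open>- (x/M^3) / (1 + x/M^2)\<close>; it is stated with the denominator cleared.\<close>

lemma Z_ser_Suc:
  "(1 + fps_const (1 / real (Suc N) ^ 2) * fps_X) * Z_ser (Suc N) =
   (1 + fps_const (1 / real (Suc N) ^ 2) * fps_X) * Z_ser N - fps_const (1 / real (Suc N) ^ 3) * fps_X"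
proof -
  define M where "M = real (Suc N)"
  have M: "M > 0"
    by (simp add: M_def)
  define W where "W = Z_ser (Suc N) - Z_ser N"
  have W: "fps_nth W k = (if k = 0 then 0 else (-1) ^ k / M ^ (2 * k + 1))" for k
    by (simp add: W_def Z_ser_def M_def algebra_simps)
  have "(1 + fps_const (1 / M ^ 2) * fps_X) * W = - (fps_const (1 / M ^ 3) * fps_X)"
  proof (rule fps_ext)
    fix k
    consider "k = 0" | "k = 1" | j where "k = Suc (Suc j)"
      by (metis One_nat_def not0_implies_Suc)
    then show "fps_nth ((1 + fps_const (1 / M ^ 2) * fps_X) * W) k = fps_nth (- (fps_const (1 / M ^ 3) * fps_X)) k"
      using M by cases
        (simp_all add: distrib_right mult.assoc W fps_X_nth power2_eq_square power3_eq_cube)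
  qed
  then show ?thesis
    unfolding M_def W_def by (simp add: algebra_simps)
qed

lemma D_ser_1_eq: "D_ser 1 N = - 2 * (D_ser 0 N * Z_ser N)"
proof (induction N)
  case 0
  have "Z_ser 0 = 0"
    by (rule fps_ext) (simp add: Z_ser_def)
  then show ?case
    by (simp add: D_ser_0 D_ser_0[unfolded One_nat_def])
next
  case (Suc N)
  let ?A = "1 + fps_const (1 / real (Suc N) ^ 2) * fps_X"
  let ?B = "fps_const (1 / real (Suc N) ^ 3) * fps_X"
  have B: "fps_const (2 / real (Suc N) ^ 3) * fps_X = 2 * ?B"
    by (simp add: numeral_fps_const flip: mult.assoc)
  have "D_ser 1 (Suc N) = - 2 * (D_ser 0 N * (?A * Z_ser N - ?B))"
    unfolding D_ser_Suc(2) Suc B by (simp add: algebra_simps)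
  also have "\<dots> = - 2 * (D_ser 0 (Suc N) * Z_ser (Suc N))"
    unfolding D_ser_Suc(1) Z_ser_Suc[symmetric] by (simp only: mult_ac)
  finally show ?case .
qed

lemma riemann_zeta_tendsto:
  assumes "k > 0"
  shows "(\<lambda>N. \<Sum>i<N. 1 / real (Suc i) ^ (2 * k + 1)) \<longlonglongrightarrow> riemann_zeta (2 * k + 1)"
proof -
  have "summable (\<lambda>n. inverse (real n ^ (2 * k + 1)))"
    using assms by (intro inverse_power_summable) auto
  then have "summable (\<lambda>i. 1 / real (Suc i) ^ (2 * k + 1))"
    by (subst (asm) summable_Suc_iff[symmetric]) (simp only: divide_inverse mult_1)
  from summable_LIMSEQ[OF this] show ?thesis
    using assms by (simp add: riemann_zeta_def)
qed

text \<open>Each coefficient of \<open>D_ser_1_eq\<close> is a finite sum, so the limit in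
  \<open>N\<close> can be taken term by term.\<close>

lemma CT_li_two_1:
  "CT (li_two 1 j) = - 2 * (\<Sum>i\<le>j. CT (li_two 0 i) * ((-1) ^ (j - i) * riemann_zeta (2 * (j - i) + 1)))"
proof -
  have lim: "(\<lambda>N. fps_nth (Z_ser N) k) \<longlonglongrightarrow> (-1) ^ k * riemann_zeta (2 * k + 1)" for k
  proof (cases "k = 0")
    case False
    then show ?thesis
      unfolding Z_ser_def fps_nth_Abs_fps if_not_P[OF False]
      by (intro tendsto_mult_left riemann_zeta_tendsto) simp
  qed (simp add: Z_ser_def riemann_zeta_def)
  have "two_sum 1 N j = - 2 * (\<Sum>i\<le>j. two_sum 0 N i * fps_nth (Z_ser N) (j - i))" for N
  proof -
    have "D_ser 1 N = fps_const (- 2) * (D_ser 0 N * Z_ser N)"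
      unfolding D_ser_1_eq by (simp add: numeral_fps_const)
    from arg_cong[OF this, of "\<lambda>f. fps_nth f j"] show ?thesis
      unfolding fps_mult_left_const_nth unfolding fps_mult_nth
      by (simp only: D_ser_def fps_nth_Abs_fps atLeast0AtMost)
  qed
  moreover have "(\<lambda>N. - 2 * (\<Sum>i\<le>j. two_sum 0 N i * fps_nth (Z_ser N) (j - i))) \<longlonglongrightarrow>
      - 2 * (\<Sum>i\<le>j. CT (li_two 0 i) * ((-1) ^ (j - i) * riemann_zeta (2 * (j - i) + 1)))"
    by (intro tendsto_mult_left tendsto_sum tendsto_mult two_sum_tendsto lim)
  ultimately have "(\<lambda>N. two_sum 1 N j) \<longlonglongrightarrow>
      - 2 * (\<Sum>i\<le>j. CT (li_two 0 i) * ((-1) ^ (j - i) * riemann_zeta (2 * (j - i) + 1)))"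
    by simp
  then show ?thesis
    using two_sum_tendsto LIMSEQ_unique by blast
qed

section \<open>Euler's product for the sine\<close>

lemma two_sum_0_sums: "(\<lambda>j. two_sum 0 N j * x ^ j) sums (\<Prod>k=1..N. 1 + x / real k ^ 2)"
proof (induction N)
  case 0
  have "(\<lambda>j. two_sum 0 0 j * x ^ j) = (\<lambda>j. if j = 0 then 1 else 0)"
  proof
    show "two_sum 0 0 j * x ^ j = (if j = 0 then 1 else 0)" for j
      by (cases j) (simp_all add: two_sum_0 two_sum_Suc_0)
  qed
  then show ?case
    using sums_single[of 0 "\<lambda>_. 1 :: real"] by simp
next
  case (Suc N)
  let ?c = "x / real (Suc N) ^ 2"
  have "(\<lambda>j. ?c * (two_sum 0 N j * x ^ j)) sums (?c * (\<Prod>k=1..N. 1 + x / real k ^ 2))"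
    by (rule sums_mult[OF Suc])
  then have "(\<lambda>j. case j of 0 \<Rightarrow> 0 | Suc i \<Rightarrow> ?c * (two_sum 0 N i * x ^ i)) sums (?c * (\<Prod>k=1..N. 1 + x / real k ^ 2))"
    by (subst sums_Suc_iff[symmetric, where f = "\<lambda>j. case j of 0 \<Rightarrow> 0 | Suc i \<Rightarrow> ?c * (two_sum 0 N i * x ^ i)", simplified]) simp
  from sums_add[OF Suc this]
  have "(\<lambda>j. two_sum 0 N j * x ^ j + (case j of 0 \<Rightarrow> 0 | Suc i \<Rightarrow> ?c * (two_sum 0 N i * x ^ i))) sums
      ((\<Prod>k=1..N. 1 + x / real k ^ 2) + ?c * (\<Prod>k=1..N. 1 + x / real k ^ 2))" .
  also have "(\<lambda>j. two_sum 0 N j * x ^ j + (case j of 0 \<Rightarrow> 0 | Suc i \<Rightarrow> ?c * (two_sum 0 N i * x ^ i))) = (\<lambda>j. two_sum 0 (Suc N) j * x ^ j)"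
  proof
    show "two_sum 0 N j * x ^ j + (case j of 0 \<Rightarrow> 0 | Suc i \<Rightarrow> ?c * (two_sum 0 N i * x ^ i)) = two_sum 0 (Suc N) j * x ^ j" for j
      by (cases j) (simp_all add: two_sum_0 two_sum_Suc_Suc distrib_right)
  qed
  also have "(\<Prod>k=1..N. 1 + x / real k ^ 2) + ?c * (\<Prod>k=1..N. 1 + x / real k ^ 2) = (\<Prod>k=1..Suc N. 1 + x / real k ^ 2)"
    by (simp add: algebra_simps)
  finally show ?case .
qed

text \<open>The coefficients are nonnegative, hence at most the value of the product at
  \<open>x = 1\<close>, and \<open>1 + u \<le> exp u\<close> bounds that value uniformly in
  \<open>N\<close>.\<close>

lemma two_sum_0_bound: "\<exists>M. \<forall>N j. two_sum 0 N j \<le> M"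
proof -
  have s: "summable (\<lambda>n. 1 / real n ^ 2)"
    using inverse_power_summable[of 2, where 'a = real] by (simp add: divide_inverse)
  have "two_sum 0 N j \<le> exp (suminf (\<lambda>n. 1 / real n ^ 2))" for N j
  proof -
    have sm: "(\<lambda>j. two_sum 0 N j) sums (\<Prod>k=1..N. 1 + 1 / real k ^ 2)"
      using two_sum_0_sums[of N 1] by simp
    have "two_sum 0 N j = (\<Sum>i\<in>{j}. two_sum 0 N i)"
      by simp
    also have "\<dots> \<le> suminf (two_sum 0 N)"
      by (rule sum_le_suminf) (use sm two_sum_nonneg in \<open>auto simp: sums_iff\<close>)
    also have "\<dots> = (\<Prod>k=1..N. 1 + 1 / real k ^ 2)"
      using sm by (simp add: sums_iff)
    also have "\<dots> \<le> (\<Prod>k=1..N. exp (1 / real k ^ 2))"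
      by (intro prod_mono) (auto simp: exp_ge_add_one_self)
    also have "\<dots> = exp (\<Sum>k=1..N. 1 / real k ^ 2)"
      by (simp add: exp_sum)
    also have "\<dots> \<le> exp (suminf (\<lambda>n. 1 / real n ^ 2))"
      using sum_le_suminf[OF s, of "{1..N}"] by simp
    finally show ?thesis .
  qed
  then show ?thesis
    by blast
qed

lemma powser_eq_0_imp_coeff_0:
  fixes a :: "nat \<Rightarrow> real"
  assumes "\<And>x. x \<noteq> 0 \<Longrightarrow> \<bar>x\<bar> < 1 \<Longrightarrow> (\<lambda>n. a n * x ^ n) sums 0"
  shows "a n = 0"
  using assms
proof (induction n arbitrary: a)
  case (0 a)
  have "((\<lambda>_. 0) \<longlongrightarrow> a 0) (at (0 :: real))"
    by (rule powser_limit_0_strong[of 1 a "\<lambda>_. 0"]) (use 0 in auto)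
  then show ?case
    using LIM_unique tendsto_const by blast
next
  case (Suc n a)
  have "((\<lambda>_. 0) \<longlongrightarrow> a 0) (at (0 :: real))"
    by (rule powser_limit_0_strong[of 1 a "\<lambda>_. 0"]) (use Suc.prems in auto)
  then have a0: "a 0 = 0"
    using LIM_unique tendsto_const by blast
  show ?case
  proof (rule Suc.IH)
    fix x :: real
    assume x: "x \<noteq> 0" "\<bar>x\<bar> < 1"
    have "(\<lambda>n. a (Suc n) * x ^ Suc n) sums 0"
      using Suc.prems[OF x] sums_Suc_iff[of "\<lambda>n. a n * x ^ n" 0] a0 by simp
    then have "(\<lambda>n. (a (Suc n) * x ^ Suc n) / x) sums (0 / x)"
      by (rule sums_divide)
    then show "(\<lambda>n. a (Suc n) * x ^ n) sums 0"
      using x by simp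
  qed
qed

text \<open>Replacing \<open>x\<close> by \<open>- x^2\<close> in the generating product gives the
  product for \<open>sin (pi * x) / (pi * x)\<close>; comparison with the Taylor series of the sine
  yields the values.\<close>

lemma CT_li_two_0: "CT (li_two 0 j) = pi ^ (2 * j) / fact (2 * j + 1)"
proof -
  define z where "z = (\<lambda>j. CT (li_two 0 j))"
  obtain M where M: "\<And>N j. two_sum 0 N j \<le> M"
    using two_sum_0_bound by blast
  have sin_sums: "(\<lambda>j. pi * z j * (-1) ^ j * x ^ (2 * j + 1)) sums sin (pi * x)"
    if x: "x \<noteq> 0" "\<bar>x\<bar> < 1" for x :: real
  proof -
    let ?a = "\<lambda>j N. two_sum 0 N j * (- (x ^ 2)) ^ j"
    let ?b = "\<lambda>j. z j * (- (x ^ 2)) ^ j"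
    \<comment> \<open>Limit and summation are interchanged with the dominating series of terms
      \<open>M * (x ^ 2) ^ j\<close>, where \<open>M\<close> is the bound uniform in
      \<open>N\<close> and \<open>j\<close>.\<close>
    have tannery: "eventually (\<lambda>N. summable (\<lambda>j. norm (?a j N))) sequentially \<and> summable (\<lambda>j. norm (?b j)) \<and>
        ((\<lambda>N. suminf (\<lambda>j. ?a j N)) \<longlonglongrightarrow> suminf ?b)"
    proof (rule tannerys_theorem)
      show "(\<lambda>N. ?a j N) \<longlonglongrightarrow> ?b j" for j
        unfolding z_def by (intro tendsto_mult_right two_sum_tendsto)
      show "\<forall>\<^sub>F (j, N) in at_top \<times>\<^sub>F sequentially. norm (?a j N) \<le> M * (x ^ 2) ^ j"
        by (intro always_eventually)
          (auto simp: abs_mult power_abs two_sum_nonneg M intro!: mult_right_mono)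
      have "x ^ 2 < 1"
        using x by (simp add: abs_square_less_1)
      then show "summable (\<lambda>j. M * (x ^ 2) ^ j)"
        by (intro summable_mult summable_geometric) simp
    qed simp
    have sb: "summable ?b"
      by (rule summable_norm_cancel[OF tannery[THEN conjunct2, THEN conjunct1]])
    have lim: "(\<lambda>N. suminf (\<lambda>j. ?a j N)) \<longlonglongrightarrow> suminf ?b"
      by (rule tannery[THEN conjunct2, THEN conjunct2])
    have "suminf (\<lambda>j. ?a j N) = (\<Prod>k=1..N. 1 - x ^ 2 / real k ^ 2)" for N
      using two_sum_0_sums[of N "- (x ^ 2)"] by (simp add: sums_iff)
    then have "(\<lambda>N. \<Prod>k=1..N. 1 - x ^ 2 / real k ^ 2) \<longlonglongrightarrow> suminf ?b"
      using lim by (simp only:)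
    then have "suminf ?b = sin (pi * x) / (pi * x)"
      using sin_product_formula_real'[OF x(1)] by (rule LIMSEQ_unique)
    then have "(\<lambda>j. (pi * x) * ?b j) sums ((pi * x) * (sin (pi * x) / (pi * x)))"
      using sb by (intro sums_mult) (simp add: sums_iff)
    moreover have "(pi * x) * ?b j = pi * z j * (-1) ^ j * x ^ (2 * j + 1)" for j
    proof -
      have "(- (x ^ 2)) ^ j = (-1) ^ j * x ^ (2 * j)"
        by (simp only: power_minus[of "x ^ 2"] power_mult)
      then show ?thesis
        by (simp only: power_add power_one_right mult_ac)
    qed
    ultimately show ?thesis
      using x by simp
  qed
  \<comment> \<open>The difference of the two expansions of \<open>sin (pi * x)\<close>, the first
    of which is spread over the odd degrees.\<close>
  define a where "a = (\<lambda>n. (if even n then 0 else pi * z ((n - 1) div 2) * (-1) ^ ((n - 1) div 2)) - sin_coeff n * pi ^ n)"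
  have "a (2 * j + 1) = 0"
  proof (rule powser_eq_0_imp_coeff_0)
    fix x :: real
    assume x: "x \<noteq> 0" "\<bar>x\<bar> < 1"
    have 1: "(\<lambda>n. if even n then 0 else pi * z ((n - 1) div 2) * (-1) ^ ((n - 1) div 2) * x ^ (2 * ((n - 1) div 2) + 1)) sums sin (pi * x)"
      by (rule sums_if'[OF sin_sums[OF x]])
    have 2: "(\<lambda>n. sin_coeff n * (pi * x) ^ n) sums sin (pi * x)"
      using sin_converges[of "pi * x"] by simp
    have "(if even n then 0 else pi * z ((n - 1) div 2) * (-1) ^ ((n - 1) div 2) * x ^ (2 * ((n - 1) div 2) + 1))
        - sin_coeff n * (pi * x) ^ n = a n * x ^ n" for n
      by (cases "even n") (auto simp: a_def power_mult_distrib algebra_simps elim!: oddE)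
    then show "(\<lambda>n. a n * x ^ n) sums 0"
      using sums_diff[OF 1 2] by simp
  qed
  then have "pi * z j = pi * (pi ^ (2 * j) / fact (2 * j + 1))"
    by (cases "even j") (simp_all add: a_def sin_coeff_def)
  then have "z j = pi ^ (2 * j) / fact (2 * j + 1)"
    using pi_neq_zero mult_left_cancel by blast
  then show ?thesis
    by (simp add: z_def)
qed

section \<open>Convolutions and the closed forms of the two coefficients\<close>

lemma sum_odd_binomial: "(\<Sum>i\<le>r. (2 * r + 2) choose (2 * i + 1)) = 2 ^ (2 * r + 1)"
proof -
  have "(\<Sum>i\<le>r. (2 * r + 2) choose (2 * i + 1)) = (\<Sum>i | i \<le> 2 * r + 2 \<and> odd i. (2 * r + 2) choose i)"
    by (rule sum.reindex_bij_witness[of _ "\<lambda>i. (i - 1) div 2" "\<lambda>i. 2 * i + 1"]) (auto elim!: oddE)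
  also have "\<dots> = (\<Sum>i\<le>2 * r + 2. if odd i then (2 * r + 2) choose i else 0)"
    by (intro sum.mono_neutral_cong_left) auto
  finally have "2 * int (\<Sum>i\<le>r. (2 * r + 2) choose (2 * i + 1)) =
      2 * (\<Sum>i\<le>2 * r + 2. if odd i then int ((2 * r + 2) choose i) else 0)"
    by (simp only: of_nat_sum if_distrib[of int] of_nat_0)
  also have "\<dots> = 2 ^ (2 * r + 2)"
    by (rule choose_odd_sum) simp
  finally have "int (\<Sum>i\<le>r. (2 * r + 2) choose (2 * i + 1)) = int (2 ^ (2 * r + 1))"
    by simp
  then show ?thesis
    by (simp only: of_nat_eq_iff)
qed

text \<open>The product of the reciprocal factorials of \<open>2 i + 1\<close> and
  \<open>2 (r - i) + 1\<close> is an odd binomial coefficient over \<open>fact (2 * r + 2)\<close>,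
  and the odd half of that row sums to \<open>2 ^ (2 * r + 1)\<close>.\<close>

lemma conv_li_two:
  "(\<Sum>i\<le>r. CT (li_two 0 i) * CT (li_two 0 (r - i))) = 2 ^ (2 * r + 1) * pi ^ (2 * r) / fact (2 * r + 2)"
proof -
  have "CT (li_two 0 i) * CT (li_two 0 (r - i)) =
      pi ^ (2 * r) / fact (2 * r + 2) * real ((2 * r + 2) choose (2 * i + 1))" if "i \<le> r" for i
  proof -
    have "2 * r + 2 - (2 * i + 1) = 2 * (r - i) + 1"
      using that by simp
    then have "real ((2 * r + 2) choose (2 * i + 1)) = fact (2 * r + 2) / (fact (2 * i + 1) * fact (2 * (r - i) + 1))"
      using binomial_fact[of "2 * i + 1" "2 * r + 2", where 'a = real] that by simp
    moreover have "2 * i + 2 * (r - i) = 2 * r"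
      using that by simp
    then have "pi ^ (2 * i) * pi ^ (2 * (r - i)) = pi ^ (2 * r)"
      by (simp only: power_add[symmetric])
    moreover have "CT (li_two 0 i) * CT (li_two 0 (r - i)) =
        (pi ^ (2 * i) * pi ^ (2 * (r - i))) / (fact (2 * i + 1) * fact (2 * (r - i) + 1))"
      unfolding CT_li_two_0 by (rule times_divide_times_eq)
    moreover have "x / y = x / c * (c / y)" if "c \<noteq> 0" for x y c :: real
      using that by simp
    ultimately show ?thesis
      by (metis fact_nonzero)
  qed
  then have "(\<Sum>i\<le>r. CT (li_two 0 i) * CT (li_two 0 (r - i))) =
      pi ^ (2 * r) / fact (2 * r + 2) * real (\<Sum>i\<le>r. (2 * r + 2) choose (2 * i + 1))"
    unfolding of_nat_sum sum_distrib_left by (intro sum.cong) simp_all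
  then show ?thesis
    unfolding sum_odd_binomial by simp
qed

text \<open>As generating series the values of \<open>li_two 1\<close> are -2 times those of
  \<open>li_two 0\<close> times the odd zeta values. By associativity the square of the series for
  \<open>li_two 0\<close> appears, which \<open>conv_li_two\<close> evaluates.\<close>

lemma conv_li_two_1:
  "(\<Sum>i\<le>r. CT (li_two 0 i) * CT (li_two 1 (r - i))) =
    - 2 * (\<Sum>i\<le>r. 2 ^ (2 * i + 1) * pi ^ (2 * i) / fact (2 * i + 2) * ((-1) ^ (r - i) * riemann_zeta (2 * (r - i) + 1)))"
proof -
  define z where "z = Abs_fps (\<lambda>j. CT (li_two 0 j))"
  define y where "y = Abs_fps (\<lambda>j. CT (li_two 1 j))"
  define w where "w = Abs_fps (\<lambda>k. (-1) ^ k * riemann_zeta (2 * k + 1))"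
  have "y = fps_const (- 2) * (z * w)"
  proof (rule fps_ext)
    show "fps_nth y j = fps_nth (fps_const (- 2) * (z * w)) j" for j
      unfolding fps_mult_left_const_nth unfolding fps_mult_nth
      by (simp only: y_def z_def w_def CT_li_two_1 fps_nth_Abs_fps atLeast0AtMost)
  qed
  then have "fps_nth (z * y) r = fps_nth (fps_const (- 2) * (z * z * w)) r"
    by (simp only: mult_ac)
  moreover have "fps_nth (z * y) r = (\<Sum>i\<le>r. CT (li_two 0 i) * CT (li_two 1 (r - i)))"
    by (simp only: y_def z_def fps_mult_nth fps_nth_Abs_fps atLeast0AtMost)
  moreover have "fps_nth (fps_const (- 2) * (z * z * w)) r = - 2 * (\<Sum>i\<le>r. (\<Sum>l\<le>i. CT (li_two 0 l) * CT (li_two 0 (i - l)))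
      * ((-1) ^ (r - i) * riemann_zeta (2 * (r - i) + 1)))"
    unfolding fps_mult_left_const_nth unfolding fps_mult_nth
    by (simp only: w_def z_def fps_nth_Abs_fps atLeast0AtMost)
  ultimately show ?thesis
    unfolding conv_li_two by simp
qed

text \<open>For odd \<open>r\<close> the reflection of \<open>i\<close> to \<open>r - i\<close>
  reverses every sign.\<close>

lemma wronski_coeff_0: "odd r \<Longrightarrow> wronski_coeff 0 r = 0"
proof -
  assume r: "odd r"
  have "wronski_coeff 0 r = (\<Sum>i\<le>r. (-1) ^ i * (CT (li_alt 0 (r - i)) * CT (li_alt 0 i)))"
    unfolding wronski_coeff_def
    by (rule sum.reindex_bij_witness[of _ "\<lambda>i. r - i" "\<lambda>i. r - i"]) auto
  also have "\<dots> = (\<Sum>i\<le>r. - ((-1) ^ (r - i) * (CT (li_alt 0 i) * CT (li_alt 0 (r - i)))))"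
  proof (intro sum.cong refl)
    fix i
    assume "i \<in> {..r}"
    then have "(-1 :: real) ^ i = - ((-1) ^ (r - i))"
      using r by (cases "even i") simp_all
    then show "(-1) ^ i * (CT (li_alt 0 (r - i)) * CT (li_alt 0 i)) = - ((-1) ^ (r - i) * (CT (li_alt 0 i) * CT (li_alt 0 (r - i))))"
      by simp
  qed
  also have "\<dots> = - wronski_coeff 0 r"
    by (simp add: wronski_coeff_def sum_negf)
  finally show ?thesis
    by simp
qed

lemma kap_odd: "kap (2 * n + 1) = - 2 * (-4) ^ n"
  by (simp add: kap_def)

lemma wronski_coeff_1: "wronski_coeff 1 (2 * n + 1) = (-4) ^ (n + 1) / fact (4 * n + 4) * pi ^ (4 * n + 2)"
proof -
  have e: "2 * (2 * n + 1) = 4 * n + 2" "4 * n + 2 + 2 = 4 * n + (4 :: nat)"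
    by simp_all
  have "- 2 * (-4) ^ n * wronski_coeff 1 (2 * n + 1) = 2 ^ (4 * n + 2 + 1) * pi ^ (4 * n + 2) / fact (4 * n + 4)"
    using wronski_coeff_eq(1)[of "2 * n + 1"] unfolding conv_li_two kap_odd e by simp
  also have "(2 :: real) ^ (4 * n + 2 + 1) = - 2 * (-4) ^ n * (-4) ^ (n + 1)"
  proof -
    have "(-4 :: real) ^ n * (-4) ^ n = 2 ^ (4 * n)"
      by (simp add: power_mult flip: power_mult_distrib)
    then show ?thesis
      by (simp add: power_add)
  qed
  finally have "(- 2 * (-4) ^ n) * wronski_coeff 1 (2 * n + 1) =
      (- 2 * (-4) ^ n) * ((-4) ^ (n + 1) / fact (4 * n + 4) * pi ^ (4 * n + 2))"
    by (simp only: times_divide_eq_left times_divide_eq_right mult.assoc)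
  then show ?thesis
    by (simp only: mult_cancel_left) simp
qed

lemma wronski_coeff_2: "wronski_coeff 2 (2 * n + 1) = (-1) ^ n *
    (\<Sum>(n0, n1) | n0 + n1 = 2 * n + 1.
      (-1) ^ n1 * 2 powi (int n0 - int n1 + 2) / fact (2 * n0 + 2) * pi ^ (2 * n0) * riemann_zeta (2 * n1 + 1))"
proof -
  let ?r = "2 * n + 1"
  let ?t = "\<lambda>n0 n1. (-1) ^ n1 * 2 powi (int n0 - int n1 + 2) / fact (2 * n0 + 2) * pi ^ (2 * n0) * riemann_zeta (2 * n1 + 1)"
  let ?s = "\<lambda>i. 2 ^ (2 * i + 1) * pi ^ (2 * i) / fact (2 * i + 2) * ((-1) ^ (?r - i) * riemann_zeta (2 * (?r - i) + 1))"
  have "(\<Sum>(n0, n1) | n0 + n1 = ?r. ?t n0 n1) = (\<Sum>i\<le>?r. ?t i (?r - i))"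
  proof -
    have "{(n0, n1). n0 + n1 = ?r} = (\<lambda>i. (i, ?r - i)) ` {..?r}"
      by (auto simp: image_iff)
    moreover have inj: "inj_on (\<lambda>i. (i, ?r - i)) {..?r}"
      by (auto simp: inj_on_def)
    ultimately show ?thesis
      by (simp only: sum.reindex[OF inj] comp_def prod.case)
  qed
  also have "\<dots> = (\<Sum>i\<le>?r. ?s i / 4 ^ n)"
  proof (intro sum.cong refl)
    fix i
    assume "i \<in> {..?r}"
    \<comment> \<open>With \<open>n0 = i\<close> and \<open>n1 = 2 n + 1 - i\<close> the exponent is
      \<open>2 i + 1 - 2 n\<close>: the first part is the power of 2 in the convolution, and the
      second is the factor \<open>4 ^ n\<close> from \<open>kap\<close>.\<close>
    then have "int i - int (?r - i) + 2 = int (2 * i + 1) - int (2 * n)"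
      by (simp add: of_nat_diff)
    then have "(2 :: real) powi (int i - int (?r - i) + 2) = 2 powi (int (2 * i + 1) - int (2 * n))"
      by (simp only:)
    also have "\<dots> = 2 powi int (2 * i + 1) / 2 powi int (2 * n)"
      by (rule power_int_diff) simp
    also have "\<dots> = 2 ^ (2 * i + 1) / 2 ^ (2 * n)"
      by (simp only: power_int_of_nat)
    also have "(2 :: real) ^ (2 * n) = 4 ^ n"
      by (simp add: power_mult)
    finally show "?t i (?r - i) = ?s i / 4 ^ n"
      by (simp only: times_divide_eq_left times_divide_eq_right divide_divide_eq_left mult_ac)
  qed
  finally have sum_eq: "(\<Sum>(n0, n1) | n0 + n1 = ?r. ?t n0 n1) = sum ?s {..?r} / 4 ^ n"
    by (simp only: sum_divide_distrib)
  have "- 2 * (-4) ^ n * wronski_coeff 2 ?r = - 2 * sum ?s {..?r}"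
    using wronski_coeff_eq(2)[of ?r] unfolding conv_li_two_1 kap_odd by simp
  then have "(-4) ^ n * wronski_coeff 2 ?r = sum ?s {..?r}"
    by simp
  also have "(-4 :: real) ^ n = (-1) ^ n * 4 ^ n"
    by (simp flip: power_mult_distrib)
  finally have "wronski_coeff 2 ?r = (-1) ^ n * (sum ?s {..?r} / 4 ^ n)"
    by (cases "even n") (simp_all add: field_simps)
  then show ?thesis
    unfolding sum_eq .
qed

section \<open>The symmetric multiple zeta values\<close>

lemma alternating_index_eq: "concat (replicate n [1, 3]) @ [1] = alt_index (2 * n + 1)"
proof (induction n)
  case (Suc n)
  have "concat (replicate (Suc n) [1, 3]) @ [1] = (concat (replicate n [1, 3]) @ [1]) @ [3, 1 :: nat]"
    by (simp only: replicate_Suc_snoc) simp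
  also have "\<dots> = alt_index (2 * Suc n + 1)"
    unfolding Suc by (simp add: alt_index_Suc)
  finally show ?case .
qed (simp add: alt_index_Suc)

lemma take_alt_index: "i \<le> r \<Longrightarrow> take i (alt_index r) = alt_index i"
  by (simp add: alt_index_def take_map)

lemma nth_alt_index: "i < r \<Longrightarrow> alt_index r ! i = (if even i then 1 else 3)"
  by (simp add: alt_index_def)

text \<open>An alternating index of odd length is a palindrome, so its reversed suffixes are its
  prefixes.\<close>

lemma rev_drop_alt_index:
  assumes "odd r" "i \<le> r"
  shows "rev (drop i (alt_index r)) = alt_index (r - i)"
proof (rule nth_equalityI)
  fix j
  assume "j < length (rev (drop i (alt_index r)))"
  then have j: "j < r - i"
    by simp
  then have "\<not> r < Suc j"
    by linarith
  then have "even (r - Suc j) = even j"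
    using assms by simp
  moreover have "rev (drop i (alt_index r)) ! j = alt_index r ! (r - Suc j)"
    using j by (simp add: rev_nth)
  ultimately show "rev (drop i (alt_index r)) ! j = alt_index (r - i) ! j"
    using j by (simp add: nth_alt_index)
qed simp

lemma sum_list_alt_index: "(-1 :: real) ^ sum_list (alt_index r) = (-1) ^ r"
  by (induction r) (simp_all add: alt_index_Suc power_add)

text \<open>A trailing 1 survives only if the last entry is an unshifted 1. The entry before it, if
  any, is at least 3, so a second trailing 1 cannot occur and both regularizations agree.\<close>

lemma alt_index_shift_cases:
  assumes "length ls = r"
  shows "admissible (map2 (+) (alt_index r) ls) \<or>
    (\<exists>ks. map2 (+) (alt_index r) ls = ks @ [1] \<and> admissible ks)"
  using assms
proof (induction r arbitrary: ls)
  case (Suc r)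
  then obtain ls' l where ls: "ls = ls' @ [l]" "length ls' = r"
    by (cases ls rule: rev_cases) auto
  have ind: "is_index (map2 (+) (alt_index r) ls')"
    using ls by (intro is_index_map2_add is_index_alt_index) simp
  have eq: "map2 (+) (alt_index (Suc r)) ls = map2 (+) (alt_index r) ls' @ [(if even r then 1 else 3) + l]"
    using ls by (simp add: alt_index_Suc)
  show ?case
  proof (cases "even r \<and> l = 0")
    case True
    have "admissible (map2 (+) (alt_index r) ls')"
    proof (cases r)
      case (Suc q)
      then obtain ls'' l' where ls'': "ls' = ls'' @ [l']" "length ls'' = q"
        using ls by (cases ls' rule: rev_cases) auto
      have "map2 (+) (alt_index r) ls' = map2 (+) (alt_index q) ls'' @ [3 + l']"
        using ls'' True Suc by (simp add: alt_index_Suc)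
      then show ?thesis
        using ind by (simp add: admissible_def)
    qed (simp add: admissible_def is_index_def)
    then show ?thesis
      using eq True by simp
  next
    case False
    then show ?thesis
      using eq ind by (auto simp: admissible_def)
  qed
qed (simp add: admissible_def is_index_def)

lemma zeta_shift_alt_index: "zeta_shift b m (alt_index r) = CT (li_alt m r)"
  unfolding zeta_shift_altdef CT_def const_term_li_shift[OF is_index_alt_index]
  by (rule shift_sum_cong, rule zeta_reg_eq_zeta_shuffle, rule alt_index_shift_cases) simp

lemma shift_sum_0: "shift_sum F 0 ks = F ks"
proof (induction ks arbitrary: F rule: rev_induct)
  case (snoc k ks)
  then show ?case
    unfolding shift_sum_snoc by simp
qed simp

lemma zeta_reg_alt_index: "zeta_reg b (alt_index r) = CT (li_alt 0 r)"
  using zeta_shift_alt_index[of b 0 r] by (simp add: zeta_shift_altdef shift_sum_0)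

lemma zeta_S_hat_nth:
  "fps_nth (zeta_S_hat b ks) m =
     (\<Sum>i\<le>length ks. (-1) ^ sum_list (drop i ks) * zeta_reg b (take i ks) * zeta_shift b m (rev (drop i ks)))"
  by (simp add: zeta_S_hat_def fps_sum_nth)

lemma zeta_S_hat_alt_index_nth:
  assumes "odd r"
  shows "fps_nth (zeta_S_hat b (alt_index r)) m = wronski_coeff m r"
  unfolding zeta_S_hat_nth wronski_coeff_def length_alt_index
proof (rule sum.cong[OF refl])
  fix i
  assume "i \<in> {..r}"
  then have i: "i \<le> r"
    by simp
  have "sum_list (drop i (alt_index r)) = sum_list (alt_index (r - i))"
    using rev_drop_alt_index[OF assms i] by (metis sum_list_rev)
  then show "(-1) ^ sum_list (drop i (alt_index r)) * zeta_reg b (take i (alt_index r)) *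
      zeta_shift b m (rev (drop i (alt_index r))) = (-1) ^ (r - i) * (CT (li_alt 0 i) * CT (li_alt m (r - i)))"
    by (simp only: rev_drop_alt_index[OF assms i] take_alt_index[OF i] zeta_shift_alt_index zeta_reg_alt_index
        sum_list_alt_index mult.assoc)
qed

section \<open>Coefficients in the span of multiple zeta values and residue classes\<close>

lemma mzv_space_mult_rat: "x \<in> mzv_space \<Longrightarrow> x * of_rat c \<in> mzv_space"
  using mzv_space_scale[of x c] by (simp only: mult.commute)

lemma mzv_space_sum: "(\<And>x. x \<in> A \<Longrightarrow> f x \<in> mzv_space) \<Longrightarrow> sum f A \<in> mzv_space"
  by (induction A rule: infinite_finite_induct) (auto intro: mzv_space_zero mzv_space_add)

lemma mzv_space_neg1_power: "x \<in> mzv_space \<Longrightarrow> (-1) ^ k * x \<in> mzv_space"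
  using mzv_space_scale[of x "(-1) ^ k"] by (simp add: of_rat_power)

lemma zeta_shift_in_mzv_space:
  assumes "is_index ks"
  shows "zeta_shift b m ks \<in> mzv_space"
  unfolding zeta_shift_altdef shift_sum_def
proof (rule mzv_space_sum)
  fix ls
  assume "ls \<in> compositions (length ks) m"
  then have "zeta_reg b (map2 (+) ks ls) \<in> mzv_space"
    by (intro zeta_reg_in_mzv_space is_index_map2_add assms) (simp add: compositions_def)
  from mzv_space_mult_rat[OF this, of "of_nat (\<Prod>i<length ks. (ks ! i + ls ! i - 1) choose (ls ! i))"]
  show "zeta_reg b (map2 (+) ks ls) * (\<Prod>i<length ks. real ((ks ! i + ls ! i - 1) choose (ls ! i))) \<in> mzv_space"
    by (simp only: of_rat_of_nat_eq) (simp only: of_nat_prod)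
qed

lemma zeta_S_hat_in_mzv_fps:
  assumes "is_index ks"
  shows "fps_nth (zeta_S_hat b ks) m \<in> mzv_space"
  unfolding zeta_S_hat_nth
proof (rule mzv_space_sum)
  fix i
  have "is_index (take i ks)" "is_index (rev (drop i ks))"
    using assms by (auto simp: is_index_def dest: in_set_takeD in_set_dropD)
  then show "(-1) ^ sum_list (drop i ks) * zeta_reg b (take i ks) * zeta_shift b m (rev (drop i ks)) \<in> mzv_space"
    unfolding mult.assoc
    by (intro mzv_space_neg1_power mzv_space_mult zeta_reg_in_mzv_space zeta_shift_in_mzv_space)
qed

text \<open>Agreement below \<open>m\<close> makes the difference a multiple of \<open>t^m\<close>
  over the reals; equality of classes also requires the cofactor to have coefficients in
  \<open>mzv_space\<close>, which is the second hypothesis.\<close>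

lemma residue_class_eqI:
  assumes low: "\<And>i. i < m \<Longrightarrow> fps_nth f i = fps_nth g i"
    and high: "\<And>i. fps_nth f (i + m) - fps_nth g (i + m) \<in> mzv_space"
  shows "residue_class m f = residue_class m g"
proof -
  define d where "d = Abs_fps (\<lambda>i. fps_nth f (i + m) - fps_nth g (i + m))"
  have f: "f = g + fps_X ^ m * d"
  proof (rule fps_ext)
    show "fps_nth f i = fps_nth (g + fps_X ^ m * d) i" for i
      using low[of i] by (cases "i < m") (simp_all add: d_def fps_X_power_mult_nth)
  qed
  have d: "fps_nth d i \<in> mzv_space" for i
    using high by (simp add: d_def)
  have add: "k + d \<in> mzv_fps" "k - d \<in> mzv_fps" if "k \<in> mzv_fps" for k
    using that d mzv_space_add[OF _ mzv_space_neg1_power[of _ 1]]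
    by (auto simp: mzv_fps_def intro: mzv_space_add)
  show ?thesis
    unfolding residue_class_def
  proof (intro equalityI subsetI)
    fix x
    assume "x \<in> {f + fps_X ^ m * k |k. k \<in> mzv_fps}"
    then obtain k where "k \<in> mzv_fps" "x = g + fps_X ^ m * (k + d)"
      using f by (auto simp: algebra_simps)
    then show "x \<in> {g + fps_X ^ m * k |k. k \<in> mzv_fps}"
      using add by blast
  next
    fix x
    assume "x \<in> {g + fps_X ^ m * k |k. k \<in> mzv_fps}"
    then obtain k where "k \<in> mzv_fps" "x = f + fps_X ^ m * (k - d)"
      using f by (auto simp: algebra_simps)
    then show "x \<in> {f + fps_X ^ m * k |k. k \<in> mzv_fps}"
      using add by blast
  qed
qed

theorem theorem1p5:
  fixes b :: regularization and n :: nat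
  shows "zeta_S b 3 (concat (replicate n [1, 3]) @ [1]) =
    residue_class 3
      (fps_const ((-4) ^ (n + 1) / fact (4 * n + 4) * pi ^ (4 * n + 2)) * fps_X
       + fps_const ((-1) ^ n *
           (\<Sum>(n0, n1) | n0 + n1 = 2 * n + 1.
              (-1) ^ n1 * 2 powi (int n0 - int n1 + 2) / fact (2 * n0 + 2)
              * pi ^ (2 * n0) * riemann_zeta (2 * n1 + 1)))
         * fps_X ^ 2)"
proof -
  have r: "odd (2 * n + 1)"
    by simp
  have nth: "fps_nth (fps_const c1 * fps_X + fps_const c2 * fps_X ^ 2) i = (if i = 1 then c1 else if i = 2 then c2 else 0)"
    for c1 c2 :: real and i
    by (simp add: fps_X_power_nth)
  show ?thesis
    unfolding zeta_S_def alternating_index_eq wronski_coeff_1[symmetric] wronski_coeff_2[symmetric]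
  proof (rule residue_class_eqI; unfold nth)
    fix i :: nat
    assume "i < 3"
    then consider "i = 0" | "i = 1" | "i = 2"
      by linarith
    then show "fps_nth (zeta_S_hat b (alt_index (2 * n + 1))) i =
        (if i = 1 then wronski_coeff 1 (2 * n + 1) else if i = 2 then wronski_coeff 2 (2 * n + 1) else 0)"
      unfolding zeta_S_hat_alt_index_nth[OF r] using wronski_coeff_0[OF r] by cases simp_all
  next
    \<comment> \<open>From degree 3 on the right-hand side vanishes, so the difference is a
      coefficient of \<open>zeta_S_hat\<close> itself.\<close>
    fix i :: nat
    show "fps_nth (zeta_S_hat b (alt_index (2 * n + 1))) (i + 3) - (if i + 3 = 1 then wronski_coeff 1 (2 * n + 1)
        else if i + 3 = 2 then wronski_coeff 2 (2 * n + 1) else 0) \<in> mzv_space"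
      using zeta_S_hat_in_mzv_fps[OF is_index_alt_index] by simp
  qed
qed

end
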